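(* Let $\mathbb{K}$ be a field, $H$ a commutative Hopf $\mathbb{K}$-algebra with comultiplication $\Delta$, counit $\varepsilon$ and unit $\eta$, $A$ a $\mathbb{K}$-algebra (not necessarily commutative), $\delta:A\to H\otimes A$ an algebra left coaction of $H$ on $A$, and $M$ a left $A$-module. Then every left $(H\otimes A)$-module homomorphism $$\Theta:H\otimes M=(\eta\otimes\mathrm{id}_A)^\ast M\to\delta^\ast M=(H\otimes A)_\delta\otimes_A M$$ that satisfies $$(\mathrm{id}_H\otimes\delta)^\ast\Theta\circ(\eta\otimes\mathrm{id}_{H\otimes A})^\ast\Theta=(\Delta\otimes\mathrm{id}_A)^\ast\Theta\qquad\text{and}\qquad(\varepsilon\otimes\mathrm{id}_A)^\ast\Theta=\mathrm{id}_M$$ is an isomorphism.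
   Context: Unadorned tensor products are over $\mathbb{K}$; algebras are associative and unital, modules unital. An algebra left coaction $\delta:A\to H\otimes A$ is a $\mathbb{K}$-algebra homomorphism with $(\Delta\otimes\mathrm{id}_A)\circ\delta=(\mathrm{id}_H\otimes\delta)\circ\delta$ and $(\varepsilon\otimes\mathrm{id}_A)\circ\delta=\mathrm{id}_A$ (with $\mathbb{K}\otimes A=A$). For a $\mathbb{K}$-algebra homomorphism $\varphi:A\to B$ and a left $A$-module $M$, $\varphi^\ast M:=B\otimes_A M$ ($B$ being a right $A$-module via $\varphi$), a left $B$-module, with natural map $M\to\varphi^\ast M$, $m\mapsto 1\otimes m$; for an $A$-module homomorphism $g$, $\varphi^\ast g:=\mathrm{id}_B\otimes_A g$. $(H\otimes A)_\delta$ denotes $H\otimes A$ with the right $A$-module structure induced by $\delta$. $H\otimes M$ is a left $(H\otimes A)$-module by $(h\otimes a)(h'\otimes m)=hh'\otimes am$ and is identified with $(\eta\otimes\mathrm{id}_A)^\ast M$ (where $\eta\otimes\mathrm{id}_A:A\to H\otimes A$, $a\mapsto 1\otimes a$) via $(h\otimes a)\otimes m=h\otimes am$. Iterated extensions of scalars of $M$ along pairs of algebra maps with equal composites are identified via the unique isomorphism compatible with the natural maps from $M$. Explicitly, the two conditions are understood under the identifications $(\eta\otimes\mathrm{id}_{H\otimes A})^\ast\delta^\ast M=(\mathrm{id}_H\otimes\delta)^\ast(\eta\otimes\mathrm{id}_A)^\ast M$, $(\eta\otimes\mathrm{id}_{H\otimes A})^\ast(\eta\otimes\mathrm{id}_A)^\ast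 M=(\Delta\otimes\mathrm{id}_A)^\ast(\eta\otimes\mathrm{id}_A)^\ast M$, $(\mathrm{id}_H\otimes\delta)^\ast\delta^\ast M=(\Delta\otimes\mathrm{id}_A)^\ast\delta^\ast M$ (for the first condition), and $(\varepsilon\otimes\mathrm{id}_A)^\ast(\eta\otimes\mathrm{id}_A)^\ast M=M$, $(\varepsilon\otimes\mathrm{id}_A)^\ast\delta^\ast M=M$ (for the second). *)

theory Defs
  imports "HOL-Algebra.Module" "HOL-Algebra.Free_Abelian_Groups"
begin

section \<open>Algebras and modules over non-commutative rings\<close>

text \<open>HOL-Algebra's locale for algebras presupposes a commutative algebra, and its locale for modules
  a commutative base ring. As usual in HOL-Algebra, the record type of modules also carries
  multiplicative fields; these are irrelevant when the record stands for a mere module.\<close>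

locale assoc_algebra = module K A + ring A for K (structure) and A (structure) +
  assumes smult_mult_left:
      "\<lbrakk>k \<in> carrier K; x \<in> carrier A; y \<in> carrier A\<rbrakk> \<Longrightarrow>
        (k \<odot>\<^bsub>A\<^esub> x) \<otimes>\<^bsub>A\<^esub> y = k \<odot>\<^bsub>A\<^esub> (x \<otimes>\<^bsub>A\<^esub> y)"
    and smult_mult_right:
      "\<lbrakk>k \<in> carrier K; x \<in> carrier A; y \<in> carrier A\<rbrakk> \<Longrightarrow>
        x \<otimes>\<^bsub>A\<^esub> (k \<odot>\<^bsub>A\<^esub> y) = k \<odot>\<^bsub>A\<^esub> (x \<otimes>\<^bsub>A\<^esub> y)"

locale left_module = R?: ring R + M?: abelian_group M
  for R :: "('r, 'x) ring_scheme" (structure) and M :: "('r, 'm, 'y) module_scheme" (structure) +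
  assumes smult_closed:
      "\<lbrakk>a \<in> carrier R; x \<in> carrier M\<rbrakk> \<Longrightarrow> a \<odot>\<^bsub>M\<^esub> x \<in> carrier M"
    and smult_l_distr:
      "\<lbrakk>a \<in> carrier R; b \<in> carrier R; x \<in> carrier M\<rbrakk> \<Longrightarrow>
        (a \<oplus>\<^bsub>R\<^esub> b) \<odot>\<^bsub>M\<^esub> x = a \<odot>\<^bsub>M\<^esub> x \<oplus>\<^bsub>M\<^esub> b \<odot>\<^bsub>M\<^esub> x"
    and smult_r_distr:
      "\<lbrakk>a \<in> carrier R; x \<in> carrier M; y \<in> carrier M\<rbrakk> \<Longrightarrow>
        a \<odot>\<^bsub>M\<^esub> (x \<oplus>\<^bsub>M\<^esub> y) = a \<odot>\<^bsub>M\<^esub> x \<oplus>\<^bsub>M\<^esub> a \<odot>\<^bsub>M\<^esub> y"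
    and smult_assoc:
      "\<lbrakk>a \<in> carrier R; b \<in> carrier R; x \<in> carrier M\<rbrakk> \<Longrightarrow>
        (a \<otimes>\<^bsub>R\<^esub> b) \<odot>\<^bsub>M\<^esub> x = a \<odot>\<^bsub>M\<^esub> (b \<odot>\<^bsub>M\<^esub> x)"
    and smult_one:
      "x \<in> carrier M \<Longrightarrow> \<one>\<^bsub>R\<^esub> \<odot>\<^bsub>M\<^esub> x = x"

definition alg_hom ::
    "'k ring \<Rightarrow> ('k, 'a) module \<Rightarrow> ('k, 'b) module \<Rightarrow> ('a \<Rightarrow> 'b) set" where
  "alg_hom K A B = {f \<in> ring_hom A B.
     \<forall>k \<in> carrier K. \<forall>a \<in> carrier A. f (k \<odot>\<^bsub>A\<^esub> a) = k \<odot>\<^bsub>B\<^esub> f a}"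

definition left_module_hom ::
    "('r, 'x) ring_scheme \<Rightarrow> ('r, 'm) module \<Rightarrow> ('r, 'n) module \<Rightarrow> ('m \<Rightarrow> 'n) set" where
  "left_module_hom R M N = {f \<in> carrier M \<rightarrow> carrier N.
     (\<forall>x \<in> carrier M. \<forall>y \<in> carrier M. f (x \<oplus>\<^bsub>M\<^esub> y) = f x \<oplus>\<^bsub>N\<^esub> f y) \<and>
     (\<forall>r \<in> carrier R. \<forall>x \<in> carrier M. f (r \<odot>\<^bsub>M\<^esub> x) = r \<odot>\<^bsub>N\<^esub> f x)}"

definition left_module_iso ::
    "('r, 'x) ring_scheme \<Rightarrow> ('r, 'm) module \<Rightarrow> ('r, 'n) module \<Rightarrow> ('m \<Rightarrow> 'n) set" where
  "left_module_iso R M N = {f \<in> left_module_hom R M N. bij_betw f (carrier M) (carrier N)}"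

definition restrict_scalars :: "('k \<Rightarrow> 'a) \<Rightarrow> ('a, 'm) module \<Rightarrow> ('k, 'm) module" where
  "restrict_scalars \<phi> M =
     \<lparr>carrier = carrier M, monoid.mult = monoid.mult M, one = one M,
      ring.zero = ring.zero M, ring.add = ring.add M,
      smult = (\<lambda>k m. \<phi> k \<odot>\<^bsub>M\<^esub> m)\<rparr>"

definition base_ring_algebra :: "'k ring \<Rightarrow> ('k, 'k) module" where
  "base_ring_algebra K =
     \<lparr>carrier = carrier K, monoid.mult = monoid.mult K, one = one K,
      ring.zero = ring.zero K, ring.add = ring.add K,
      smult = monoid.mult K\<rparr>"


section \<open>Tensor products\<close>

text \<open>The tensor product over \<open>R\<close> of a right module \<open>N\<close>, with right action \<open>act\<close>, and a left
  module \<open>M\<close>: the free abelian group on pairs modulo the subgroup generated by the relations of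
  bi-additivity and \<open>R\<close>-balancedness. Its elements are cosets of finite formal sums.\<close>

type_synonym ('n, 'm) tensor = "('n \<times> 'm \<Rightarrow>\<^sub>0 int) set"

definition tensor_relations ::
    "('r, 'x) ring_scheme \<Rightarrow> ('n, 'y) ring_scheme \<Rightarrow> ('n \<Rightarrow> 'r \<Rightarrow> 'n) \<Rightarrow> ('r, 'm) module
      \<Rightarrow> ('n, 'm) tensor" where
  "tensor_relations R N act M =
     {frag_of (n \<oplus>\<^bsub>N\<^esub> n', m) - frag_of (n, m) - frag_of (n', m) |n n' m.
        n \<in> carrier N \<and> n' \<in> carrier N \<and> m \<in> carrier M} \<union>
     {frag_of (n, m \<oplus>\<^bsub>M\<^esub> m') - frag_of (n, m) - frag_of (n, m') |n m m'.
        n \<in> carrier N \<and> m \<in> carrier M \<and> m' \<in> carrier M} \<union>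
     {frag_of (act n r, m) - frag_of (n, r \<odot>\<^bsub>M\<^esub> m) |n r m.
        n \<in> carrier N \<and> r \<in> carrier R \<and> m \<in> carrier M}"

definition tensor_group ::
    "('r, 'x) ring_scheme \<Rightarrow> ('n, 'y) ring_scheme \<Rightarrow> ('n \<Rightarrow> 'r \<Rightarrow> 'n) \<Rightarrow> ('r, 'm) module
      \<Rightarrow> ('n, 'm) tensor monoid" where
  "tensor_group R N act M =
     (let F = free_Abelian_group (carrier N \<times> carrier M)
      in F Mod generate F (tensor_relations R N act M))"

definition pure_tensor ::
    "('r, 'x) ring_scheme \<Rightarrow> ('n, 'y) ring_scheme \<Rightarrow> ('n \<Rightarrow> 'r \<Rightarrow> 'n) \<Rightarrow> ('r, 'm) module
      \<Rightarrow> 'n \<Rightarrow> 'm \<Rightarrow> ('n, 'm) tensor" where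
  "pure_tensor R N act M n m =
     (let F = free_Abelian_group (carrier N \<times> carrier M)
      in generate F (tensor_relations R N act M) #>\<^bsub>F\<^esub> frag_of (n, m))"

text \<open>The additive map induced by a balanced map \<open>f\<close> into the abelian group \<open>G\<close> (written
  multiplicatively): the tensor represented by \<open>\<Sum>i. c\<^sub>i (n\<^sub>i, m\<^sub>i)\<close> is sent to
  \<open>\<Sum>i. c\<^sub>i f n\<^sub>i m\<^sub>i\<close>. For balanced \<open>f\<close> the choice of the representative is immaterial.\<close>

definition tensor_lift ::
    "('g, 'x) monoid_scheme \<Rightarrow> ('n \<Rightarrow> 'm \<Rightarrow> 'g) \<Rightarrow> ('n, 'm) tensor \<Rightarrow> 'g" where
  "tensor_lift G f X =
     (let c = (SOME c. c \<in> X)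
      in finprod G (\<lambda>p. f (fst p) (snd p) [^]\<^bsub>G\<^esub> Poly_Mapping.lookup c p) (Poly_Mapping.keys c))"


subsection \<open>Tensor products over the commutative base\<close>

abbreviation ktensor_group ::
    "'k ring \<Rightarrow> ('k, 'v) module \<Rightarrow> ('k, 'w) module \<Rightarrow> ('v, 'w) tensor monoid" where
  "ktensor_group K V W \<equiv> tensor_group K V (\<lambda>v k. k \<odot>\<^bsub>V\<^esub> v) W"

abbreviation ktensor ::
    "'k ring \<Rightarrow> ('k, 'v) module \<Rightarrow> ('k, 'w) module \<Rightarrow> 'v \<Rightarrow> 'w \<Rightarrow> ('v, 'w) tensor" where
  "ktensor K V W \<equiv> pure_tensor K V (\<lambda>v k. k \<odot>\<^bsub>V\<^esub> v) W"

definition tensor_algebra ::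
    "'k ring \<Rightarrow> ('k, 'a) module \<Rightarrow> ('k, 'b) module \<Rightarrow> ('k, ('a, 'b) tensor) module" where
  "tensor_algebra K A B =
     (let T = ktensor_group K A B
      in \<lparr>carrier = carrier T,
          monoid.mult = (\<lambda>x y. tensor_lift T (\<lambda>a b. tensor_lift T
             (\<lambda>a' b'. ktensor K A B (a \<otimes>\<^bsub>A\<^esub> a') (b \<otimes>\<^bsub>B\<^esub> b')) y) x),
          one = ktensor K A B \<one>\<^bsub>A\<^esub> \<one>\<^bsub>B\<^esub>,
          ring.zero = \<one>\<^bsub>T\<^esub>,
          ring.add = monoid.mult T,
          smult = (\<lambda>k. tensor_lift T (\<lambda>a b. ktensor K A B (k \<odot>\<^bsub>A\<^esub> a) b))\<rparr>)"

definition tensor_map ::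
    "'k ring \<Rightarrow> ('k, 'c) module \<Rightarrow> ('k, 'd) module \<Rightarrow> ('a \<Rightarrow> 'c) \<Rightarrow> ('b \<Rightarrow> 'd)
      \<Rightarrow> ('a, 'b) tensor \<Rightarrow> ('c, 'd) tensor" where
  "tensor_map K C D f g =
     tensor_lift (ktensor_group K C D) (\<lambda>a b. ktensor K C D (f a) (g b))"

text \<open>The associator from \<open>(A \<otimes> B) \<otimes> C\<close> to \<open>A \<otimes> (B \<otimes> C)\<close>.\<close>

definition tensor_assoc ::
    "'k ring \<Rightarrow> ('k, 'a) module \<Rightarrow> ('k, 'b) module \<Rightarrow> ('k, 'c) module
      \<Rightarrow> (('a, 'b) tensor, 'c) tensor \<Rightarrow> ('a, ('b, 'c) tensor) tensor" where
  "tensor_assoc K A B C =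
     (let BC = tensor_algebra K B C; T = ktensor_group K A BC
      in tensor_lift T (\<lambda>x c. tensor_lift T (\<lambda>a b. ktensor K A BC a (ktensor K B C b c)) x))"

text \<open>For a linear form \<open>\<epsilon>\<close> on \<open>H\<close>, the maps \<open>\<epsilon> \<otimes> id\<close> and \<open>id \<otimes> \<epsilon>\<close>, composed with the
  identifications \<open>\<bbbK> \<otimes> A = A\<close> and \<open>A \<otimes> \<bbbK> = A\<close>.\<close>

definition contract_left ::
    "('k, 'a) module \<Rightarrow> ('h \<Rightarrow> 'k) \<Rightarrow> ('h, 'a) tensor \<Rightarrow> 'a" where
  "contract_left A \<epsilon> = tensor_lift (add_monoid A) (\<lambda>h a. \<epsilon> h \<odot>\<^bsub>A\<^esub> a)"

definition contract_right ::
    "('k, 'a) module \<Rightarrow> ('h \<Rightarrow> 'k) \<Rightarrow> ('a, 'h) tensor \<Rightarrow> 'a" where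
  "contract_right A \<epsilon> = tensor_lift (add_monoid A) (\<lambda>a h. \<epsilon> h \<odot>\<^bsub>A\<^esub> a)"


section \<open>Hopf algebras and coactions\<close>

locale commutative_hopf_algebra = algebra K H for K :: "'k ring" and H :: "('k, 'h) module" +
  fixes \<Delta> :: "'h \<Rightarrow> ('h, 'h) tensor" and \<epsilon> :: "'h \<Rightarrow> 'k" and S :: "'h \<Rightarrow> 'h"
  assumes comult_hom: "\<Delta> \<in> alg_hom K H (tensor_algebra K H H)"
    and counit_hom: "\<epsilon> \<in> alg_hom K H (base_ring_algebra K)"
    and coassoc: "h \<in> carrier H \<Longrightarrow>
      tensor_assoc K H H H (tensor_map K (tensor_algebra K H H) H \<Delta> id (\<Delta> h)) =
      tensor_map K H (tensor_algebra K H H) id \<Delta> (\<Delta> h)"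
    and counit_left: "h \<in> carrier H \<Longrightarrow> contract_left H \<epsilon> (\<Delta> h) = h"
    and counit_right: "h \<in> carrier H \<Longrightarrow> contract_right H \<epsilon> (\<Delta> h) = h"
    and antipode_linear: "S \<in> left_module_hom K H H"
    and antipode_left: "h \<in> carrier H \<Longrightarrow>
      tensor_lift (add_monoid H) (\<lambda>x y. S x \<otimes>\<^bsub>H\<^esub> y) (\<Delta> h) = \<epsilon> h \<odot>\<^bsub>H\<^esub> \<one>\<^bsub>H\<^esub>"
    and antipode_right: "h \<in> carrier H \<Longrightarrow>
      tensor_lift (add_monoid H) (\<lambda>x y. x \<otimes>\<^bsub>H\<^esub> S y) (\<Delta> h) = \<epsilon> h \<odot>\<^bsub>H\<^esub> \<one>\<^bsub>H\<^esub>"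

text \<open>The map \<open>\<Delta> \<otimes> id\<close> from \<open>H \<otimes> A\<close> to \<open>H \<otimes> H \<otimes> A\<close>, the latter bracketed to the right.\<close>

definition comult_tensor_id ::
    "'k ring \<Rightarrow> ('k, 'h) module \<Rightarrow> ('k, 'a) module \<Rightarrow> ('h \<Rightarrow> ('h, 'h) tensor)
      \<Rightarrow> ('h, 'a) tensor \<Rightarrow> ('h, ('h, 'a) tensor) tensor" where
  "comult_tensor_id K H A \<Delta> x =
     tensor_assoc K H H A (tensor_map K (tensor_algebra K H H) A \<Delta> id x)"

definition id_tensor_coaction ::
    "'k ring \<Rightarrow> ('k, 'h) module \<Rightarrow> ('k, 'a) module \<Rightarrow> ('a \<Rightarrow> ('h, 'a) tensor)
      \<Rightarrow> ('h, 'a) tensor \<Rightarrow> ('h, ('h, 'a) tensor) tensor" where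
  "id_tensor_coaction K H A \<delta> = tensor_map K H (tensor_algebra K H A) id \<delta>"

definition unit_tensor_id ::
    "'k ring \<Rightarrow> ('k, 'h) module \<Rightarrow> ('k, 'a) module \<Rightarrow> 'a \<Rightarrow> ('h, 'a) tensor" where
  "unit_tensor_id K H A a = ktensor K H A \<one>\<^bsub>H\<^esub> a"

definition algebra_left_coaction ::
    "'k ring \<Rightarrow> ('k, 'h) module \<Rightarrow> ('h \<Rightarrow> ('h, 'h) tensor) \<Rightarrow> ('h \<Rightarrow> 'k) \<Rightarrow> ('k, 'a) module
      \<Rightarrow> ('a \<Rightarrow> ('h, 'a) tensor) \<Rightarrow> bool" where
  "algebra_left_coaction K H \<Delta> \<epsilon> A \<delta> \<longleftrightarrow>
     \<delta> \<in> alg_hom K A (tensor_algebra K H A) \<and>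
     (\<forall>a \<in> carrier A. comult_tensor_id K H A \<Delta> (\<delta> a) = id_tensor_coaction K H A \<delta> (\<delta> a)) \<and>
     (\<forall>a \<in> carrier A. contract_left A \<epsilon> (\<delta> a) = a)"

text \<open>\<open>H \<otimes> M\<close> as a left module over \<open>H \<otimes> A\<close>; the vector space structure of \<open>M\<close> is the one
  induced by \<open>\<bbbK> \<rightarrow> A\<close>.\<close>

definition scalars_module ::
    "('k, 'a) module \<Rightarrow> ('a, 'm) module \<Rightarrow> ('k, 'm) module" where
  "scalars_module A M = restrict_scalars (\<lambda>k. k \<odot>\<^bsub>A\<^esub> \<one>\<^bsub>A\<^esub>) M"

definition tensor_module ::
    "'k ring \<Rightarrow> ('k, 'h) module \<Rightarrow> ('k, 'a) module \<Rightarrow> ('a, 'm) module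
      \<Rightarrow> (('h, 'a) tensor, ('h, 'm) tensor) module" where
  "tensor_module K H A M =
     (let V = scalars_module A M; T = ktensor_group K H V
      in \<lparr>carrier = carrier T, monoid.mult = undefined, one = undefined,
          ring.zero = \<one>\<^bsub>T\<^esub>, ring.add = monoid.mult T,
          smult = (\<lambda>x y. tensor_lift T (\<lambda>h a. tensor_lift T
             (\<lambda>h' m. ktensor K H V (h \<otimes>\<^bsub>H\<^esub> h') (a \<odot>\<^bsub>M\<^esub> m)) y) x)\<rparr>)"


section \<open>Extension of scalars\<close>

definition ext_scalars_group ::
    "('a, 'x) ring_scheme \<Rightarrow> ('b, 'y) ring_scheme \<Rightarrow> ('a \<Rightarrow> 'b) \<Rightarrow> ('a, 'm) module
      \<Rightarrow> ('b, 'm) tensor monoid" where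
  "ext_scalars_group A B \<phi> M = tensor_group A B (\<lambda>b a. b \<otimes>\<^bsub>B\<^esub> \<phi> a) M"

definition ext_scalars_pure ::
    "('a, 'x) ring_scheme \<Rightarrow> ('b, 'y) ring_scheme \<Rightarrow> ('a \<Rightarrow> 'b) \<Rightarrow> ('a, 'm) module
      \<Rightarrow> 'b \<Rightarrow> 'm \<Rightarrow> ('b, 'm) tensor" where
  "ext_scalars_pure A B \<phi> M = pure_tensor A B (\<lambda>b a. b \<otimes>\<^bsub>B\<^esub> \<phi> a) M"

text \<open>The left \<open>B\<close>-module \<open>\<phi>\<^sup>* M = B \<otimes>\<^sub>A M\<close>, the natural map \<open>M \<rightarrow> \<phi>\<^sup>* M\<close>, and the
  homomorphism \<open>\<phi>\<^sup>* g : \<phi>\<^sup>* M \<rightarrow> \<phi>\<^sup>* N\<close> for \<open>g : M \<rightarrow> N\<close>.\<close>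

definition ext_scalars ::
    "('a, 'x) ring_scheme \<Rightarrow> ('b, 'y) ring_scheme \<Rightarrow> ('a \<Rightarrow> 'b) \<Rightarrow> ('a, 'm) module
      \<Rightarrow> ('b, ('b, 'm) tensor) module" where
  "ext_scalars A B \<phi> M =
     (let T = ext_scalars_group A B \<phi> M
      in \<lparr>carrier = carrier T, monoid.mult = undefined, one = undefined,
          ring.zero = \<one>\<^bsub>T\<^esub>, ring.add = monoid.mult T,
          smult = (\<lambda>b. tensor_lift T (\<lambda>b' m. ext_scalars_pure A B \<phi> M (b \<otimes>\<^bsub>B\<^esub> b') m))\<rparr>)"

definition ext_scalars_nat ::
    "('a, 'x) ring_scheme \<Rightarrow> ('b, 'y) ring_scheme \<Rightarrow> ('a \<Rightarrow> 'b) \<Rightarrow> ('a, 'm) module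
      \<Rightarrow> 'm \<Rightarrow> ('b, 'm) tensor" where
  "ext_scalars_nat A B \<phi> M m = ext_scalars_pure A B \<phi> M \<one>\<^bsub>B\<^esub> m"

definition ext_scalars_map ::
    "('a, 'x) ring_scheme \<Rightarrow> ('b, 'y) ring_scheme \<Rightarrow> ('a \<Rightarrow> 'b) \<Rightarrow> ('a, 'n) module
      \<Rightarrow> ('m \<Rightarrow> 'n) \<Rightarrow> ('b, 'm) tensor \<Rightarrow> ('b, 'n) tensor" where
  "ext_scalars_map A B \<phi> N g =
     tensor_lift (ext_scalars_group A B \<phi> N) (\<lambda>b m. ext_scalars_pure A B \<phi> N b (g m))"

text \<open>The unique isomorphism of left \<open>C\<close>-modules from \<open>P\<close> to \<open>Q\<close> compatible with maps
  \<open>p : M \<rightarrow> P\<close> and \<open>q : M \<rightarrow> Q\<close>; it is made \<open>undefined\<close> off the carrier of \<open>P\<close> in order to be unique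
  as a HOL function.\<close>

definition compatible_iso ::
    "('c, 'x) ring_scheme \<Rightarrow> ('a, 'm) module \<Rightarrow> ('c, 'p) module \<Rightarrow> ('m \<Rightarrow> 'p)
      \<Rightarrow> ('c, 'q) module \<Rightarrow> ('m \<Rightarrow> 'q) \<Rightarrow> 'p \<Rightarrow> 'q" where
  "compatible_iso C M P p Q q =
     (THE i. i \<in> left_module_iso C P Q \<and> i \<in> extensional (carrier P) \<and>
        (\<forall>m \<in> carrier M. i (p m) = q m))"

text \<open>For \<open>f, f' : A \<rightarrow> B\<close> and \<open>g, g' : B \<rightarrow> C\<close> with \<open>g \<circ> f = g' \<circ> f'\<close>, the identification
  \<open>g\<^sup>* f\<^sup>* M = g'\<^sup>* f'\<^sup>* M\<close>; and for \<open>f : A \<rightarrow> B\<close> and \<open>g : B \<rightarrow> A\<close> with \<open>g \<circ> f = id\<close>, the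
  identification \<open>g\<^sup>* f\<^sup>* M = M\<close>.\<close>

definition iterated_ext_ident ::
    "('a, 'x) ring_scheme \<Rightarrow> ('b, 'y) ring_scheme \<Rightarrow> ('c, 'z) ring_scheme
      \<Rightarrow> ('a \<Rightarrow> 'b) \<Rightarrow> ('b \<Rightarrow> 'c) \<Rightarrow> ('a \<Rightarrow> 'b) \<Rightarrow> ('b \<Rightarrow> 'c) \<Rightarrow> ('a, 'm) module
      \<Rightarrow> ('c, ('b, 'm) tensor) tensor \<Rightarrow> ('c, ('b, 'm) tensor) tensor" where
  "iterated_ext_ident A B C f g f' g' M =
     compatible_iso C M
       (ext_scalars B C g (ext_scalars A B f M))
       (ext_scalars_nat B C g (ext_scalars A B f M) \<circ> ext_scalars_nat A B f M)
       (ext_scalars B C g' (ext_scalars A B f' M))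
       (ext_scalars_nat B C g' (ext_scalars A B f' M) \<circ> ext_scalars_nat A B f' M)"

definition retract_ext_ident ::
    "('a, 'x) ring_scheme \<Rightarrow> ('b, 'y) ring_scheme \<Rightarrow> ('a \<Rightarrow> 'b) \<Rightarrow> ('b \<Rightarrow> 'a) \<Rightarrow> ('a, 'm) module
      \<Rightarrow> ('a, ('b, 'm) tensor) tensor \<Rightarrow> 'm" where
  "retract_ext_ident A B f g M =
     compatible_iso A M
       (ext_scalars B A g (ext_scalars A B f M))
       (ext_scalars_nat B A g (ext_scalars A B f M) \<circ> ext_scalars_nat A B f M)
       M id"


section \<open>The conditions on \<open>\<Theta>\<close>\<close>

text \<open>The identification \<open>(\<eta> \<otimes> id)\<^sup>* M = H \<otimes> M\<close>, \<open>(h \<otimes> a) \<otimes> m = h \<otimes> am\<close>, and \<open>\<Theta>\<close>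
  regarded as a map on \<open>(\<eta> \<otimes> id)\<^sup>* M\<close> through it.\<close>

definition unit_ext_ident ::
    "'k ring \<Rightarrow> ('k, 'h) module \<Rightarrow> ('k, 'a) module \<Rightarrow> ('a, 'm) module
      \<Rightarrow> (('h, 'a) tensor, 'm) tensor \<Rightarrow> ('h, 'm) tensor" where
  "unit_ext_ident K H A M =
     (let V = scalars_module A M; T = ktensor_group K H V
      in tensor_lift T (\<lambda>x m. tensor_lift T (\<lambda>h a. ktensor K H V h (a \<odot>\<^bsub>M\<^esub> m)) x))"

definition on_unit_ext ::
    "'k ring \<Rightarrow> ('k, 'h) module \<Rightarrow> ('k, 'a) module \<Rightarrow> ('a, 'm) module
      \<Rightarrow> (('h, 'm) tensor \<Rightarrow> 'q) \<Rightarrow> (('h, 'a) tensor, 'm) tensor \<Rightarrow> 'q" where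
  "on_unit_ext K H A M \<Theta> = \<Theta> \<circ> unit_ext_ident K H A M"

text \<open>\<open>(id \<otimes> \<delta>)\<^sup>* \<Theta> \<circ> (\<eta> \<otimes> id)\<^sup>* \<Theta> = (\<Delta> \<otimes> id)\<^sup>* \<Theta>\<close>, with the three identifications
  made explicit. The maps \<open>u\<close>, \<open>u'\<close>, \<open>d\<close>, \<open>D\<close> below are
  \<open>\<eta> \<otimes> id\<^sub>A\<close>, \<open>\<eta> \<otimes> id\<close> on \<open>H \<otimes> A\<close>, \<open>id \<otimes> \<delta>\<close> and \<open>\<Delta> \<otimes> id\<close>.\<close>

definition multiplicativity_condition ::
    "'k ring \<Rightarrow> ('k, 'h) module \<Rightarrow> ('h \<Rightarrow> ('h, 'h) tensor) \<Rightarrow> ('k, 'a) module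
      \<Rightarrow> ('a \<Rightarrow> ('h, 'a) tensor) \<Rightarrow> ('a, 'm) module
      \<Rightarrow> (('h, 'm) tensor \<Rightarrow> (('h, 'a) tensor, 'm) tensor) \<Rightarrow> bool" where
  "multiplicativity_condition K H \<Delta> A \<delta> M \<Theta> \<longleftrightarrow>
     (let HA = tensor_algebra K H A;
          HHA = tensor_algebra K H HA;
          u = unit_tensor_id K H A;
          u' = unit_tensor_id K H HA;
          d = id_tensor_coaction K H A \<delta>;
          D = comult_tensor_id K H A \<Delta>;
          uM = ext_scalars A HA u M;
          \<delta>M = ext_scalars A HA \<delta> M;
          \<Theta>' = on_unit_ext K H A M \<Theta>;
          i\<^sub>1 = iterated_ext_ident A HA HHA \<delta> u' u d M;
          i\<^sub>2 = iterated_ext_ident A HA HHA u u' u D M;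
          i\<^sub>3 = iterated_ext_ident A HA HHA \<delta> d \<delta> D M
      in \<forall>x \<in> carrier (ext_scalars HA HHA u' uM).
           i\<^sub>3 (ext_scalars_map HA HHA d \<delta>M \<Theta>' (i\<^sub>1 (ext_scalars_map HA HHA u' \<delta>M \<Theta>' x))) =
           ext_scalars_map HA HHA D \<delta>M \<Theta>' (i\<^sub>2 x))"

text \<open>\<open>(\<epsilon> \<otimes> id)\<^sup>* \<Theta> = id\<close>, both sides of \<open>(\<epsilon> \<otimes> id)\<^sup>* \<Theta>\<close> being identified with \<open>M\<close>.\<close>

definition unitality_condition ::
    "'k ring \<Rightarrow> ('k, 'h) module \<Rightarrow> ('h \<Rightarrow> 'k) \<Rightarrow> ('k, 'a) module
      \<Rightarrow> ('a \<Rightarrow> ('h, 'a) tensor) \<Rightarrow> ('a, 'm) module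
      \<Rightarrow> (('h, 'm) tensor \<Rightarrow> (('h, 'a) tensor, 'm) tensor) \<Rightarrow> bool" where
  "unitality_condition K H \<epsilon> A \<delta> M \<Theta> \<longleftrightarrow>
     (let HA = tensor_algebra K H A;
          u = unit_tensor_id K H A;
          e = contract_left A \<epsilon>;
          uM = ext_scalars A HA u M;
          \<delta>M = ext_scalars A HA \<delta> M;
          \<Theta>' = on_unit_ext K H A M \<Theta>
      in \<forall>x \<in> carrier (ext_scalars HA A e uM).
           retract_ext_ident A HA \<delta> e M (ext_scalars_map HA A e \<delta>M \<Theta>' x) =
           retract_ext_ident A HA u e M x)"

end

theory Submission
  imports Defs
begin

text \<open>Write \<open>B = H \<otimes> A\<close>, \<open>C = H \<otimes> H \<otimes> A\<close>, \<open>u = \<eta> \<otimes> id\<close> on \<open>A\<close>, \<open>u' = \<eta> \<otimes> id\<close> on \<open>B\<close>, \<open>d = id \<otimes> \<delta>\<close>,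
  \<open>D = \<Delta> \<otimes> id\<close> and \<open>e = \<epsilon> \<otimes> id\<close>. The antipode provides ring homomorphisms \<open>f, f' : C \<rightarrow> B\<close> with
  \<open>f u' = id\<close>, \<open>f D = u e\<close>, \<open>f' d = id\<close> and \<open>f' D = \<delta> e\<close>. Extending scalars in the cocycle identity
  \<open>d\<^sup>*\<Theta> \<circ> u'\<^sup>*\<Theta> = D\<^sup>*\<Theta>\<close> along \<open>f\<close> gives \<open>(f d)\<^sup>*\<Theta> \<circ> \<Theta> = u\<^sup>*e\<^sup>*\<Theta> = id\<close>, and extending along \<open>f'\<close>
  gives \<open>\<Theta> \<circ> (f' u')\<^sup>*\<Theta> = \<delta>\<^sup>*e\<^sup>*\<Theta> = id\<close>. On elements, these extensions are semilinear maps out of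
  \<open>D\<^sup>* \<delta>\<^sup>* M\<close>, determined by their values on the image of \<open>M\<close>.\<close>


section \<open>The universal property of the tensor product\<close>

text \<open>The antipode axioms give only a linear \<open>S\<close>, whereas \<open>f\<close> and
  \<open>f'\<close> have to be multiplicative. Two facts close this gap, and both rest on the
  commutativity of \<open>H\<close>: \<open>S\<close> is an algebra homomorphism
  (\<open>antipode_alg_hom\<close>), and the elements \<open>h \<otimes> 1\<close> are central in
  \<open>H \<otimes> A\<close> although \<open>A\<close> may be noncommutative. The two pullbacks do
  different work: \<open>f\<close> produces a linear left inverse of \<open>\<Theta>\<close>, hence
  injectivity, while \<open>f'\<close> puts the natural generators of
  \<open>\<delta>\<^sup>* M\<close> into the image of the linear map \<open>\<Theta>\<close>, hence
  surjectivity. A second obstacle is the encoding: induced maps depend formally on a chosen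
  representative of a coset, and the identifications are definite descriptions. Before any value can
  be computed, balancedness and unique existence have to be established, which is why universal
  properties come first.\<close>

definition additive_map :: "('q, 'x) ring_scheme \<Rightarrow> ('p, 'y) ring_scheme \<Rightarrow> ('q \<Rightarrow> 'p) \<Rightarrow> bool" where
  "additive_map Q P f \<longleftrightarrow> f \<in> carrier Q \<rightarrow> carrier P \<and>
     (\<forall>x \<in> carrier Q. \<forall>y \<in> carrier Q. f (x \<oplus>\<^bsub>Q\<^esub> y) = f x \<oplus>\<^bsub>P\<^esub> f y)"

definition balanced_map ::
    "('r, 'x) ring_scheme \<Rightarrow> ('n, 'y) ring_scheme \<Rightarrow> ('n \<Rightarrow> 'r \<Rightarrow> 'n) \<Rightarrow> ('r, 'm) module
      \<Rightarrow> ('p, 'z) ring_scheme \<Rightarrow> ('n \<Rightarrow> 'm \<Rightarrow> 'p) \<Rightarrow> bool" where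
  "balanced_map R N act M P f \<longleftrightarrow>
     (\<forall>n \<in> carrier N. additive_map M P (f n)) \<and>
     (\<forall>m \<in> carrier M. additive_map N P (\<lambda>n. f n m)) \<and>
     (\<forall>n \<in> carrier N. \<forall>r \<in> carrier R. \<forall>m \<in> carrier M. f (act n r) m = f n (r \<odot>\<^bsub>M\<^esub> m))"

text \<open>The two monoids that occur as first argument of \<^const>\<open>tensor_lift\<close> for a given target, namely
  \<open>add_monoid P\<close> and a tensor group, have different record types.\<close>

definition add_group_of :: "('p, 'x) monoid_scheme \<Rightarrow> ('p, 'y) ring_scheme \<Rightarrow> bool" where
  "add_group_of G P \<longleftrightarrow> comm_group G \<and> carrier G = carrier P \<and>
     monoid.mult G = ring.add P \<and> one G = ring.zero P"

lemma (in abelian_group) add_group_of_add_monoid: "add_group_of (add_monoid G) G"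
  by (simp add: add_group_of_def a_comm_group)

lemma additive_mapI:
  "\<lbrakk>\<And>x. x \<in> carrier Q \<Longrightarrow> f x \<in> carrier P;
    \<And>x y. \<lbrakk>x \<in> carrier Q; y \<in> carrier Q\<rbrakk> \<Longrightarrow> f (x \<oplus>\<^bsub>Q\<^esub> y) = f x \<oplus>\<^bsub>P\<^esub> f y\<rbrakk>
    \<Longrightarrow> additive_map Q P f"
  by (simp add: additive_map_def)

lemma additive_map_closed: "\<lbrakk>additive_map Q P f; x \<in> carrier Q\<rbrakk> \<Longrightarrow> f x \<in> carrier P"
  by (auto simp: additive_map_def)

lemma additive_map_add:
  "\<lbrakk>additive_map Q P f; x \<in> carrier Q; y \<in> carrier Q\<rbrakk> \<Longrightarrow> f (x \<oplus>\<^bsub>Q\<^esub> y) = f x \<oplus>\<^bsub>P\<^esub> f y"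
  by (auto simp: additive_map_def)

lemma additive_map_plus:
  assumes "abelian_group P" "additive_map Q P f" "additive_map Q P g"
  shows "additive_map Q P (\<lambda>x. f x \<oplus>\<^bsub>P\<^esub> g x)"
proof -
  interpret P: abelian_group P by fact
  show ?thesis
    using assms(2,3) by (auto simp: additive_map_def Pi_iff P.a_ac)
qed

lemma balanced_mapI:
  assumes "\<And>n m. \<lbrakk>n \<in> carrier N; m \<in> carrier M\<rbrakk> \<Longrightarrow> f n m \<in> carrier P"
    and "\<And>n m m'. \<lbrakk>n \<in> carrier N; m \<in> carrier M; m' \<in> carrier M\<rbrakk> \<Longrightarrow>
      f n (m \<oplus>\<^bsub>M\<^esub> m') = f n m \<oplus>\<^bsub>P\<^esub> f n m'"
    and "\<And>n n' m. \<lbrakk>n \<in> carrier N; n' \<in> carrier N; m \<in> carrier M\<rbrakk> \<Longrightarrow>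
      f (n \<oplus>\<^bsub>N\<^esub> n') m = f n m \<oplus>\<^bsub>P\<^esub> f n' m"
    and "\<And>n r m. \<lbrakk>n \<in> carrier N; r \<in> carrier R; m \<in> carrier M\<rbrakk> \<Longrightarrow>
      f (act n r) m = f n (r \<odot>\<^bsub>M\<^esub> m)"
  shows "balanced_map R N act M P f"
  using assms by (auto simp: balanced_map_def additive_map_def)

lemma balanced_mapD:
  assumes "balanced_map R N act M P f"
  shows "\<And>n m. \<lbrakk>n \<in> carrier N; m \<in> carrier M\<rbrakk> \<Longrightarrow> f n m \<in> carrier P"
    and "\<And>n m m'. \<lbrakk>n \<in> carrier N; m \<in> carrier M; m' \<in> carrier M\<rbrakk> \<Longrightarrow>
      f n (m \<oplus>\<^bsub>M\<^esub> m') = f n m \<oplus>\<^bsub>P\<^esub> f n m'"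
    and "\<And>n n' m. \<lbrakk>n \<in> carrier N; n' \<in> carrier N; m \<in> carrier M\<rbrakk> \<Longrightarrow>
      f (n \<oplus>\<^bsub>N\<^esub> n') m = f n m \<oplus>\<^bsub>P\<^esub> f n' m"
    and "\<And>n r m. \<lbrakk>n \<in> carrier N; r \<in> carrier R; m \<in> carrier M\<rbrakk> \<Longrightarrow>
      f (act n r) m = f n (r \<odot>\<^bsub>M\<^esub> m)"
  using assms by (auto simp: balanced_map_def additive_map_def)

text \<open>Freeness in explicit form: a map on the basis extends to formal sums by the very formula
  that \<open>tensor_lift\<close> applies to a representative.\<close>

lemma (in comm_group) free_Abelian_group_extension_hom:
  assumes f: "\<And>p. p \<in> X \<Longrightarrow> f p \<in> carrier G"
  shows "(\<lambda>c. finprod G (\<lambda>p. f p [^] Poly_Mapping.lookup c p) (Poly_Mapping.keys c))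
           \<in> hom (free_Abelian_group X) G"
proof (rule homI)
  fix c assume "c \<in> carrier (free_Abelian_group X)"
  then show "finprod G (\<lambda>p. f p [^] Poly_Mapping.lookup c p) (Poly_Mapping.keys c) \<in> carrier G"
    using f by (auto intro!: finprod_closed)
next
  fix c d assume "c \<in> carrier (free_Abelian_group X)" "d \<in> carrier (free_Abelian_group X)"
  then have cX: "Poly_Mapping.keys c \<subseteq> X" and dX: "Poly_Mapping.keys d \<subseteq> X" by auto
  \<comment> \<open>A common support for \<open>c\<close>, \<open>d\<close> and
    \<open>c + d\<close>; the extra basis elements have exponent 0 and contribute the neutral
    element, so the product splits over one index set.\<close>
  define Z where "Z = Poly_Mapping.keys c \<union> Poly_Mapping.keys d"
  have Z: "finite Z" "Z \<subseteq> X" using cX dX by (auto simp: Z_def)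
  have ext: "finprod G (\<lambda>p. f p [^] Poly_Mapping.lookup b p) (Poly_Mapping.keys b) =
      finprod G (\<lambda>p. f p [^] Poly_Mapping.lookup b p) Z" if "Poly_Mapping.keys b \<subseteq> Z" for b :: "_ \<Rightarrow>\<^sub>0 int"
    using Z f that by (intro finprod_mono_neutral_cong_left) (auto simp: in_keys_iff)
  have "finprod G (\<lambda>p. f p [^] Poly_Mapping.lookup (c + d) p) (Poly_Mapping.keys (c + d)) =
      finprod G (\<lambda>p. f p [^] Poly_Mapping.lookup c p \<otimes> f p [^] Poly_Mapping.lookup d p) Z"
    using Z f keys_add[of c d]
    by (subst ext) (auto simp: Z_def lookup_add int_pow_mult intro!: finprod_cong')
  also have "\<dots> = finprod G (\<lambda>p. f p [^] Poly_Mapping.lookup c p) Z \<otimes>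
      finprod G (\<lambda>p. f p [^] Poly_Mapping.lookup d p) Z"
    using Z f by (intro finprod_multf) auto
  finally show "finprod G (\<lambda>p. f p [^] Poly_Mapping.lookup (c \<otimes>\<^bsub>free_Abelian_group X\<^esub> d) p)
        (Poly_Mapping.keys (c \<otimes>\<^bsub>free_Abelian_group X\<^esub> d)) =
      finprod G (\<lambda>p. f p [^] Poly_Mapping.lookup c p) (Poly_Mapping.keys c) \<otimes>
      finprod G (\<lambda>p. f p [^] Poly_Mapping.lookup d p) (Poly_Mapping.keys d)"
    by (simp add: ext Z_def)
qed

text \<open>The same quotient group occurs as additive part of several records, with different
  scalars. The parameter \<open>Q\<close> stands for any of them, so that the universal property is
  proved once for \<open>ext_scalars\<close> and \<open>tensor_algebra\<close>.\<close>

locale tensor_product = N: abelian_group N + M: abelian_group M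
  for R :: "('r, 'x) ring_scheme" and N :: "('n, 'y) ring_scheme"
    and act :: "'n \<Rightarrow> 'r \<Rightarrow> 'n" and M :: "('r, 'm) module"
    and Q :: "(('n, 'm) tensor, 'q) ring_scheme" +
  assumes act_closed: "\<lbrakk>n \<in> carrier N; r \<in> carrier R\<rbrakk> \<Longrightarrow> act n r \<in> carrier N"
    and smult_closed: "\<lbrakk>r \<in> carrier R; m \<in> carrier M\<rbrakk> \<Longrightarrow> r \<odot>\<^bsub>M\<^esub> m \<in> carrier M"
    and carrier_eq: "carrier Q = carrier (tensor_group R N act M)"
    and add_eq: "ring.add Q = monoid.mult (tensor_group R N act M)"
    and zero_eq: "ring.zero Q = one (tensor_group R N act M)"
begin

abbreviation (input) "F \<equiv> free_Abelian_group (carrier N \<times> carrier M)"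
abbreviation (input) "rels \<equiv> generate F (tensor_relations R N act M)"
abbreviation (input) "pure \<equiv> pure_tensor R N act M"

lemma F_comm_group: "comm_group F"
  by (rule abelian_free_Abelian_group)

lemma relations_in_F: "tensor_relations R N act M \<subseteq> carrier F"
proof -
  have of: "frag_of (n, m) \<in> carrier F" if "n \<in> carrier N" "m \<in> carrier M" for n m
    using that by simp
  have diff: "x - y \<in> carrier F" if "x \<in> carrier F" "y \<in> carrier F" for x y
  proof -
    have "Poly_Mapping.keys x \<union> Poly_Mapping.keys y \<subseteq> carrier N \<times> carrier M"
      using that by simp
    then show ?thesis
      unfolding carrier_free_Abelian_group_iff by (rule order_trans[OF keys_diff])
  qed
  show ?thesis
    unfolding tensor_relations_def
    by (intro Un_least subsetI; elim CollectE exE conjE; hypsubst)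
      (intro diff of act_closed smult_closed N.a_closed M.a_closed; assumption)+
qed

lemma rels_subgroup: "subgroup rels F"
  by (rule group.generate_is_subgroup[OF group_free_Abelian_group relations_in_F])

lemma rels_normal: "rels \<lhd> F"
  by (rule comm_group.subgroup_imp_normal[OF F_comm_group rels_subgroup])

lemma tensor_group_eq: "tensor_group R N act M = F Mod rels"
  by (simp add: tensor_group_def Let_def)

lemma pure_eq: "pure n m = rels #>\<^bsub>F\<^esub> frag_of (n, m)"
  by (simp add: pure_tensor_def Let_def)

lemma comm_group_tensor_group: "comm_group (tensor_group R N act M)"
  unfolding tensor_group_eq
  by (rule comm_group.abelian_FactGroup[OF F_comm_group rels_subgroup])

lemma abelian_group_tensor: "abelian_group Q"
proof (intro abelian_group.intro abelian_group_axioms.intro)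
  interpret T: comm_group "tensor_group R N act M" by (rule comm_group_tensor_group)
  show "abelian_monoid Q"
    by (rule abelian_monoidI)
      (simp_all add: carrier_eq add_eq zero_eq T.m_ac)
  show "comm_group (add_monoid Q)"
    by (rule comm_groupI) (simp_all add: carrier_eq add_eq zero_eq T.m_ac)
qed

lemma add_group_of_tensor_group: "add_group_of (tensor_group R N act M) Q"
  by (simp add: add_group_of_def comm_group_tensor_group carrier_eq add_eq zero_eq)

lemma carrier_iff: "X \<in> carrier Q \<longleftrightarrow> (\<exists>c \<in> carrier F. X = rels #>\<^bsub>F\<^esub> c)"
  unfolding carrier_eq tensor_group_eq carrier_FactGroup by blast

lemma coset_add:
  "\<lbrakk>c \<in> carrier F; d \<in> carrier F\<rbrakk> \<Longrightarrow>
    (rels #>\<^bsub>F\<^esub> c) \<oplus>\<^bsub>Q\<^esub> (rels #>\<^bsub>F\<^esub> d) = rels #>\<^bsub>F\<^esub> (c + d)"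
  using normal.rcos_sum[OF rels_normal, of c d] by (simp add: add_eq tensor_group_eq)

lemma coset_eqI:
  assumes "c \<in> carrier F" "d \<in> carrier F" "c - d \<in> rels"
  shows "rels #>\<^bsub>F\<^esub> c = rels #>\<^bsub>F\<^esub> d"
proof -
  have "c \<in> rels #>\<^bsub>F\<^esub> d"
    using assms by (auto simp: r_coset_def intro!: bexI[of _ "c - d"])
  then show ?thesis
    using group.repr_independence[OF group_free_Abelian_group _ _ rels_subgroup, of c d] assms
    by simp
qed

lemma frag_of_F: "\<lbrakk>n \<in> carrier N; m \<in> carrier M\<rbrakk> \<Longrightarrow> frag_of (n, m) \<in> carrier F"
  by simp

lemma F_plus: "\<lbrakk>x \<in> carrier F; y \<in> carrier F\<rbrakk> \<Longrightarrow> x + y \<in> carrier F"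
  using monoid.m_closed[OF group.is_monoid[OF group_free_Abelian_group], of x _ y] by auto

lemma pure_closed [intro, simp]:
  "\<lbrakk>n \<in> carrier N; m \<in> carrier M\<rbrakk> \<Longrightarrow> pure n m \<in> carrier Q"
  unfolding carrier_iff pure_eq using frag_of_F by blast

lemma pure_balanced: "balanced_map R N act M Q pure"
proof (rule balanced_mapI)
  show "pure n (m \<oplus>\<^bsub>M\<^esub> m') = pure n m \<oplus>\<^bsub>Q\<^esub> pure n m'"
    if "n \<in> carrier N" "m \<in> carrier M" "m' \<in> carrier M" for n m m'
  proof -
    have fr: "frag_of (n, m \<oplus>\<^bsub>M\<^esub> m') \<in> carrier F" "frag_of (n, m) \<in> carrier F"
      "frag_of (n, m') \<in> carrier F"
      by (intro frag_of_F M.a_closed that)+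
    have "frag_of (n, m \<oplus>\<^bsub>M\<^esub> m') - frag_of (n, m) - frag_of (n, m') \<in> rels"
      using that by (intro generate.incl) (auto simp: tensor_relations_def)
    then show ?thesis
      using that unfolding pure_eq
      unfolding coset_add[OF fr(2,3)]
      by (intro coset_eqI[OF fr(1) F_plus[OF fr(2,3)]]) (simp add: diff_diff_eq)
  qed
  show "pure (n \<oplus>\<^bsub>N\<^esub> n') m = pure n m \<oplus>\<^bsub>Q\<^esub> pure n' m"
    if "n \<in> carrier N" "n' \<in> carrier N" "m \<in> carrier M" for n n' m
  proof -
    have fr: "frag_of (n \<oplus>\<^bsub>N\<^esub> n', m) \<in> carrier F" "frag_of (n, m) \<in> carrier F"
      "frag_of (n', m) \<in> carrier F"
      by (intro frag_of_F N.a_closed that)+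
    have "frag_of (n \<oplus>\<^bsub>N\<^esub> n', m) - frag_of (n, m) - frag_of (n', m) \<in> rels"
      using that by (intro generate.incl) (auto simp: tensor_relations_def)
    then show ?thesis
      using that unfolding pure_eq
      unfolding coset_add[OF fr(2,3)]
      by (intro coset_eqI[OF fr(1) F_plus[OF fr(2,3)]]) (simp add: diff_diff_eq)
  qed
  show "pure (act n r) m = pure n (r \<odot>\<^bsub>M\<^esub> m)"
    if "n \<in> carrier N" "r \<in> carrier R" "m \<in> carrier M" for n r m
    unfolding pure_eq
  proof (rule coset_eqI)
    show "frag_of (act n r, m) - frag_of (n, r \<odot>\<^bsub>M\<^esub> m) \<in> rels"
      using that by (intro generate.incl) (auto simp: tensor_relations_def)
  qed (intro frag_of_F act_closed smult_closed that)+
qed (rule pure_closed)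

lemmas pure_add_right = balanced_mapD(2)[OF pure_balanced]
  and pure_add_left = balanced_mapD(3)[OF pure_balanced]
  and pure_act = balanced_mapD(4)[OF pure_balanced]

lemma pure_zero_left:
  assumes "m \<in> carrier M"
  shows "pure \<zero>\<^bsub>N\<^esub> m = \<zero>\<^bsub>Q\<^esub>"
proof -
  interpret Q: abelian_group Q by (rule abelian_group_tensor)
  have "pure \<zero>\<^bsub>N\<^esub> m \<oplus>\<^bsub>Q\<^esub> pure \<zero>\<^bsub>N\<^esub> m = pure \<zero>\<^bsub>N\<^esub> m"
    using assms pure_add_left[of "\<zero>\<^bsub>N\<^esub>" "\<zero>\<^bsub>N\<^esub>" m] by simp
  then show ?thesis
    using assms by (metis N.zero_closed Q.add.l_cancel_one' pure_closed)
qed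

text \<open>Zero and negatives need no cases of their own: the zero element is the pure tensor of
  two zeros, and a sign is absorbed into the left factor.\<close>

lemma tensor_induct [consumes 1, case_names pure add]:
  assumes "x \<in> carrier Q"
    and pure: "\<And>n m. \<lbrakk>n \<in> carrier N; m \<in> carrier M\<rbrakk> \<Longrightarrow> P (pure n m)"
    and add: "\<And>x y. \<lbrakk>x \<in> carrier Q; y \<in> carrier Q; P x; P y\<rbrakk> \<Longrightarrow> P (x \<oplus>\<^bsub>Q\<^esub> y)"
  shows "P x"
proof -
  interpret Q: abelian_group Q by (rule abelian_group_tensor)
  obtain c where c: "Poly_Mapping.keys c \<subseteq> carrier N \<times> carrier M" "x = rels #>\<^bsub>F\<^esub> c"
    using assms(1) by (auto simp: carrier_iff)
  have zero: "\<zero>\<^bsub>Q\<^esub> = rels #>\<^bsub>F\<^esub> 0"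
    using group.coset_mult_one[OF group_free_Abelian_group subgroup.subset[OF rels_subgroup]]
    by (simp add: zero_eq tensor_group_eq)
  \<comment> \<open>Strengthened to \<open>c\<close> and \<open>- c\<close>, because induction on
    the free abelian group proceeds by differences whereas \<open>P\<close> is only known to be
    stable under sums.\<close>
  have "P (rels #>\<^bsub>F\<^esub> c) \<and> P (rels #>\<^bsub>F\<^esub> (- c))"
    using c(1)
  proof (induction c rule: free_Abelian_group_induct[consumes 1, case_names nil diff of])
    case nil
    have "P \<zero>\<^bsub>Q\<^esub>"
      using pure[of "\<zero>\<^bsub>N\<^esub>" "\<zero>\<^bsub>M\<^esub>"] pure_zero_left[of "\<zero>\<^bsub>M\<^esub>"] by simp
    then show ?case by (simp add: zero)
  next
    case (diff a b)
    have closed: "rels #>\<^bsub>F\<^esub> a \<in> carrier Q" "rels #>\<^bsub>F\<^esub> b \<in> carrier Q"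
      "rels #>\<^bsub>F\<^esub> (- a) \<in> carrier Q" "rels #>\<^bsub>F\<^esub> (- b) \<in> carrier Q"
      using diff unfolding carrier_iff by (auto simp del: carrier_free_Abelian_group_iff
          simp add: carrier_free_Abelian_group_iff[symmetric]) auto
    show ?case
      using add[of "rels #>\<^bsub>F\<^esub> a" "rels #>\<^bsub>F\<^esub> (- b)"] add[of "rels #>\<^bsub>F\<^esub> b" "rels #>\<^bsub>F\<^esub> (- a)"]
        closed diff coset_add[of a "- b"] coset_add[of b "- a"]
      by simp
  next
    case (of p)
    obtain n m where p: "p = (n, m)" "n \<in> carrier N" "m \<in> carrier M" using of by auto
    have "pure (\<ominus>\<^bsub>N\<^esub> n) m \<oplus>\<^bsub>Q\<^esub> pure n m = \<zero>\<^bsub>Q\<^esub>"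
      using p pure_add_left[of "\<ominus>\<^bsub>N\<^esub> n" n m] pure_zero_left[of m] by (simp add: N.l_neg)
    moreover have "(rels #>\<^bsub>F\<^esub> (- frag_of p)) \<oplus>\<^bsub>Q\<^esub> pure n m = \<zero>\<^bsub>Q\<^esub>"
      using p coset_add[of "- frag_of p" "frag_of p"] by (simp add: zero pure_eq)
    moreover have "rels #>\<^bsub>F\<^esub> (- frag_of p) \<in> carrier Q"
      using p unfolding carrier_iff by force
    ultimately have "rels #>\<^bsub>F\<^esub> (- frag_of p) = pure (\<ominus>\<^bsub>N\<^esub> n) m"
      using p by (metis N.a_inv_closed Q.minus_equality pure_closed)
    then show ?case using p pure by (simp add: pure_eq[symmetric])
  qed
  then show ?thesis using c by simp
qed

lemma additive_map_eqI:
  assumes "additive_map Q P f" "additive_map Q P g"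
    and "\<And>n m. \<lbrakk>n \<in> carrier N; m \<in> carrier M\<rbrakk> \<Longrightarrow> f (pure n m) = g (pure n m)"
    and "x \<in> carrier Q"
  shows "f x = g x"
  using assms(4) by (induction rule: tensor_induct) (use assms in \<open>auto simp: additive_map_add\<close>)

text \<open>Independence of the chosen representative: the extension \<open>h\<close> of
  \<open>f\<close> to formal sums kills the relations exactly because \<open>f\<close> is balanced,
  so it is constant on cosets.\<close>

lemma tensor_lift_coset:
  assumes G: "add_group_of G P" and f: "balanced_map R N act M P f"
  obtains h :: "('n \<times> 'm \<Rightarrow>\<^sub>0 int) \<Rightarrow> _" where "h \<in> hom F G" "\<And>c. c \<in> carrier F \<Longrightarrow> tensor_lift G f (rels #>\<^bsub>F\<^esub> c) = h c"
    "\<And>n m. \<lbrakk>n \<in> carrier N; m \<in> carrier M\<rbrakk> \<Longrightarrow> h (frag_of (n, m)) = f n m"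
proof -
  interpret G: comm_group G using G by (simp add: add_group_of_def)
  interpret FG: group F by simp
  have carrG: "carrier G = carrier P" and addG: "x \<oplus>\<^bsub>P\<^esub> y = x \<otimes>\<^bsub>G\<^esub> y" for x y
    using G by (simp_all add: add_group_of_def)
  note fD = balanced_mapD[OF f, folded carrG, unfolded addG]
  define h :: "('n \<times> 'm \<Rightarrow>\<^sub>0 int) \<Rightarrow> _" where "h c = finprod G (\<lambda>p. f (fst p) (snd p) [^]\<^bsub>G\<^esub> Poly_Mapping.lookup c p)
    (Poly_Mapping.keys c)" for c
  have h: "h \<in> hom F G"
    unfolding h_def by (rule G.free_Abelian_group_extension_hom) (auto simp: fD(1))
  interpret h: group_hom F G h
    by (rule group_hom.intro) (auto simp: group_hom_axioms_def h G.is_group)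
  have h_of: "h (frag_of (n, m)) = f n m" if "n \<in> carrier N" "m \<in> carrier M" for n m
    using that fD(1) by (simp add: h_def)
  have h_diff: "h (x - y) = h x \<otimes>\<^bsub>G\<^esub> inv\<^bsub>G\<^esub> h y" if "x \<in> carrier F" "y \<in> carrier F" for x y
    using that h.hom_mult[of x "inv\<^bsub>F\<^esub> y"] h.hom_inv[of y] by (simp del: h.hom_mult h.hom_inv)
  have diff_F: "x - y \<in> carrier F" if "x \<in> carrier F" "y \<in> carrier F" for x y
    using that FG.m_closed[of x "inv\<^bsub>F\<^esub> y"] by simp
  have h_rel: "h r = \<one>\<^bsub>G\<^esub>" if "r \<in> tensor_relations R N act M" for r
  proof -
    \<comment> \<open>The relations have two shapes: \<open>eq1\<close> serves both kinds of
      additivity, \<open>eq2\<close> the balancing relation.\<close>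
    have eq1: "h (frag_of p - frag_of q - frag_of s) = \<one>\<^bsub>G\<^esub>"
      if "p \<in> carrier N \<times> carrier M" "q \<in> carrier N \<times> carrier M" "s \<in> carrier N \<times> carrier M"
        "f (fst p) (snd p) = f (fst q) (snd q) \<otimes>\<^bsub>G\<^esub> f (fst s) (snd s)" for p q s
    proof -
      have *: "frag_of p \<in> carrier F" "frag_of q \<in> carrier F" "frag_of s \<in> carrier F"
        using that by auto
      have "h (frag_of p - frag_of q - frag_of s) =
          h (frag_of p) \<otimes>\<^bsub>G\<^esub> inv\<^bsub>G\<^esub> h (frag_of q) \<otimes>\<^bsub>G\<^esub> inv\<^bsub>G\<^esub> h (frag_of s)"
        using * by (simp add: h_diff diff_F del: carrier_free_Abelian_group_iff)
      also have "\<dots> = f (fst q) (snd q) \<otimes>\<^bsub>G\<^esub> f (fst s) (snd s) \<otimes>\<^bsub>G\<^esub>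
          inv\<^bsub>G\<^esub> f (fst q) (snd q) \<otimes>\<^bsub>G\<^esub> inv\<^bsub>G\<^esub> f (fst s) (snd s)"
        using that by (auto simp: h_of)
      also have "\<dots> = \<one>\<^bsub>G\<^esub>"
        using that by (auto simp: fD(1) G.m_ac) 
          (smt (verit) G.inv_closed G.l_one G.m_assoc G.m_comm G.r_inv fD(1))
      finally show ?thesis .
    qed
    have eq2: "h (frag_of p - frag_of q) = \<one>\<^bsub>G\<^esub>"
      if "p \<in> carrier N \<times> carrier M" "q \<in> carrier N \<times> carrier M"
        "f (fst p) (snd p) = f (fst q) (snd q)" for p q
    proof -
      have "h (frag_of p - frag_of q) = h (frag_of p) \<otimes>\<^bsub>G\<^esub> inv\<^bsub>G\<^esub> h (frag_of q)"
        using that by (intro h_diff) auto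
      also have "\<dots> = \<one>\<^bsub>G\<^esub>"
        using that by (cases p, cases q) (simp add: h_of fD(1))
      finally show ?thesis .
    qed
    show ?thesis
      using that unfolding tensor_relations_def
      by (elim UnE CollectE exE conjE; hypsubst)
        (rule eq1 eq2; simp add: fD act_closed smult_closed)+
  qed
  have rels_h: "h r = \<one>\<^bsub>G\<^esub>" if "r \<in> rels" for r
    using that
  proof (induction rule: generate.induct)
    case (inv k)
    then have "k \<in> carrier F" using relations_in_F by blast
    then show ?case using inv h_rel h.hom_inv[of k] by simp
  next
    case (eng a b)
    then have "a \<in> carrier F" "b \<in> carrier F"
      using subgroup.subset[OF rels_subgroup] by blast+
    then show ?case using eng h.hom_mult[of a b] by simp
  qed (use h.hom_one h_rel in auto)
  have "tensor_lift G f (rels #>\<^bsub>F\<^esub> c) = h c" if c: "c \<in> carrier F" for c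
  proof -
    have "c \<in> rels #>\<^bsub>F\<^esub> c"
      using FG.rcos_self[OF c rels_subgroup] .
    then have "(SOME c'. c' \<in> rels #>\<^bsub>F\<^esub> c) \<in> rels #>\<^bsub>F\<^esub> c"
      by (rule someI)
    then obtain r where r: "r \<in> rels" "(SOME c'. c' \<in> rels #>\<^bsub>F\<^esub> c) = r \<otimes>\<^bsub>F\<^esub> c"
      by (auto simp: r_coset_def)
    have "r \<in> carrier F" using r(1) subgroup.subset[OF rels_subgroup] by blast
    then have "h (r \<otimes>\<^bsub>F\<^esub> c) = h c"
      using c r(1) h.hom_mult[of r c] h.hom_closed[OF c] rels_h by (simp del: h.hom_mult)
    then show ?thesis
      using r(2) by (simp add: tensor_lift_def h_def Let_def)
  qed
  then show ?thesis using that h h_of by blast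
qed

proposition tensor_lift_additive:
  assumes "add_group_of G P" "balanced_map R N act M P f"
  shows "additive_map Q P (tensor_lift G f)"
proof -
  obtain h where h: "h \<in> hom F G"
    "\<And>c. c \<in> carrier F \<Longrightarrow> tensor_lift G f (rels #>\<^bsub>F\<^esub> c) = h c"
    by (rule tensor_lift_coset[OF assms]) (erule that, assumption)
  show ?thesis
  proof (rule additive_mapI)
    show "tensor_lift G f x \<in> carrier P" if "x \<in> carrier Q" for x
      using that h assms(1) hom_in_carrier[OF h(1)] unfolding carrier_iff add_group_of_def by auto
    show "tensor_lift G f (x \<oplus>\<^bsub>Q\<^esub> y) = tensor_lift G f x \<oplus>\<^bsub>P\<^esub> tensor_lift G f y"
      if xy: "x \<in> carrier Q" "y \<in> carrier Q" for x y
    proof -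
      obtain c d where cd: "c \<in> carrier F" "d \<in> carrier F"
        "x = rels #>\<^bsub>F\<^esub> c" "y = rels #>\<^bsub>F\<^esub> d"
        using xy unfolding carrier_iff by blast
      have "h (c + d) = h c \<otimes>\<^bsub>G\<^esub> h d"
        using hom_mult[OF h(1) cd(1,2)] by simp
      then show ?thesis
        using cd assms(1) by (simp add: coset_add h(2) F_plus add_group_of_def
            del: carrier_free_Abelian_group_iff)
    qed
  qed
qed

proposition tensor_lift_pure [simp]:
  assumes "add_group_of G P" "balanced_map R N act M P f" "n \<in> carrier N" "m \<in> carrier M"
  shows "tensor_lift G f (pure n m) = f n m"
  unfolding pure_eq
  by (rule tensor_lift_coset[OF assms(1,2)]) (simp add: assms(3,4) frag_of_F del: carrier_free_Abelian_group_iff)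

text \<open>Needed for nested lifts, where the inner lift must itself be balanced in the outer
  variables. Each law compares maps additive in \<open>y\<close>, so it may be checked on pure
  tensors, where it is the assumption \<open>param\<close>.\<close>

lemma tensor_lift_param:
  assumes G: "add_group_of G P" and P: "abelian_group P"
    and f: "\<And>a b. \<lbrakk>a \<in> carrier N'; b \<in> carrier M'\<rbrakk> \<Longrightarrow> balanced_map R N act M P (f a b)"
    and param: "\<And>n m. \<lbrakk>n \<in> carrier N; m \<in> carrier M\<rbrakk> \<Longrightarrow>
      balanced_map R' N' act' M' P (\<lambda>a b. f a b n m)"
    and tp: "tensor_product R' N' act' M' Q'"
    and y: "y \<in> carrier Q"
  shows "balanced_map R' N' act' M' P (\<lambda>a b. tensor_lift G (f a b) y)"
proof -
  interpret P: abelian_group P by fact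
  interpret TP: tensor_product R' N' act' M' Q' by fact
  note lift = tensor_lift_additive[OF G f]
  have plus: "tensor_lift G k y = tensor_lift G k1 y \<oplus>\<^bsub>P\<^esub> tensor_lift G k2 y"
    if "balanced_map R N act M P k" "balanced_map R N act M P k1" "balanced_map R N act M P k2"
      "\<And>n m. \<lbrakk>n \<in> carrier N; m \<in> carrier M\<rbrakk> \<Longrightarrow> k n m = k1 n m \<oplus>\<^bsub>P\<^esub> k2 n m" for k k1 k2
    by (rule additive_map_eqI[OF _ _ _ y, where P = P
          and g = "\<lambda>y. tensor_lift G k1 y \<oplus>\<^bsub>P\<^esub> tensor_lift G k2 y"])
      (auto intro!: additive_map_plus tensor_lift_additive P G that simp: tensor_lift_pure[OF G] that)
  have eq: "tensor_lift G k y = tensor_lift G k1 y"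
    if "balanced_map R N act M P k" "balanced_map R N act M P k1"
      "\<And>n m. \<lbrakk>n \<in> carrier N; m \<in> carrier M\<rbrakk> \<Longrightarrow> k n m = k1 n m" for k k1
    by (rule additive_map_eqI[OF _ _ _ y, where P = P])
      (auto intro!: tensor_lift_additive G that simp: tensor_lift_pure[OF G] that)
  note param = balanced_mapD[OF param]
  show ?thesis
    by (rule balanced_mapI)
      (use y in \<open>auto intro!: plus eq f TP.act_closed TP.smult_closed additive_map_closed[OF lift] simp: param\<close>)
qed

end


section \<open>Extension of scalars\<close>

text \<open>The twist \<open>\<phi>\<close> replaces a further extension of scalars: a
  \<open>\<phi>\<close>-semilinear map from \<open>M\<close> to \<open>N\<close> amounts to a linear
  map from \<open>\<phi>\<^sup>* M\<close> to \<open>N\<close>. Pulling an identity back along a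
  ring map therefore means composing with a semilinear map. Module homomorphisms are the case of the
  identity twist.\<close>

definition semilinear_map ::
    "('r, 'x) ring_scheme \<Rightarrow> ('r \<Rightarrow> 's) \<Rightarrow> ('r, 'm) module \<Rightarrow> ('s, 'n) module \<Rightarrow> ('m \<Rightarrow> 'n) \<Rightarrow> bool" where
  "semilinear_map R \<phi> M N f \<longleftrightarrow> additive_map M N f \<and>
     (\<forall>r \<in> carrier R. \<forall>x \<in> carrier M. f (r \<odot>\<^bsub>M\<^esub> x) = \<phi> r \<odot>\<^bsub>N\<^esub> f x)"

lemma left_module_hom_iff: "f \<in> left_module_hom R M N \<longleftrightarrow> semilinear_map R (\<lambda>r. r) M N f"
  by (auto simp: left_module_hom_def semilinear_map_def additive_map_def)

lemma semilinear_mapI: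
  "\<lbrakk>additive_map M N f;
    \<And>r x. \<lbrakk>r \<in> carrier R; x \<in> carrier M\<rbrakk> \<Longrightarrow> f (r \<odot>\<^bsub>M\<^esub> x) = \<phi> r \<odot>\<^bsub>N\<^esub> f x\<rbrakk>
    \<Longrightarrow> semilinear_map R \<phi> M N f"
  by (simp add: semilinear_map_def)

lemma semilinear_mapD:
  assumes "semilinear_map R \<phi> M N f"
  shows "additive_map M N f"
    and "\<And>x. x \<in> carrier M \<Longrightarrow> f x \<in> carrier N"
    and "\<And>x y. \<lbrakk>x \<in> carrier M; y \<in> carrier M\<rbrakk> \<Longrightarrow> f (x \<oplus>\<^bsub>M\<^esub> y) = f x \<oplus>\<^bsub>N\<^esub> f y"
    and "\<And>r x. \<lbrakk>r \<in> carrier R; x \<in> carrier M\<rbrakk> \<Longrightarrow> f (r \<odot>\<^bsub>M\<^esub> x) = \<phi> r \<odot>\<^bsub>N\<^esub> f x"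
  using assms by (auto simp: semilinear_map_def additive_map_def)

lemma semilinear_map_comp:
  assumes "semilinear_map R \<phi> M N f" "semilinear_map S \<psi> N P g"
    and "\<And>r. r \<in> carrier R \<Longrightarrow> \<phi> r \<in> carrier S" "\<And>r. r \<in> carrier R \<Longrightarrow> \<psi> (\<phi> r) = \<chi> r"
  shows "semilinear_map R \<chi> M P (\<lambda>x. g (f x))"
  using assms by (auto simp: semilinear_map_def additive_map_def Pi_iff)

lemma semilinear_map_id: "semilinear_map R (\<lambda>r. r) M M (\<lambda>x. x)"
  by (simp add: semilinear_map_def additive_map_def)

lemma semilinear_map_cong:
  assumes "semilinear_map R \<phi> M N f" "\<And>r. r \<in> carrier R \<Longrightarrow> \<phi> r = \<psi> r"
  shows "semilinear_map R \<psi> M N f"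
  using assms by (simp add: semilinear_map_def)

locale scalar_extension =
  fixes A :: "('a, 'x) ring_scheme" and B :: "('b, 'y) ring_scheme"
    and \<phi> :: "'a \<Rightarrow> 'b" and M :: "('a, 'm) module"
  assumes ring_A: "ring A" and ring_B: "ring B" and hom_\<phi>: "\<phi> \<in> ring_hom A B"
    and left_module_M: "left_module A M"

sublocale scalar_extension \<subseteq>
  tensor_product A B "\<lambda>b a. b \<otimes>\<^bsub>B\<^esub> \<phi> a" M "ext_scalars A B \<phi> M"
proof -
  interpret B: ring B by (rule ring_B)
  interpret M: left_module A M by (rule left_module_M)
  show "tensor_product A B (\<lambda>b a. b \<otimes>\<^bsub>B\<^esub> \<phi> a) M (ext_scalars A B \<phi> M)"
    by unfold_locales
      (auto simp: ext_scalars_def ext_scalars_group_def Let_def M.smult_closed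
        ring_hom_closed[OF hom_\<phi>])
qed

context scalar_extension begin

interpretation A: ring A by (rule ring_A)
interpretation B: ring B by (rule ring_B)
interpretation LM: left_module A M by (rule left_module_M)

abbreviation (input) "E \<equiv> ext_scalars A B \<phi> M"
abbreviation (input) "nat_map \<equiv> ext_scalars_nat A B \<phi> M"

lemma nat_map_eq: "nat_map m = pure \<one>\<^bsub>B\<^esub> m"
  by (simp add: ext_scalars_nat_def ext_scalars_pure_def)

lemma pure_act': "\<lbrakk>b \<in> carrier B; a \<in> carrier A; m \<in> carrier M\<rbrakk> \<Longrightarrow>
    pure (b \<otimes>\<^bsub>B\<^esub> \<phi> a) m = pure b (a \<odot>\<^bsub>M\<^esub> m)"
  by (rule pure_act)

lemma mult_balanced:
  assumes "b \<in> carrier B"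
  shows "balanced_map A B (\<lambda>b a. b \<otimes>\<^bsub>B\<^esub> \<phi> a) M E (\<lambda>b'. pure (b \<otimes>\<^bsub>B\<^esub> b'))"
  by (rule balanced_mapI)
    (use assms in \<open>simp_all add: pure_add_left pure_add_right B.r_distr pure_act'
      ring_hom_closed[OF hom_\<phi>] B.m_assoc[symmetric]\<close>)

lemma smult_eq: "b \<odot>\<^bsub>E\<^esub> x =
    tensor_lift (tensor_group A B (\<lambda>b a. b \<otimes>\<^bsub>B\<^esub> \<phi> a) M) (\<lambda>b'. pure (b \<otimes>\<^bsub>B\<^esub> b')) x"
  by (simp add: ext_scalars_def ext_scalars_group_def ext_scalars_pure_def Let_def)

lemma smult_additive: "b \<in> carrier B \<Longrightarrow> additive_map E E (\<lambda>x. b \<odot>\<^bsub>E\<^esub> x)"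
  unfolding smult_eq by (rule tensor_lift_additive[OF add_group_of_tensor_group mult_balanced])

lemma smult_pure: "\<lbrakk>b \<in> carrier B; b' \<in> carrier B; m \<in> carrier M\<rbrakk> \<Longrightarrow>
    b \<odot>\<^bsub>E\<^esub> pure b' m = pure (b \<otimes>\<^bsub>B\<^esub> b') m"
  unfolding smult_eq by (rule tensor_lift_pure[OF add_group_of_tensor_group mult_balanced])

lemma smult_nat: "\<lbrakk>b \<in> carrier B; m \<in> carrier M\<rbrakk> \<Longrightarrow> b \<odot>\<^bsub>E\<^esub> nat_map m = pure b m"
  by (simp add: nat_map_eq smult_pure)

lemma left_module_ext_scalars: "left_module B E"
proof -
  interpret E: abelian_group E by (rule abelian_group_tensor)
  note add = additive_map_add[OF smult_additive] and closed = additive_map_closed[OF smult_additive]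
  show ?thesis
  proof (unfold_locales)
    fix a b x assume ab: "a \<in> carrier B" "b \<in> carrier B" and x: "x \<in> carrier E"
    show "a \<odot>\<^bsub>E\<^esub> x \<in> carrier E" by (rule closed[OF ab(1) x])
    show "(a \<oplus>\<^bsub>B\<^esub> b) \<odot>\<^bsub>E\<^esub> x = a \<odot>\<^bsub>E\<^esub> x \<oplus>\<^bsub>E\<^esub> b \<odot>\<^bsub>E\<^esub> x"
      using x by (induction rule: tensor_induct)
        (use ab in \<open>simp_all add: smult_pure pure_add_left B.l_distr add closed E.a_ac\<close>)
    show "(a \<otimes>\<^bsub>B\<^esub> b) \<odot>\<^bsub>E\<^esub> x = a \<odot>\<^bsub>E\<^esub> (b \<odot>\<^bsub>E\<^esub> x)"
      using x by (induction rule: tensor_induct)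
        (use ab in \<open>simp_all add: smult_pure B.m_assoc add closed\<close>)
  next
    fix x assume x: "x \<in> carrier E"
    show "\<one>\<^bsub>B\<^esub> \<odot>\<^bsub>E\<^esub> x = x"
      using x by (induction rule: tensor_induct) (simp_all add: smult_pure add)
  qed (rule add)
qed

lemma nat_map_semilinear: "semilinear_map A \<phi> M E nat_map"
proof (rule semilinear_mapI)
  show "additive_map M E nat_map"
    unfolding nat_map_eq by (rule additive_mapI) (auto simp: pure_add_right)
  show "nat_map (a \<odot>\<^bsub>M\<^esub> m) = \<phi> a \<odot>\<^bsub>E\<^esub> nat_map m" if "a \<in> carrier A" "m \<in> carrier M" for a m
    using that pure_act'[of "\<one>\<^bsub>B\<^esub>" a m]
    by (simp add: nat_map_eq smult_pure ring_hom_closed[OF hom_\<phi>])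
qed

lemmas nat_map_closed = semilinear_mapD(2)[OF nat_map_semilinear]

text \<open>The adjunction between extension and restriction of scalars, twisted by
  \<open>\<psi>\<close>: the map sends \<open>b \<otimes> m\<close> to \<open>\<psi> b\<close>
  acting on \<open>p m\<close>, and balancedness is the semilinearity of \<open>p\<close> over the
  composite.\<close>

proposition extension_universal:
  assumes \<psi>: "\<psi> \<in> ring_hom B C" and N: "left_module C N"
    and p: "semilinear_map A (\<lambda>a. \<psi> (\<phi> a)) M N p"
  obtains f where "semilinear_map B \<psi> E N f" "\<And>m. m \<in> carrier M \<Longrightarrow> f (nat_map m) = p m"
proof -
  interpret N: left_module C N by (rule N)
  define k where "k b m = \<psi> b \<odot>\<^bsub>N\<^esub> p m" for b m
  note pD = semilinear_mapD[OF p] and \<psi>c = ring_hom_closed[OF \<psi>] and \<phi>c = ring_hom_closed[OF hom_\<phi>]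
  have k: "balanced_map A B (\<lambda>b a. b \<otimes>\<^bsub>B\<^esub> \<phi> a) M N k"
    by (rule balanced_mapI)
      (simp_all add: k_def pD \<psi>c \<phi>c ring_hom_add[OF \<psi>] ring_hom_mult[OF \<psi>]
        N.smult_closed N.smult_l_distr N.smult_r_distr N.smult_assoc)
  define f where "f = tensor_lift (add_monoid N) k"
  have f: "additive_map E N f"
    unfolding f_def by (rule tensor_lift_additive[OF N.add_group_of_add_monoid k])
  have f_pure: "f (pure b m) = \<psi> b \<odot>\<^bsub>N\<^esub> p m" if "b \<in> carrier B" "m \<in> carrier M" for b m
    using tensor_lift_pure[OF N.add_group_of_add_monoid k that] by (simp add: f_def k_def)
  have "semilinear_map B \<psi> E N f"
  proof (rule semilinear_mapI[OF f])
    fix b x assume b: "b \<in> carrier B" and "x \<in> carrier E"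
    from this(2) show "f (b \<odot>\<^bsub>E\<^esub> x) = \<psi> b \<odot>\<^bsub>N\<^esub> f x"
      by (induction rule: tensor_induct)
        (simp_all add: b smult_pure f_pure pD \<psi>c ring_hom_mult[OF \<psi>] N.smult_assoc
          additive_map_add[OF f] additive_map_add[OF smult_additive] N.smult_r_distr
          additive_map_closed[OF f] additive_map_closed[OF smult_additive])
  qed
  moreover have "f (nat_map m) = p m" if "m \<in> carrier M" for m
    using that by (simp add: nat_map_eq f_pure ring_hom_one[OF \<psi>] N.smult_one pD)
  ultimately show ?thesis by (rule that)
qed

text \<open>The natural image of \<open>M\<close> generates the extension, since
  \<open>b \<otimes> m\<close> is \<open>b\<close> acting on \<open>1 \<otimes> m\<close>.\<close>

proposition extension_unique:
  assumes f: "semilinear_map B \<psi> E N f" and g: "semilinear_map B \<psi> E N g"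
    and eq: "\<And>m. m \<in> carrier M \<Longrightarrow> f (nat_map m) = g (nat_map m)" and x: "x \<in> carrier E"
  shows "f x = g x"
  using semilinear_mapD(1)[OF f] semilinear_mapD(1)[OF g] _ x
proof (rule additive_map_eqI)
  fix b m assume bm: "b \<in> carrier B" "m \<in> carrier M"
  then have "f (b \<odot>\<^bsub>E\<^esub> nat_map m) = g (b \<odot>\<^bsub>E\<^esub> nat_map m)"
    by (simp add: semilinear_mapD(4)[OF f] semilinear_mapD(4)[OF g] nat_map_closed eq)
  then show "f (pure b m) = g (pure b m)"
    using bm by (simp add: smult_nat)
qed

end

section \<open>Functoriality of extension of scalars and the canonical identifications\<close>

lemma ext_scalars_map_semilinear:
  assumes M: "scalar_extension A B \<phi> M" and N: "scalar_extension A B \<phi> N"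
    and g: "semilinear_map A (\<lambda>a. a) M N g"
  shows "semilinear_map B (\<lambda>b. b) (ext_scalars A B \<phi> M) (ext_scalars A B \<phi> N)
      (ext_scalars_map A B \<phi> N g)"
    and "m \<in> carrier M \<Longrightarrow> ext_scalars_map A B \<phi> N g (ext_scalars_nat A B \<phi> M m) =
      ext_scalars_nat A B \<phi> N (g m)"
proof -
  interpret M: scalar_extension A B \<phi> M by (rule M)
  interpret N: scalar_extension A B \<phi> N by (rule N)
  interpret B: ring B by (rule M.ring_B)
  note gD = semilinear_mapD[OF g]
  have map_eq: "ext_scalars_map A B \<phi> N g = tensor_lift (tensor_group A B (\<lambda>b a. b \<otimes>\<^bsub>B\<^esub> \<phi> a) N)
      (\<lambda>b m. pure_tensor A B (\<lambda>b a. b \<otimes>\<^bsub>B\<^esub> \<phi> a) N b (g m))"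
    by (simp add: ext_scalars_map_def ext_scalars_group_def ext_scalars_pure_def)
  have bal: "balanced_map A B (\<lambda>b a. b \<otimes>\<^bsub>B\<^esub> \<phi> a) M (ext_scalars A B \<phi> N)
      (\<lambda>b m. pure_tensor A B (\<lambda>b a. b \<otimes>\<^bsub>B\<^esub> \<phi> a) N b (g m))"
    by (rule balanced_mapI) (simp_all add: gD N.pure_add_left N.pure_add_right N.pure_act')
  note add = M.tensor_lift_additive[OF N.add_group_of_tensor_group bal, folded map_eq]
  note pure = M.tensor_lift_pure[OF N.add_group_of_tensor_group bal, folded map_eq]
  note addM = M.smult_additive and addN = N.smult_additive
  show "semilinear_map B (\<lambda>b. b) (ext_scalars A B \<phi> M) (ext_scalars A B \<phi> N)
      (ext_scalars_map A B \<phi> N g)"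
  proof (rule semilinear_mapI[OF add])
    fix b x assume b: "b \<in> carrier B" and "x \<in> carrier (ext_scalars A B \<phi> M)"
    from this(2) show "ext_scalars_map A B \<phi> N g (b \<odot>\<^bsub>ext_scalars A B \<phi> M\<^esub> x) =
        b \<odot>\<^bsub>ext_scalars A B \<phi> N\<^esub> ext_scalars_map A B \<phi> N g x"
      by (induction rule: M.tensor_induct)
        (simp_all add: b M.smult_pure N.smult_pure pure gD additive_map_add[OF add]
          additive_map_add[OF addM] additive_map_add[OF addN]
          additive_map_closed[OF add] additive_map_closed[OF addM])
  qed
  show "ext_scalars_map A B \<phi> N g (ext_scalars_nat A B \<phi> M m) = ext_scalars_nat A B \<phi> N (g m)"
    if "m \<in> carrier M"
    using that by (simp add: M.nat_map_eq N.nat_map_eq pure)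
qed

text \<open>A definite description yields its defining properties only after unique existence.
  Existence comes from the inverse pair \<open>i\<close>, \<open>j\<close>, uniqueness from the
  rigidity assumption \<open>unique\<close>, which for iterated extensions is
  \<open>iterated_unique\<close>.\<close>

lemma compatible_iso_properties:
  assumes i: "semilinear_map C (\<lambda>c. c) P Q i" and j: "semilinear_map C (\<lambda>c. c) Q P j"
    and ij: "\<And>x. x \<in> carrier Q \<Longrightarrow> i (j x) = x" and ji: "\<And>x. x \<in> carrier P \<Longrightarrow> j (i x) = x"
    and ip: "\<And>m. m \<in> carrier M \<Longrightarrow> i (p m) = q m"
    and p: "\<And>m. m \<in> carrier M \<Longrightarrow> p m \<in> carrier P"
    and unique: "\<And>f g x. \<lbrakk>semilinear_map C (\<lambda>c. c) P Q f; semilinear_map C (\<lambda>c. c) P Q g;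
      \<forall>m \<in> carrier M. f (p m) = g (p m); x \<in> carrier P\<rbrakk> \<Longrightarrow> f x = g x"
    and smult_closed: "\<And>c x. \<lbrakk>c \<in> carrier C; x \<in> carrier P\<rbrakk> \<Longrightarrow> c \<odot>\<^bsub>P\<^esub> x \<in> carrier P"
    and add_closed: "\<And>x y. \<lbrakk>x \<in> carrier P; y \<in> carrier P\<rbrakk> \<Longrightarrow> x \<oplus>\<^bsub>P\<^esub> y \<in> carrier P"
  shows "semilinear_map C (\<lambda>c. c) P Q (compatible_iso C M P p Q q)"
    and "m \<in> carrier M \<Longrightarrow> compatible_iso C M P p Q q (p m) = q m"
proof -
  let ?R = "\<lambda>i. i \<in> left_module_iso C P Q \<and> i \<in> extensional (carrier P) \<and>
        (\<forall>m \<in> carrier M. i (p m) = q m)"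
  \<comment> \<open>The description asks for an extensional function, so the witness is cut down to
    the carrier; closure of \<open>P\<close> keeps it linear.\<close>
  have lin: "semilinear_map C (\<lambda>c. c) P Q (restrict i (carrier P))"
    using i smult_closed add_closed by (auto simp: semilinear_map_def additive_map_def)
  have "bij_betw i (carrier P) (carrier Q)"
    by (rule bij_betw_byWitness[where f' = j])
      (use ij ji semilinear_mapD(2)[OF i] semilinear_mapD(2)[OF j] in auto)
  then have "bij_betw (restrict i (carrier P)) (carrier P) (carrier Q)"
    by (simp cong: bij_betw_cong)
  then have ex: "?R (restrict i (carrier P))"
    using lin p ip by (simp add: left_module_iso_def left_module_hom_iff)
  have R_unique: "f = g" if "?R f" "?R g" for f g
  proof (rule extensionalityI)
    fix x assume "x \<in> carrier P"
    then show "f x = g x"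
      using that by (intro unique) (auto simp: left_module_iso_def left_module_hom_iff)
  qed (use that in auto)
  have "?R (compatible_iso C M P p Q q)"
    unfolding compatible_iso_def by (rule theI[of ?R, OF ex]) (rule R_unique[OF _ ex])
  then show "semilinear_map C (\<lambda>c. c) P Q (compatible_iso C M P p Q q)"
    and "m \<in> carrier M \<Longrightarrow> compatible_iso C M P p Q q (p m) = q m"
    by (auto simp: left_module_iso_def left_module_hom_iff)
qed

locale iterated_scalar_extension =
  first: scalar_extension A B f M + second: scalar_extension B C g "ext_scalars A B f M"
  for A :: "('a, 'x) ring_scheme" and B :: "('b, 'y) ring_scheme" and C :: "('c, 'z) ring_scheme"
    and f :: "'a \<Rightarrow> 'b" and g :: "'b \<Rightarrow> 'c" and M :: "('a, 'm) module"
begin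

abbreviation (input) "EE \<equiv> ext_scalars B C g (ext_scalars A B f M)"
abbreviation (input) "nat2 \<equiv> \<lambda>m. ext_scalars_nat B C g (ext_scalars A B f M) (ext_scalars_nat A B f M m)"

lemma nat2_semilinear: "semilinear_map A (\<lambda>a. g (f a)) M EE nat2"
  by (rule semilinear_map_comp[OF first.nat_map_semilinear second.nat_map_semilinear])
    (simp_all add: ring_hom_closed[OF first.hom_\<phi>])

text \<open>Two uses of the one-step property: first over \<open>\<psi>\<close> after
  \<open>g\<close>, then over \<open>\<psi>\<close>. Only the composite of \<open>f\<close> and
  \<open>g\<close> enters the condition on \<open>p\<close>, which is what makes extensions with
  equal composites comparable.\<close>

lemma iterated_universal:
  assumes \<psi>: "\<psi> \<in> ring_hom C D" and N: "left_module D N"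
    and p: "semilinear_map A \<chi> M N p" and \<chi>: "\<And>a. a \<in> carrier A \<Longrightarrow> \<chi> a = \<psi> (g (f a))"
  obtains h where "semilinear_map C \<psi> EE N h" "\<And>m. m \<in> carrier M \<Longrightarrow> h (nat2 m) = p m"
proof -
  have p': "semilinear_map A (\<lambda>a. (\<lambda>b. \<psi> (g b)) (f a)) M N p"
    using p \<chi> by (rule semilinear_map_cong)
  have \<psi>g: "(\<lambda>b. \<psi> (g b)) \<in> ring_hom B D"
    using ring_hom_trans[OF second.hom_\<phi> \<psi>] by (simp add: o_def)
  obtain k where k: "semilinear_map B (\<lambda>b. \<psi> (g b)) (ext_scalars A B f M) N k"
    "\<And>m. m \<in> carrier M \<Longrightarrow> k (ext_scalars_nat A B f M m) = p m"
    using first.extension_universal[OF \<psi>g N p'] by blast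
  obtain h where "semilinear_map C \<psi> EE N h"
    "\<And>x. x \<in> carrier (ext_scalars A B f M) \<Longrightarrow>
      h (ext_scalars_nat B C g (ext_scalars A B f M) x) = k x"
    using second.extension_universal[OF \<psi> N k(1)] by blast
  then show ?thesis
    using that k(2) first.nat_map_closed by simp
qed

lemma iterated_unique:
  assumes h: "semilinear_map C \<psi> EE N h" and k: "semilinear_map C \<psi> EE N k"
    and eq: "\<And>m. m \<in> carrier M \<Longrightarrow> h (nat2 m) = k (nat2 m)" and x: "x \<in> carrier EE"
  shows "h x = k x"
proof (rule second.extension_unique[OF h k _ x])
  fix y assume y: "y \<in> carrier (ext_scalars A B f M)"
  note comp = semilinear_map_comp[OF second.nat_map_semilinear _ ring_hom_closed[OF second.hom_\<phi>] refl]
  show "h (ext_scalars_nat B C g (ext_scalars A B f M) y) =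
      k (ext_scalars_nat B C g (ext_scalars A B f M) y)"
    by (rule first.extension_unique[OF comp[OF h] comp[OF k] eq y])
qed

end

lemma iterated_scalar_extensionI:
  assumes "ring A" "ring B" "ring C" "f \<in> ring_hom A B" "g \<in> ring_hom B C" "left_module A M"
  shows "iterated_scalar_extension A B C f g M"
proof -
  interpret first: scalar_extension A B f M by (rule scalar_extension.intro; fact)
  interpret second: scalar_extension B C g "ext_scalars A B f M"
    by (rule scalar_extension.intro; fact assms first.left_module_ext_scalars)
  show ?thesis ..
qed

text \<open>Both sides solve the same universal problem because the composites agree; the maps
  obtained in the two directions are inverse to each other by uniqueness.\<close>

lemma iterated_ext_ident_properties:
  assumes P: "iterated_scalar_extension A B C f g M" and Q: "iterated_scalar_extension A B C f' g' M"
    and eq: "\<And>a. a \<in> carrier A \<Longrightarrow> g (f a) = g' (f' a)"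
  shows "semilinear_map C (\<lambda>c. c) (ext_scalars B C g (ext_scalars A B f M))
      (ext_scalars B C g' (ext_scalars A B f' M)) (iterated_ext_ident A B C f g f' g' M)"
    and "m \<in> carrier M \<Longrightarrow> iterated_ext_ident A B C f g f' g' M
      (ext_scalars_nat B C g (ext_scalars A B f M) (ext_scalars_nat A B f M m)) =
      ext_scalars_nat B C g' (ext_scalars A B f' M) (ext_scalars_nat A B f' M m)"
proof -
  interpret P: iterated_scalar_extension A B C f g M by (rule P)
  interpret Q: iterated_scalar_extension A B C f' g' M by (rule Q)
  interpret PM: left_module C "ext_scalars B C g (ext_scalars A B f M)"
    by (rule P.second.left_module_ext_scalars)
  interpret C: ring C by (rule P.second.ring_B)
  have idC: "(\<lambda>c. c) \<in> ring_hom C C" by (rule ring_hom_memI) auto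
  obtain i where i: "semilinear_map C (\<lambda>c. c) P.EE Q.EE i" "\<And>m. m \<in> carrier M \<Longrightarrow> i (P.nat2 m) = Q.nat2 m"
    using P.iterated_universal[OF idC Q.second.left_module_ext_scalars Q.nat2_semilinear eq[symmetric]]
    by blast
  obtain j where j: "semilinear_map C (\<lambda>c. c) Q.EE P.EE j" "\<And>m. m \<in> carrier M \<Longrightarrow> j (Q.nat2 m) = P.nat2 m"
    using Q.iterated_universal[OF idC P.second.left_module_ext_scalars P.nat2_semilinear eq]
    by blast
  have ij: "i (j x) = x" if "x \<in> carrier Q.EE" for x
    by (rule Q.iterated_unique[OF semilinear_map_comp[OF j(1) i(1)] semilinear_map_id _ that])
      (simp_all add: i j)
  have ji: "j (i x) = x" if "x \<in> carrier P.EE" for x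
    by (rule P.iterated_unique[OF semilinear_map_comp[OF i(1) j(1)] semilinear_map_id _ that])
      (simp_all add: i j)
  have unique: "f x = g x" if "semilinear_map C (\<lambda>c. c) P.EE Q.EE f" "semilinear_map C (\<lambda>c. c) P.EE Q.EE g"
    "\<forall>m \<in> carrier M. f (P.nat2 m) = g (P.nat2 m)" "x \<in> carrier P.EE" for f g x
    by (rule P.iterated_unique[OF that(1,2) _ that(4)]) (use that(3) in blast)
  note props = compatible_iso_properties[of C P.EE Q.EE i j M P.nat2 Q.nat2, OF i(1) j(1) ij ji i(2)
      semilinear_mapD(2)[OF P.nat2_semilinear]]
  show "semilinear_map C (\<lambda>c. c) P.EE Q.EE (iterated_ext_ident A B C f g f' g' M)"
    unfolding iterated_ext_ident_def comp_def by (rule props(1)) (assumption | erule (3) unique | erule (1) PM.smult_closed PM.a_closed)+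
  show "m \<in> carrier M \<Longrightarrow> iterated_ext_ident A B C f g f' g' M (P.nat2 m) = Q.nat2 m"
    unfolding iterated_ext_ident_def comp_def by (rule props(2)) (assumption | erule (3) unique | erule (1) PM.smult_closed PM.a_closed)+
qed

text \<open>When the composite is the identity, \<open>M\<close> itself solves the universal
  problem, and the natural map, now linear over \<open>A\<close>, is the inverse of the
  identification.\<close>

lemma retract_ext_ident_properties:
  assumes P: "iterated_scalar_extension A B A f g M"
    and eq: "\<And>a. a \<in> carrier A \<Longrightarrow> g (f a) = a"
  shows "semilinear_map A (\<lambda>a. a) (ext_scalars B A g (ext_scalars A B f M)) M
      (retract_ext_ident A B f g M)"
    and "m \<in> carrier M \<Longrightarrow> retract_ext_ident A B f g M
      (ext_scalars_nat B A g (ext_scalars A B f M) (ext_scalars_nat A B f M m)) = m"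
proof -
  interpret P: iterated_scalar_extension A B A f g M by (rule P)
  interpret PM: left_module A "ext_scalars B A g (ext_scalars A B f M)"
    by (rule P.second.left_module_ext_scalars)
  interpret A: ring A by (rule P.first.ring_A)
  have idA: "(\<lambda>c. c) \<in> ring_hom A A" by (rule ring_hom_memI) auto
  have nat2: "semilinear_map A (\<lambda>a. a) M P.EE P.nat2"
    using P.nat2_semilinear eq by (rule semilinear_map_cong)
  obtain i where i: "semilinear_map A (\<lambda>a. a) P.EE M i" "\<And>m. m \<in> carrier M \<Longrightarrow> i (P.nat2 m) = m"
    using P.iterated_universal[OF idA P.first.left_module_M semilinear_map_id eq[symmetric]] by blast
  have ji: "P.nat2 (i x) = x" if "x \<in> carrier P.EE" for x
    by (rule P.iterated_unique[OF semilinear_map_comp[OF i(1) nat2] semilinear_map_id _ that])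
      (simp_all add: i)
  have unique: "f x = g x" if "semilinear_map A (\<lambda>c. c) P.EE M f" "semilinear_map A (\<lambda>c. c) P.EE M g"
    "\<forall>m \<in> carrier M. f (P.nat2 m) = g (P.nat2 m)" "x \<in> carrier P.EE" for f g x
    by (rule P.iterated_unique[OF that(1,2) _ that(4)]) (use that(3) in blast)
  note props = compatible_iso_properties[of A P.EE M i P.nat2 M P.nat2 "\<lambda>m. m", OF i(1) nat2 i(2) ji i(2)
      semilinear_mapD(2)[OF nat2]]
  show "semilinear_map A (\<lambda>a. a) P.EE M (retract_ext_ident A B f g M)"
    unfolding retract_ext_ident_def comp_def id_def by (rule props(1)) (assumption | erule (3) unique | erule (1) PM.smult_closed PM.a_closed)+
  show "m \<in> carrier M \<Longrightarrow> retract_ext_ident A B f g M (P.nat2 m) = m"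
    unfolding retract_ext_ident_def comp_def id_def by (rule props(2)) (assumption | erule (3) unique | erule (1) PM.smult_closed PM.a_closed)+
qed


section \<open>Invertibility of cocycles over rings\<close>

text \<open>For affine group schemes, \<open>\<Theta>\<close> is a cocycle and the inverse of \<open>\<Theta>\<^sub>g\<close> is a pullback of
  \<open>\<Theta>\<close> at \<open>g\<^sup>-\<^sup>1\<close>. The maps \<open>f\<close> and \<open>f'\<close> below pull the cocycle identity back to the pairs
  \<open>(g\<^sup>-\<^sup>1, g)\<close> and \<open>(g, g\<^sup>-\<^sup>1)\<close>.\<close>

theorem cocycle_bijective:
  fixes A :: "('a, 'x) ring_scheme" and B :: "('b, 'y) ring_scheme" and C :: "('c, 'z) ring_scheme"
    and M :: "('a, 'm) module"
  assumes ring: "ring A" "ring B" "ring C" and M: "left_module A M"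
    and u: "u \<in> ring_hom A B" and \<delta>: "\<delta> \<in> ring_hom A B" and e: "e \<in> ring_hom B A"
    and u': "u' \<in> ring_hom B C" and d: "d \<in> ring_hom B C" and D: "D \<in> ring_hom B C"
    and f: "f \<in> ring_hom C B" and f': "f' \<in> ring_hom C B"
    and d\<delta>: "\<And>a. a \<in> carrier A \<Longrightarrow> d (\<delta> a) = D (\<delta> a)"
    and du: "\<And>a. a \<in> carrier A \<Longrightarrow> d (u a) = u' (\<delta> a)"
    and Du: "\<And>a. a \<in> carrier A \<Longrightarrow> D (u a) = u' (u a)"
    and eu: "\<And>a. a \<in> carrier A \<Longrightarrow> e (u a) = a"
    and e\<delta>: "\<And>a. a \<in> carrier A \<Longrightarrow> e (\<delta> a) = a"
    and fu': "\<And>b. b \<in> carrier B \<Longrightarrow> f (u' b) = b"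
    and fD: "\<And>b. b \<in> carrier B \<Longrightarrow> f (D b) = u (e b)"
    and f'd: "\<And>b. b \<in> carrier B \<Longrightarrow> f' (d b) = b"
    and f'D: "\<And>b. b \<in> carrier B \<Longrightarrow> f' (D b) = \<delta> (e b)"
    and \<Theta>: "semilinear_map B (\<lambda>b. b) (ext_scalars A B u M) (ext_scalars A B \<delta> M) \<Theta>"
    and mult: "\<And>x. x \<in> carrier (ext_scalars B C u' (ext_scalars A B u M)) \<Longrightarrow>
      iterated_ext_ident A B C \<delta> d \<delta> D M (ext_scalars_map B C d (ext_scalars A B \<delta> M) \<Theta>
        (iterated_ext_ident A B C \<delta> u' u d M (ext_scalars_map B C u' (ext_scalars A B \<delta> M) \<Theta> x))) =
      ext_scalars_map B C D (ext_scalars A B \<delta> M) \<Theta> (iterated_ext_ident A B C u u' u D M x)"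
    and unital: "\<And>x. x \<in> carrier (ext_scalars B A e (ext_scalars A B u M)) \<Longrightarrow>
      retract_ext_ident A B \<delta> e M (ext_scalars_map B A e (ext_scalars A B \<delta> M) \<Theta> x) =
      retract_ext_ident A B u e M x"
  shows "bij_betw \<Theta> (carrier (ext_scalars A B u M)) (carrier (ext_scalars A B \<delta> M))"
proof -
  let ?uM = "ext_scalars A B u M" and ?\<delta>M = "ext_scalars A B \<delta> M"
  let ?n = "ext_scalars_nat A B u M" and ?\<nu> = "ext_scalars_nat A B \<delta> M"
  note closed = ring_hom_closed
  interpret uu': iterated_scalar_extension A B C u u' M
    by (rule iterated_scalar_extensionI) fact+
  interpret \<delta>u': iterated_scalar_extension A B C \<delta> u' M
    by (rule iterated_scalar_extensionI) fact+
  interpret ud: iterated_scalar_extension A B C u d M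
    by (rule iterated_scalar_extensionI) fact+
  interpret uD: iterated_scalar_extension A B C u D M
    by (rule iterated_scalar_extensionI) fact+
  interpret \<delta>d: iterated_scalar_extension A B C \<delta> d M
    by (rule iterated_scalar_extensionI) fact+
  interpret \<delta>D: iterated_scalar_extension A B C \<delta> D M
    by (rule iterated_scalar_extensionI) fact+
  interpret ue: iterated_scalar_extension A B A u e M
    by (rule iterated_scalar_extensionI) fact+
  interpret \<delta>e: iterated_scalar_extension A B A \<delta> e M
    by (rule iterated_scalar_extensionI) fact+
  interpret LuM: left_module B ?uM by (rule uu'.first.left_module_ext_scalars)
  define i1 where "i1 = iterated_ext_ident A B C \<delta> u' u d M"
  define i2 where "i2 = iterated_ext_ident A B C u u' u D M"
  define i3 where "i3 = iterated_ext_ident A B C \<delta> d \<delta> D M"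
  note i1 = iterated_ext_ident_properties[OF \<delta>u'.iterated_scalar_extension_axioms
      ud.iterated_scalar_extension_axioms du[symmetric], folded i1_def]
  note i2 = iterated_ext_ident_properties[OF uu'.iterated_scalar_extension_axioms
      uD.iterated_scalar_extension_axioms Du[symmetric], folded i2_def]
  note i3 = iterated_ext_ident_properties[OF \<delta>d.iterated_scalar_extension_axioms
      \<delta>D.iterated_scalar_extension_axioms d\<delta>, folded i3_def]
  note retract_u = retract_ext_ident_properties[OF ue.iterated_scalar_extension_axioms eu]
  note retract_\<delta> = retract_ext_ident_properties[OF \<delta>e.iterated_scalar_extension_axioms e\<delta>]
  note map_u' = ext_scalars_map_semilinear[OF uu'.second.scalar_extension_axioms
      \<delta>u'.second.scalar_extension_axioms \<Theta>]
  note map_d = ext_scalars_map_semilinear[OF ud.second.scalar_extension_axioms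
      \<delta>d.second.scalar_extension_axioms \<Theta>]
  note map_D = ext_scalars_map_semilinear[OF uD.second.scalar_extension_axioms
      \<delta>D.second.scalar_extension_axioms \<Theta>]
  note map_e = ext_scalars_map_semilinear[OF ue.second.scalar_extension_axioms
      \<delta>e.second.scalar_extension_axioms \<Theta>]
  define \<theta> where "\<theta> m = \<Theta> (?n m)" for m
  have \<theta>: "\<theta> m \<in> carrier ?\<delta>M" if "m \<in> carrier M" for m
    using semilinear_mapD(2)[OF \<Theta>] uu'.first.nat_map_closed[OF that] by (simp add: \<theta>_def)

  \<comment> \<open>Evaluation \<open>b \<otimes> m \<mapsto> e(b) m\<close>, an
    \<open>e\<close>-semilinear map. Unitality at the natural image of \<open>m\<close> says that
    \<open>E\<close> sends \<open>\<theta> m\<close> back to \<open>m\<close>.\<close>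
  define E where "E y = retract_ext_ident A B \<delta> e M (ext_scalars_nat B A e ?\<delta>M y)" for y
  have E: "semilinear_map B e ?\<delta>M M E"
    unfolding E_def by (rule semilinear_map_comp[OF \<delta>e.second.nat_map_semilinear retract_\<delta>(1)])
      (simp_all add: closed[OF e])
  have E_nat: "E (?\<nu> m) = m" if "m \<in> carrier M" for m
    using that by (simp add: E_def retract_\<delta>(2))
  have E_\<theta>: "E (\<theta> m) = m" if "m \<in> carrier M" for m
    using that unital[OF semilinear_mapD(2)[OF ue.nat2_semilinear that]]
    by (simp add: E_def \<theta>_def map_e(2) retract_u(2) uu'.first.nat_map_closed)

  \<comment> \<open>All that follows \<open>u'\<^sup>*\<Theta>\<close> on the left of the cocycle
    identity, restricted to the natural image of \<open>\<delta>\<^sup>* M\<close>. At the natural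
    image of \<open>m\<close> the identity then reads
    \<open>\<Lambda>(\<theta> m) = 1 \<otimes> \<theta> m\<close>.\<close>
  define \<Lambda> where "\<Lambda> y = i3 (ext_scalars_map B C d ?\<delta>M \<Theta> (i1 (ext_scalars_nat B C u' ?\<delta>M y)))" for y
  have \<Lambda>: "semilinear_map B u' ?\<delta>M (ext_scalars B C D ?\<delta>M) \<Lambda>"
    unfolding \<Lambda>_def
    by (rule semilinear_map_comp[OF \<delta>u'.second.nat_map_semilinear
          semilinear_map_comp[OF i1(1) semilinear_map_comp[OF map_d(1) i3(1)]]])
      (simp_all add: closed[OF u'])
  have \<Lambda>_nat: "\<Lambda> (?\<nu> m) = i3 (ext_scalars_nat B C d ?\<delta>M (\<theta> m))" if "m \<in> carrier M" for m
    using that by (simp add: \<Lambda>_def i1(2) map_d(2) \<theta>_def uu'.first.nat_map_closed)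
  have cocycle: "\<Lambda> (\<theta> m) = ext_scalars_nat B C D ?\<delta>M (\<theta> m)" if "m \<in> carrier M" for m
    using that mult[OF semilinear_mapD(2)[OF uu'.nat2_semilinear that]]
    by (simp add: \<Lambda>_def \<theta>_def i1_def[symmetric] i2_def[symmetric] i3_def[symmetric] i2(2)
        map_u'(2) map_D(2) uu'.first.nat_map_closed)

  \<comment> \<open>The pullback of \<open>D\<^sup>*\<Theta>\<close> is trivial: since
    \<open>\<psi> D = \<chi> e\<close>, both \<open>y \<mapsto> G (1 \<otimes> y)\<close> and
    \<open>N\<close> after \<open>E\<close> are semilinear over the same map and agree on the
    generators, and \<open>E\<close> takes \<open>\<theta> m\<close> to \<open>m\<close>.\<close>
  have factor: "G (ext_scalars_nat B C D ?\<delta>M (\<theta> m)) = N m"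
    if G: "semilinear_map C \<psi> (ext_scalars B C D ?\<delta>M) P G"
      and G_nat: "\<And>m. m \<in> carrier M \<Longrightarrow> G (ext_scalars_nat B C D ?\<delta>M (?\<nu> m)) = N m"
      and N: "semilinear_map A \<chi> M P N"
      and \<psi>D: "\<And>b. b \<in> carrier B \<Longrightarrow> \<psi> (D b) = \<chi> (e b)" and m: "m \<in> carrier M"
    for G \<psi> \<chi> N m and P :: "('b, 'p) module"
  proof -
    have "G (ext_scalars_nat B C D ?\<delta>M (\<theta> m)) = N (E (\<theta> m))"
    proof (rule \<delta>u'.first.extension_unique[OF _ _ _ \<theta>[OF m]])
      show "semilinear_map B (\<lambda>b. \<chi> (e b)) ?\<delta>M P (\<lambda>y. G (ext_scalars_nat B C D ?\<delta>M y))"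
        by (rule semilinear_map_comp[OF \<delta>D.second.nat_map_semilinear G])
          (simp_all add: closed[OF D] \<psi>D)
      show "semilinear_map B (\<lambda>b. \<chi> (e b)) ?\<delta>M P (\<lambda>y. N (E y))"
        by (rule semilinear_map_comp[OF E N]) (simp_all add: closed[OF e])
    qed (simp add: G_nat E_nat)
    then show ?thesis by (simp add: E_\<theta> m)
  qed

  \<comment> \<open>\<open>G\<close> exists because
    \<open>f D \<delta> = u e \<delta> = u\<close>.\<close>
  obtain G where G: "semilinear_map C f (ext_scalars B C D ?\<delta>M) ?uM G"
    "\<And>m. m \<in> carrier M \<Longrightarrow> G (ext_scalars_nat B C D ?\<delta>M (?\<nu> m)) = ?n m"
    using \<delta>D.iterated_universal[OF f uu'.first.left_module_ext_scalars uu'.first.nat_map_semilinear]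
    by (auto simp: fD e\<delta> closed[OF \<delta>])
  \<comment> \<open>In effect \<open>(f d)\<^sup>*\<Theta>\<close>. It is genuinely linear since
    \<open>f u' = id\<close>, so being a left inverse need only be tested on the natural image of
    \<open>M\<close>.\<close>
  define \<Lambda>' where "\<Lambda>' y = G (\<Lambda> y)" for y
  have \<Lambda>': "semilinear_map B (\<lambda>b. b) ?\<delta>M ?uM \<Lambda>'"
    unfolding \<Lambda>'_def by (rule semilinear_map_comp[OF \<Lambda> G(1)]) (simp_all add: closed[OF u'] fu')
  have \<Lambda>'_\<theta>: "\<Lambda>' (\<Theta> (?n m)) = ?n m" if "m \<in> carrier M" for m
    using that factor[OF G uu'.first.nat_map_semilinear fD that] cocycle[OF that]
    by (simp add: \<Lambda>'_def \<theta>_def)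
  have left_inverse: "\<Lambda>' (\<Theta> x) = x" if "x \<in> carrier ?uM" for x
    by (rule uu'.first.extension_unique[OF semilinear_map_comp[OF \<Theta> \<Lambda>'] semilinear_map_id
          \<Lambda>'_\<theta> that]) auto

  obtain G' where G': "semilinear_map C f' (ext_scalars B C D ?\<delta>M) ?\<delta>M G'"
    "\<And>m. m \<in> carrier M \<Longrightarrow> G' (ext_scalars_nat B C D ?\<delta>M (?\<nu> m)) = ?\<nu> m"
    using \<delta>D.iterated_universal[OF f' \<delta>u'.first.left_module_ext_scalars \<delta>u'.first.nat_map_semilinear]
    by (auto simp: f'D e\<delta> closed[OF \<delta>])
  \<comment> \<open>Here \<open>f' d = id\<close> makes the composite linear, and it fixes the
    generators.\<close>
  have G'd: "G' (i3 (ext_scalars_nat B C d ?\<delta>M y)) = y" if "y \<in> carrier ?\<delta>M" for y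
  proof (rule \<delta>u'.first.extension_unique[OF _ semilinear_map_id _ that])
    show "semilinear_map B (\<lambda>b. b) ?\<delta>M ?\<delta>M (\<lambda>y. G' (i3 (ext_scalars_nat B C d ?\<delta>M y)))"
      by (rule semilinear_map_comp[OF \<delta>d.second.nat_map_semilinear
            semilinear_map_comp[OF i3(1) G'(1), where \<chi> = f']])
        (simp_all add: closed[OF d] f'd)
  qed (simp add: i3(2) G'(2))
  have f'u': "(\<lambda>b. f' (u' b)) \<in> ring_hom B B"
    using ring_hom_trans[OF u' f'] by (simp add: o_def)
  \<comment> \<open>Compatibility with the action of \<open>A\<close> is
    \<open>f' u' \<delta> = f' d u = u\<close>.\<close>
  obtain \<Sigma> where \<Sigma>: "semilinear_map B (\<lambda>b. f' (u' b)) ?\<delta>M ?uM \<Sigma>"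
    "\<And>m. m \<in> carrier M \<Longrightarrow> \<Sigma> (?\<nu> m) = ?n m"
    using \<delta>u'.first.extension_universal[OF f'u' uu'.first.left_module_ext_scalars
        semilinear_map_cong[OF uu'.first.nat_map_semilinear]]
    by (auto simp: du[symmetric] f'd closed[OF u])
  \<comment> \<open>Pulling back along \<open>f'\<close> turns \<open>d\<^sup>*\<Theta>\<close> into
    \<open>\<Theta>\<close> and leaves the twist \<open>f' u'\<close> to \<open>\<Sigma>\<close>.
    With the cocycle identity this exhibits a preimage of each natural generator.\<close>
  have \<Theta>_\<Sigma>: "G' (\<Lambda> y) = \<Theta> (\<Sigma> y)" if "y \<in> carrier ?\<delta>M" for y
  proof (rule \<delta>u'.first.extension_unique[OF _ _ _ that])
    show "semilinear_map B (\<lambda>b. f' (u' b)) ?\<delta>M ?\<delta>M (\<lambda>y. G' (\<Lambda> y))"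
      by (rule semilinear_map_comp[OF \<Lambda> G'(1)]) (simp_all add: closed[OF u'])
    show "semilinear_map B (\<lambda>b. f' (u' b)) ?\<delta>M ?\<delta>M (\<lambda>y. \<Theta> (\<Sigma> y))"
      by (rule semilinear_map_comp[OF \<Sigma>(1) \<Theta>]) (simp_all add: closed[OF f'u'])
  qed (simp add: \<Lambda>_nat G'd \<theta> \<Sigma>(2) \<theta>_def[symmetric])
  have nat_image: "\<Theta> (\<Sigma> (\<theta> m)) = ?\<nu> m" if "m \<in> carrier M" for m
    using factor[OF G' \<delta>u'.first.nat_map_semilinear f'D that] cocycle[OF that] \<Theta>_\<Sigma>[OF \<theta>[OF that]]
    by simp
  \<comment> \<open>\<open>\<Sigma>\<close> is only semilinear, but \<open>\<Theta>\<close> is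
    linear: its image is a submodule, and \<open>b\<close> acting on
    \<open>\<Sigma> (\<theta> m)\<close> is a preimage of \<open>b \<otimes> m\<close>.\<close>
  have surj: "\<exists>x \<in> carrier ?uM. \<Theta> x = y" if "y \<in> carrier ?\<delta>M" for y
    using that
  proof (induction rule: \<delta>u'.first.tensor_induct)
    case (pure b m)
    then have "\<Theta> (b \<odot>\<^bsub>?uM\<^esub> \<Sigma> (\<theta> m)) = pure_tensor A B (\<lambda>b a. b \<otimes>\<^bsub>B\<^esub> \<delta> a) M b m"
      by (simp add: semilinear_mapD(4)[OF \<Theta>] semilinear_mapD(2)[OF \<Sigma>(1)] \<theta> nat_image
          \<delta>u'.first.smult_nat)
    then show ?case
      using pure by (blast intro: LuM.smult_closed semilinear_mapD(2)[OF \<Sigma>(1)] \<theta>)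
  next
    case (add x y)
    then obtain x' y' where "x' \<in> carrier ?uM" "y' \<in> carrier ?uM" "\<Theta> x' = x" "\<Theta> y' = y"
      by blast
    then show ?case
      using semilinear_mapD(3)[OF \<Theta>, of x' y'] uu'.second.M.a_closed[of x' y'] by blast
  qed
  show ?thesis
    unfolding bij_betw_def
  proof
    show "inj_on \<Theta> (carrier ?uM)"
      by (rule inj_on_inverseI) (rule left_inverse)
    show "\<Theta> ` carrier ?uM = carrier ?\<delta>M"
      using surj semilinear_mapD(2)[OF \<Theta>] by (intro equalityI subsetI) (metis imageE, metis imageI)
  qed
qed


section \<open>Tensor products over the base field\<close>

abbreviation linear_map :: "('k, 'z) ring_scheme \<Rightarrow> ('k, 'v) module \<Rightarrow> ('k, 'w) module \<Rightarrow> ('v \<Rightarrow> 'w) \<Rightarrow> bool" where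
  "linear_map K \<equiv> semilinear_map K (\<lambda>k. k)"

text \<open>Balancedness only moves scalars between the two arguments. The second clause ties them
  to the action on \<open>P\<close>, which makes the induced map linear and not merely
  additive.\<close>

definition bilinear_map ::
    "('k, 'z) ring_scheme \<Rightarrow> ('k, 'v) module \<Rightarrow> ('k, 'w) module \<Rightarrow> ('k, 'p) module \<Rightarrow> ('v \<Rightarrow> 'w \<Rightarrow> 'p) \<Rightarrow> bool" where
  "bilinear_map K V W P f \<longleftrightarrow> balanced_map K V (\<lambda>v k. k \<odot>\<^bsub>V\<^esub> v) W P f \<and>
     (\<forall>k \<in> carrier K. \<forall>v \<in> carrier V. \<forall>w \<in> carrier W. f (k \<odot>\<^bsub>V\<^esub> v) w = k \<odot>\<^bsub>P\<^esub> f v w)"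

lemma bilinear_mapI:
  assumes "\<And>v w. \<lbrakk>v \<in> carrier V; w \<in> carrier W\<rbrakk> \<Longrightarrow> f v w \<in> carrier P"
    and "\<And>v w w'. \<lbrakk>v \<in> carrier V; w \<in> carrier W; w' \<in> carrier W\<rbrakk> \<Longrightarrow>
      f v (w \<oplus>\<^bsub>W\<^esub> w') = f v w \<oplus>\<^bsub>P\<^esub> f v w'"
    and "\<And>v v' w. \<lbrakk>v \<in> carrier V; v' \<in> carrier V; w \<in> carrier W\<rbrakk> \<Longrightarrow>
      f (v \<oplus>\<^bsub>V\<^esub> v') w = f v w \<oplus>\<^bsub>P\<^esub> f v' w"
    and "\<And>k v w. \<lbrakk>k \<in> carrier K; v \<in> carrier V; w \<in> carrier W\<rbrakk> \<Longrightarrow>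
      f (k \<odot>\<^bsub>V\<^esub> v) w = k \<odot>\<^bsub>P\<^esub> f v w"
    and "\<And>k v w. \<lbrakk>k \<in> carrier K; v \<in> carrier V; w \<in> carrier W\<rbrakk> \<Longrightarrow>
      f v (k \<odot>\<^bsub>W\<^esub> w) = k \<odot>\<^bsub>P\<^esub> f v w"
  shows "bilinear_map K V W P f"
  unfolding bilinear_map_def using assms by (auto intro!: balanced_mapI)

lemma bilinear_mapD:
  assumes "bilinear_map K V W P f"
  shows "balanced_map K V (\<lambda>v k. k \<odot>\<^bsub>V\<^esub> v) W P f"
    and "\<And>v w. \<lbrakk>v \<in> carrier V; w \<in> carrier W\<rbrakk> \<Longrightarrow> f v w \<in> carrier P"
    and "\<And>v w w'. \<lbrakk>v \<in> carrier V; w \<in> carrier W; w' \<in> carrier W\<rbrakk> \<Longrightarrow>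
      f v (w \<oplus>\<^bsub>W\<^esub> w') = f v w \<oplus>\<^bsub>P\<^esub> f v w'"
    and "\<And>v v' w. \<lbrakk>v \<in> carrier V; v' \<in> carrier V; w \<in> carrier W\<rbrakk> \<Longrightarrow>
      f (v \<oplus>\<^bsub>V\<^esub> v') w = f v w \<oplus>\<^bsub>P\<^esub> f v' w"
    and "\<And>k v w. \<lbrakk>k \<in> carrier K; v \<in> carrier V; w \<in> carrier W\<rbrakk> \<Longrightarrow>
      f (k \<odot>\<^bsub>V\<^esub> v) w = k \<odot>\<^bsub>P\<^esub> f v w"
    and "\<And>k v w. \<lbrakk>k \<in> carrier K; v \<in> carrier V; w \<in> carrier W\<rbrakk> \<Longrightarrow>
      f v (k \<odot>\<^bsub>W\<^esub> w) = k \<odot>\<^bsub>P\<^esub> f v w"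
  using assms unfolding bilinear_map_def by (auto dest: balanced_mapD)

lemma linear_mapI:
  assumes "\<And>x. x \<in> carrier V \<Longrightarrow> f x \<in> carrier W"
    and "\<And>x y. \<lbrakk>x \<in> carrier V; y \<in> carrier V\<rbrakk> \<Longrightarrow> f (x \<oplus>\<^bsub>V\<^esub> y) = f x \<oplus>\<^bsub>W\<^esub> f y"
    and "\<And>k x. \<lbrakk>k \<in> carrier K; x \<in> carrier V\<rbrakk> \<Longrightarrow> f (k \<odot>\<^bsub>V\<^esub> x) = k \<odot>\<^bsub>W\<^esub> f x"
  shows "linear_map K V W f"
  using assms by (intro semilinear_mapI additive_mapI)

lemma linear_map_comp:
  "\<lbrakk>linear_map K V W f; linear_map K W P g\<rbrakk> \<Longrightarrow> linear_map K V P (\<lambda>x. g (f x))"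
  by (rule semilinear_map_comp) auto

lemma bilinear_map_comp:
  assumes f: "bilinear_map K V W P f" and g: "linear_map K P P' g"
  shows "bilinear_map K V W P' (\<lambda>v w. g (f v w))"
  by (rule bilinear_mapI) (simp_all add: bilinear_mapD[OF f] semilinear_mapD[OF g])

lemma bilinear_map_comp2:
  assumes f: "bilinear_map K V W P f" and g: "linear_map K V' V g" and h: "linear_map K W' W h"
  shows "bilinear_map K V' W' P (\<lambda>v w. f (g v) (h w))"
  by (rule bilinear_mapI)
    (simp_all add: bilinear_mapD[OF f] semilinear_mapD[OF g] semilinear_mapD[OF h])

lemma bilinear_map_linear:
  assumes f: "bilinear_map K V W P f"
  shows "v \<in> carrier V \<Longrightarrow> linear_map K W P (f v)"
    and "w \<in> carrier W \<Longrightarrow> linear_map K V P (\<lambda>v. f v w)"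
  by (rule linear_mapI; simp add: bilinear_mapD[OF f])+

locale vector_tensor = V: module K V + W: module K W
  for K :: "'k ring" and V :: "('k, 'v) module" and W :: "('k, 'w) module"

text \<open>\<open>tensor_algebra\<close> serves here as a mere vector space, so that it also covers
  \<open>H \<otimes> M\<close>, where the second factor carries no product.\<close>

sublocale vector_tensor \<subseteq>
  tensor_product K V "\<lambda>v k. k \<odot>\<^bsub>V\<^esub> v" W "tensor_algebra K V W"
  by unfold_locales (auto simp: tensor_algebra_def Let_def)

context vector_tensor begin

abbreviation (input) "T \<equiv> tensor_algebra K V W"

lemma smult_eq: "k \<odot>\<^bsub>T\<^esub> x = tensor_lift (ktensor_group K V W) (\<lambda>v w. pure (k \<odot>\<^bsub>V\<^esub> v) w) x"
  by (simp add: tensor_algebra_def Let_def)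

lemma smult_balanced:
  assumes "k \<in> carrier K"
  shows "balanced_map K V (\<lambda>v k. k \<odot>\<^bsub>V\<^esub> v) W T (\<lambda>v w. pure (k \<odot>\<^bsub>V\<^esub> v) w)"
proof (rule balanced_mapI)
  fix v r w assume "v \<in> carrier V" "r \<in> carrier K" "w \<in> carrier W"
  then show "pure (k \<odot>\<^bsub>V\<^esub> (r \<odot>\<^bsub>V\<^esub> v)) w = pure (k \<odot>\<^bsub>V\<^esub> v) (r \<odot>\<^bsub>W\<^esub> w)"
    using assms pure_act[of "k \<odot>\<^bsub>V\<^esub> v" r w]
    by (simp add: V.smult_assoc1[symmetric] V.R.m_comm)
qed (use assms in \<open>simp_all add: pure_add_left pure_add_right V.smult_r_distr\<close>)

lemma smult_additive: "k \<in> carrier K \<Longrightarrow> additive_map T T (\<lambda>x. k \<odot>\<^bsub>T\<^esub> x)"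
  unfolding smult_eq by (rule tensor_lift_additive[OF add_group_of_tensor_group smult_balanced])

lemma smult_pure: "\<lbrakk>k \<in> carrier K; v \<in> carrier V; w \<in> carrier W\<rbrakk> \<Longrightarrow>
    k \<odot>\<^bsub>T\<^esub> pure v w = pure (k \<odot>\<^bsub>V\<^esub> v) w"
  unfolding smult_eq by (rule tensor_lift_pure[OF add_group_of_tensor_group smult_balanced])

lemma module_tensor: "module K T"
proof -
  interpret T: abelian_group T by (rule abelian_group_tensor)
  note add = additive_map_add[OF smult_additive] and closed = additive_map_closed[OF smult_additive]
  show ?thesis
  proof (rule moduleI)
    fix a b x assume ab: "a \<in> carrier K" "b \<in> carrier K" and x: "x \<in> carrier T"
    show "(a \<oplus>\<^bsub>K\<^esub> b) \<odot>\<^bsub>T\<^esub> x = a \<odot>\<^bsub>T\<^esub> x \<oplus>\<^bsub>T\<^esub> b \<odot>\<^bsub>T\<^esub> x"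
      using x by (induction rule: tensor_induct)
        (use ab in \<open>simp_all add: smult_pure pure_add_left V.smult_l_distr add closed T.a_ac\<close>)
    show "(a \<otimes>\<^bsub>K\<^esub> b) \<odot>\<^bsub>T\<^esub> x = a \<odot>\<^bsub>T\<^esub> (b \<odot>\<^bsub>T\<^esub> x)"
      using x by (induction rule: tensor_induct)
        (use ab in \<open>simp_all add: smult_pure V.smult_assoc1 add closed\<close>)
  next
    fix x assume x: "x \<in> carrier T"
    show "\<one>\<^bsub>K\<^esub> \<odot>\<^bsub>T\<^esub> x = x"
      using x by (induction rule: tensor_induct) (simp_all add: smult_pure add)
  qed (auto simp: add closed V.R.is_cring T.abelian_group_axioms)
qed

lemma pure_bilinear: "bilinear_map K V W T pure"
  by (rule bilinear_mapI)
    (simp_all add: pure_add_left pure_add_right smult_pure pure_act[symmetric])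

context
  fixes G :: "('p, 'g) monoid_scheme" and P :: "('k, 'p) module"
  assumes G: "add_group_of G P" and P: "module K P"
begin

lemma lift_pure:
  "\<lbrakk>bilinear_map K V W P f; v \<in> carrier V; w \<in> carrier W\<rbrakk> \<Longrightarrow> tensor_lift G f (pure v w) = f v w"
  by (rule tensor_lift_pure[OF G bilinear_mapD(1)])

lemma lift_linear:
  assumes f: "bilinear_map K V W P f"
  shows "linear_map K T P (tensor_lift G f)"
proof (rule semilinear_mapI)
  interpret P: module K P by (rule P)
  note bal = bilinear_mapD(1)[OF f]
  show add: "additive_map T P (tensor_lift G f)"
    by (rule tensor_lift_additive[OF G bal])
  fix k x assume k: "k \<in> carrier K" and "x \<in> carrier T"
  from this(2) show "tensor_lift G f (k \<odot>\<^bsub>T\<^esub> x) = k \<odot>\<^bsub>P\<^esub> tensor_lift G f x"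
    by (induction rule: tensor_induct)
      (use k in \<open>simp_all add: smult_pure lift_pure[OF f] bilinear_mapD[OF f] P.smult_r_distr
        additive_map_add[OF add] additive_map_closed[OF add]
        additive_map_add[OF smult_additive] additive_map_closed[OF smult_additive]\<close>)
qed

lemma lift_param:
  assumes f: "\<And>a b. \<lbrakk>a \<in> carrier V'; b \<in> carrier W'\<rbrakk> \<Longrightarrow> bilinear_map K V W P (f a b)"
    and param: "\<And>v w. \<lbrakk>v \<in> carrier V; w \<in> carrier W\<rbrakk> \<Longrightarrow>
      bilinear_map K V' W' P (\<lambda>a b. f a b v w)"
    and V': "vector_tensor K V' W'" and y: "y \<in> carrier T"
  shows "bilinear_map K V' W' P (\<lambda>a b. tensor_lift G (f a b) y)"
  unfolding bilinear_map_def
proof (intro conjI ballI)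
  interpret P: module K P by (rule P)
  interpret V': vector_tensor K V' W' by (rule V')
  show "balanced_map K V' (\<lambda>v k. k \<odot>\<^bsub>V'\<^esub> v) W' P (\<lambda>a b. tensor_lift G (f a b) y)"
    by (rule tensor_lift_param[OF G P.abelian_group_axioms _ _ V'.tensor_product_axioms y])
      (use f param in \<open>simp_all add: bilinear_mapD(1)\<close>)
  fix k a b assume k: "k \<in> carrier K" and ab: "a \<in> carrier V'" "b \<in> carrier W'"
  note fab = lift_linear[OF f[OF ab]]
    and fkab = lift_linear[OF f[OF V'.V.smult_closed[OF k ab(1)] ab(2)]]
  show "tensor_lift G (f (k \<odot>\<^bsub>V'\<^esub> a) b) y = k \<odot>\<^bsub>P\<^esub> tensor_lift G (f a b) y"
    using y by (induction rule: tensor_induct)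
      (use k ab in \<open>simp_all add: lift_pure f bilinear_mapD[OF param] P.smult_r_distr
        semilinear_mapD[OF fab] semilinear_mapD[OF fkab]\<close>)
qed

end

lemma linear_map_eqI:
  assumes "linear_map K T P f" "linear_map K T P g"
    and "\<And>v w. \<lbrakk>v \<in> carrier V; w \<in> carrier W\<rbrakk> \<Longrightarrow> f (pure v w) = g (pure v w)"
    and "x \<in> carrier T"
  shows "f x = g x"
  by (rule additive_map_eqI[OF semilinear_mapD(1)[OF assms(1)] semilinear_mapD(1)[OF assms(2)]
        assms(3,4)])

text \<open>A lift applied to \<open>\<Delta> x\<close> plays the role of a Sweedler sum. This is
  rewriting under the sum: the summands agree only on the carriers, so both must be known to be
  bilinear.\<close>

lemma lift_eqI:
  assumes "add_group_of G P" "add_group_of G' P" "module K P"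
    and f: "bilinear_map K V W P f" and g: "bilinear_map K V W P g"
    and "\<And>v w. \<lbrakk>v \<in> carrier V; w \<in> carrier W\<rbrakk> \<Longrightarrow> f v w = g v w"
    and "x \<in> carrier T"
  shows "tensor_lift G f x = tensor_lift G' g x"
  by (rule linear_map_eqI[OF lift_linear lift_linear]) (use assms in \<open>auto simp: lift_pure\<close>)

text \<open>Moves a linear map inside a Sweedler sum.\<close>

lemma lift_comp:
  assumes "add_group_of G P" "add_group_of G' P'" "module K P" "module K P'"
    and f: "bilinear_map K V W P f" and h: "linear_map K P P' h" and "x \<in> carrier T"
  shows "h (tensor_lift G f x) = tensor_lift G' (\<lambda>v w. h (f v w)) x"
  by (rule linear_map_eqI[OF linear_map_comp[OF lift_linear h] lift_linear])
    (use assms bilinear_map_comp[OF f h] in \<open>auto simp: lift_pure\<close>)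

end


section \<open>Tensor products of algebras\<close>

lemma alg_homI:
  assumes "\<And>x. x \<in> carrier A \<Longrightarrow> f x \<in> carrier B"
    and "\<And>x y. \<lbrakk>x \<in> carrier A; y \<in> carrier A\<rbrakk> \<Longrightarrow> f (x \<otimes>\<^bsub>A\<^esub> y) = f x \<otimes>\<^bsub>B\<^esub> f y"
    and "\<And>x y. \<lbrakk>x \<in> carrier A; y \<in> carrier A\<rbrakk> \<Longrightarrow> f (x \<oplus>\<^bsub>A\<^esub> y) = f x \<oplus>\<^bsub>B\<^esub> f y"
    and "f \<one>\<^bsub>A\<^esub> = \<one>\<^bsub>B\<^esub>"
    and "\<And>k x. \<lbrakk>k \<in> carrier K; x \<in> carrier A\<rbrakk> \<Longrightarrow> f (k \<odot>\<^bsub>A\<^esub> x) = k \<odot>\<^bsub>B\<^esub> f x"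
  shows "f \<in> alg_hom K A B"
  using assms by (auto simp: alg_hom_def intro!: ring_hom_memI)

lemma alg_homD:
  assumes "f \<in> alg_hom K A B"
  shows "f \<in> ring_hom A B" and "linear_map K A B f"
    and "\<And>x. x \<in> carrier A \<Longrightarrow> f x \<in> carrier B"
    and "\<And>x y. \<lbrakk>x \<in> carrier A; y \<in> carrier A\<rbrakk> \<Longrightarrow> f (x \<otimes>\<^bsub>A\<^esub> y) = f x \<otimes>\<^bsub>B\<^esub> f y"
    and "\<And>x y. \<lbrakk>x \<in> carrier A; y \<in> carrier A\<rbrakk> \<Longrightarrow> f (x \<oplus>\<^bsub>A\<^esub> y) = f x \<oplus>\<^bsub>B\<^esub> f y"
    and "f \<one>\<^bsub>A\<^esub> = \<one>\<^bsub>B\<^esub>"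
    and "\<And>k x. \<lbrakk>k \<in> carrier K; x \<in> carrier A\<rbrakk> \<Longrightarrow> f (k \<odot>\<^bsub>A\<^esub> x) = k \<odot>\<^bsub>B\<^esub> f x"
  using assms by (auto simp: alg_hom_def ring_hom_def intro!: linear_mapI)

lemma alg_hom_comp:
  assumes f: "f \<in> alg_hom K A B" and g: "g \<in> alg_hom K B C"
  shows "(\<lambda>x. g (f x)) \<in> alg_hom K A C"
  by (rule alg_homI) (simp_all add: alg_homD(3-)[OF f] alg_homD(3-)[OF g])

lemma alg_hom_id: "(\<lambda>x. x) \<in> alg_hom K A A"
  by (rule alg_homI) auto

lemma mult_bilinear:
  fixes K :: "'k ring" and A :: "('k, 'a) module"
  assumes "assoc_algebra K A"
  shows "bilinear_map K A A A (\<lambda>x y. x \<otimes>\<^bsub>A\<^esub> y)"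
proof -
  interpret assoc_algebra K A by fact
  show ?thesis
    by (rule bilinear_mapI) (simp_all add: l_distr r_distr smult_mult_left smult_mult_right)
qed

lemma (in algebra) assoc_algebra: "assoc_algebra R M"
proof -
  have "x \<otimes>\<^bsub>M\<^esub> (k \<odot>\<^bsub>M\<^esub> y) = k \<odot>\<^bsub>M\<^esub> (x \<otimes>\<^bsub>M\<^esub> y)"
    if "k \<in> carrier R" "x \<in> carrier M" "y \<in> carrier M" for k x y
    using that smult_assoc2[of k y x] m_comm[of x "k \<odot>\<^bsub>M\<^esub> y"] m_comm[of x y] by simp
  then show ?thesis
    by (intro assoc_algebra.intro assoc_algebra_axioms.intro)
      (auto simp: module smult_assoc2 cring.axioms(1)[OF M_cring])
qed

locale algebra_tensor = A: assoc_algebra K A + B: assoc_algebra K B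
  for K :: "'k ring" and A :: "('k, 'a) module" and B :: "('k, 'b) module"

sublocale algebra_tensor \<subseteq> vector_tensor K A B
  by unfold_locales

context algebra_tensor begin

lemma mult_eq: "x \<otimes>\<^bsub>T\<^esub> y = tensor_lift (ktensor_group K A B) (\<lambda>a b.
    tensor_lift (ktensor_group K A B) (\<lambda>a' b'. pure (a \<otimes>\<^bsub>A\<^esub> a') (b \<otimes>\<^bsub>B\<^esub> b')) y) x"
  by (simp add: tensor_algebra_def Let_def)

lemma one_eq: "\<one>\<^bsub>T\<^esub> = pure \<one>\<^bsub>A\<^esub> \<one>\<^bsub>B\<^esub>"
  by (simp add: tensor_algebra_def Let_def)

lemma mult_inner_bilinear:
  assumes "a \<in> carrier A" "b \<in> carrier B"
  shows "bilinear_map K A B T (\<lambda>a' b'. pure (a \<otimes>\<^bsub>A\<^esub> a') (b \<otimes>\<^bsub>B\<^esub> b'))"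
    and "bilinear_map K A B T (\<lambda>a' b'. pure (a' \<otimes>\<^bsub>A\<^esub> a) (b' \<otimes>\<^bsub>B\<^esub> b))"
  by (rule bilinear_map_comp2[OF pure_bilinear bilinear_map_linear(1)[OF mult_bilinear[OF A.assoc_algebra_axioms]]
        bilinear_map_linear(1)[OF mult_bilinear[OF B.assoc_algebra_axioms]]]; fact)
    (rule bilinear_map_comp2[OF pure_bilinear bilinear_map_linear(2)[OF mult_bilinear[OF A.assoc_algebra_axioms]]
        bilinear_map_linear(2)[OF mult_bilinear[OF B.assoc_algebra_axioms]]]; fact)

lemmas lift_T = add_group_of_tensor_group module_tensor

lemma mult_outer_bilinear:
  "y \<in> carrier T \<Longrightarrow> bilinear_map K A B T (\<lambda>a b.
    tensor_lift (ktensor_group K A B) (\<lambda>a' b'. pure (a \<otimes>\<^bsub>A\<^esub> a') (b \<otimes>\<^bsub>B\<^esub> b')) y)"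
  by (rule lift_param[OF lift_T mult_inner_bilinear(1) mult_inner_bilinear(2) vector_tensor_axioms])

lemma mult_linear_left: "y \<in> carrier T \<Longrightarrow> linear_map K T T (\<lambda>x. x \<otimes>\<^bsub>T\<^esub> y)"
  unfolding mult_eq by (rule lift_linear[OF lift_T mult_outer_bilinear])

lemma mult_pure_left: "\<lbrakk>a \<in> carrier A; b \<in> carrier B; y \<in> carrier T\<rbrakk> \<Longrightarrow> pure a b \<otimes>\<^bsub>T\<^esub> y =
    tensor_lift (ktensor_group K A B) (\<lambda>a' b'. pure (a \<otimes>\<^bsub>A\<^esub> a') (b \<otimes>\<^bsub>B\<^esub> b')) y"
  unfolding mult_eq by (rule lift_pure[OF lift_T mult_outer_bilinear])

lemma mult_pure: "\<lbrakk>a \<in> carrier A; b \<in> carrier B; a' \<in> carrier A; b' \<in> carrier B\<rbrakk> \<Longrightarrow>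
    pure a b \<otimes>\<^bsub>T\<^esub> pure a' b' = pure (a \<otimes>\<^bsub>A\<^esub> a') (b \<otimes>\<^bsub>B\<^esub> b')"
  by (simp add: mult_pure_left lift_pure[OF lift_T mult_inner_bilinear(1)])

text \<open>The product is a lift in \<open>x\<close>, so linearity in \<open>y\<close> is not
  automatic; it follows by induction on \<open>x\<close> from the linearity of the inner
  lift.\<close>

lemma mult_linear_right:
  assumes "x \<in> carrier T"
  shows "linear_map K T T (\<lambda>y. x \<otimes>\<^bsub>T\<^esub> y)"
proof -
  interpret T: module K T by (rule module_tensor)
  note left = semilinear_mapD[OF mult_linear_left]
  note inner = semilinear_mapD[OF lift_linear[OF lift_T mult_inner_bilinear(1)]]
  show ?thesis
  proof (rule linear_mapI)
    fix y y' assume y: "y \<in> carrier T" "y' \<in> carrier T"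
    show "x \<otimes>\<^bsub>T\<^esub> (y \<oplus>\<^bsub>T\<^esub> y') = x \<otimes>\<^bsub>T\<^esub> y \<oplus>\<^bsub>T\<^esub> x \<otimes>\<^bsub>T\<^esub> y'"
      using assms by (induction rule: tensor_induct)
        (use y in \<open>simp_all add: mult_pure_left inner left T.M.a_ac\<close>)
  next
    fix k y assume y: "k \<in> carrier K" "y \<in> carrier T"
    show "x \<otimes>\<^bsub>T\<^esub> (k \<odot>\<^bsub>T\<^esub> y) = k \<odot>\<^bsub>T\<^esub> (x \<otimes>\<^bsub>T\<^esub> y)"
      using assms by (induction rule: tensor_induct)
        (use y in \<open>simp_all add: mult_pure_left inner left T.smult_r_distr\<close>)
  qed (use assms in \<open>simp add: left\<close>)
qed

lemma assoc_algebra_tensor: "assoc_algebra K T"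
proof -
  interpret T: module K T by (rule module_tensor)
  note left = semilinear_mapD[OF mult_linear_left] and right = semilinear_mapD[OF mult_linear_right]
  have one: "\<one>\<^bsub>T\<^esub> \<in> carrier T" by (simp add: one_eq)
  have l_one: "\<one>\<^bsub>T\<^esub> \<otimes>\<^bsub>T\<^esub> x = x" if "x \<in> carrier T" for x
    using that by (induction rule: tensor_induct) (simp_all add: right one, simp add: one_eq mult_pure)
  have r_one: "x \<otimes>\<^bsub>T\<^esub> \<one>\<^bsub>T\<^esub> = x" if "x \<in> carrier T" for x
    using that by (induction rule: tensor_induct) (simp_all add: left one, simp add: one_eq mult_pure)
  have assoc: "(x \<otimes>\<^bsub>T\<^esub> y) \<otimes>\<^bsub>T\<^esub> z = x \<otimes>\<^bsub>T\<^esub> (y \<otimes>\<^bsub>T\<^esub> z)"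
    if x: "x \<in> carrier T" and y: "y \<in> carrier T" and z: "z \<in> carrier T" for x y z
    using x
  proof (induction rule: tensor_induct)
    case x: (pure a b)
    show ?case using y
    proof (induction rule: tensor_induct)
      case y: (pure a' b')
      show ?case using z
        by (induction rule: tensor_induct)
          (use x y in \<open>simp_all add: mult_pure A.m_assoc B.m_assoc right\<close>)
    qed (use x z in \<open>simp add: left right\<close>)
  qed (use y z in \<open>simp add: left right\<close>)
  have "ring T"
    by (rule ringI[OF T.M.abelian_group_axioms monoidI])
      (simp_all add: one l_one r_one assoc left right)
  then show ?thesis
    by (intro assoc_algebra.intro assoc_algebra_axioms.intro module_tensor)
      (simp_all add: left right)
qed

text \<open>\<open>\<mu>\<close> is kept apart from \<open>s a \<otimes> t b\<close> so that the theorem applies to lifts of maps that are not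
  literally of this form.\<close>

theorem lift_alg_hom:
  assumes C: "assoc_algebra K C" and G: "add_group_of G C"
    and s: "s \<in> alg_hom K A C" and t: "t \<in> alg_hom K B C"
    and comm: "\<And>a b. \<lbrakk>a \<in> carrier A; b \<in> carrier B\<rbrakk> \<Longrightarrow> s a \<otimes>\<^bsub>C\<^esub> t b = t b \<otimes>\<^bsub>C\<^esub> s a"
    and \<mu>: "\<And>a b. \<lbrakk>a \<in> carrier A; b \<in> carrier B\<rbrakk> \<Longrightarrow> \<mu> a b = s a \<otimes>\<^bsub>C\<^esub> t b"
  shows "bilinear_map K A B C \<mu>"
    and "tensor_lift G \<mu> \<in> alg_hom K T C"
    and "\<lbrakk>a \<in> carrier A; b \<in> carrier B\<rbrakk> \<Longrightarrow> tensor_lift G \<mu> (pure a b) = s a \<otimes>\<^bsub>C\<^esub> t b"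
proof -
  interpret C: assoc_algebra K C by (rule C)
  interpret T: assoc_algebra K T by (rule assoc_algebra_tensor)
  note sD = alg_homD(3-)[OF s] and tD = alg_homD(3-)[OF t]
  show bil: "bilinear_map K A B C \<mu>"
    by (rule bilinear_mapI)
      (simp_all add: \<mu> sD tD C.l_distr C.r_distr C.smult_mult_left C.smult_mult_right)
  note pure = lift_pure[OF G C.module_axioms bil]
  note lin = semilinear_mapD[OF lift_linear[OF G C.module_axioms bil]]
  show "tensor_lift G \<mu> \<in> alg_hom K T C"
  proof (rule alg_homI)
    fix x y assume x: "x \<in> carrier T" and y: "y \<in> carrier T"
    show "tensor_lift G \<mu> (x \<otimes>\<^bsub>T\<^esub> y) = tensor_lift G \<mu> x \<otimes>\<^bsub>C\<^esub> tensor_lift G \<mu> y"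
      using x
    proof (induction rule: tensor_induct)
      case ab: (pure a b)
      show ?case using y
      proof (induction rule: tensor_induct)
        case ab': (pure a' b')
        \<comment> \<open>The interchange of \<open>s a'\<close> and \<open>t b\<close> is where
          commutation of the two images is used.\<close>
        have "s a \<otimes>\<^bsub>C\<^esub> (s a' \<otimes>\<^bsub>C\<^esub> t b) \<otimes>\<^bsub>C\<^esub> t b' = s a \<otimes>\<^bsub>C\<^esub> (t b \<otimes>\<^bsub>C\<^esub> s a') \<otimes>\<^bsub>C\<^esub> t b'"
          using ab ab' comm by simp
        then show ?case
          using ab ab' by (simp add: mult_pure pure \<mu> sD tD C.m_assoc)
      qed (use ab in \<open>simp add: lin T.r_distr C.r_distr\<close>)
    qed (use y in \<open>simp add: lin T.l_distr C.l_distr\<close>)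
  qed (simp_all add: lin, simp add: one_eq pure \<mu> sD tD)
  show "\<lbrakk>a \<in> carrier A; b \<in> carrier B\<rbrakk> \<Longrightarrow> tensor_lift G \<mu> (pure a b) = s a \<otimes>\<^bsub>C\<^esub> t b"
    by (simp add: pure \<mu>)
qed

lemma left_inclusion: "(\<lambda>a. pure a \<one>\<^bsub>B\<^esub>) \<in> alg_hom K A T"
  by (rule alg_homI) (simp_all add: mult_pure pure_add_left one_eq smult_pure)

lemma right_inclusion: "(\<lambda>b. pure \<one>\<^bsub>A\<^esub> b) \<in> alg_hom K B T"
  by (rule alg_homI)
    (simp_all add: mult_pure pure_add_right one_eq bilinear_mapD[OF pure_bilinear])

text \<open>Supplies the commutation hypothesis of \<open>lift_alg_hom\<close> when one factor is
  commutative and the other is arbitrary.\<close>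

lemma left_inclusion_central:
  assumes "a \<in> carrier A" "\<And>a'. a' \<in> carrier A \<Longrightarrow> a \<otimes>\<^bsub>A\<^esub> a' = a' \<otimes>\<^bsub>A\<^esub> a" "x \<in> carrier T"
  shows "pure a \<one>\<^bsub>B\<^esub> \<otimes>\<^bsub>T\<^esub> x = x \<otimes>\<^bsub>T\<^esub> pure a \<one>\<^bsub>B\<^esub>"
proof -
  note left = semilinear_mapD[OF mult_linear_left] and right = semilinear_mapD[OF mult_linear_right]
  show ?thesis
    using assms(3) by (induction rule: tensor_induct)
      (use assms(1,2) in \<open>simp_all add: mult_pure left right\<close>)
qed

end

lemma tensor_map_alg_hom:
  assumes "algebra_tensor K A B" "algebra_tensor K C D"
    and f: "f \<in> alg_hom K A C" and g: "g \<in> alg_hom K B D"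
  shows "tensor_map K C D f g \<in> alg_hom K (tensor_algebra K A B) (tensor_algebra K C D)"
    and "\<lbrakk>a \<in> carrier A; b \<in> carrier B\<rbrakk> \<Longrightarrow>
      tensor_map K C D f g (ktensor K A B a b) = ktensor K C D (f a) (g b)"
proof -
  interpret AB: algebra_tensor K A B by fact
  interpret CD: algebra_tensor K C D by fact
  note lift = AB.lift_alg_hom[OF CD.assoc_algebra_tensor CD.add_group_of_tensor_group
      alg_hom_comp[OF f CD.left_inclusion] alg_hom_comp[OF g CD.right_inclusion],
      where \<mu> = "\<lambda>a b. ktensor K C D (f a) (g b)"]
  show "tensor_map K C D f g \<in> alg_hom K (tensor_algebra K A B) (tensor_algebra K C D)"
    unfolding tensor_map_def
    by (rule lift(2)) (simp_all add: CD.mult_pure alg_homD(3)[OF f] alg_homD(3)[OF g])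
  show "tensor_map K C D f g (ktensor K A B a b) = ktensor K C D (f a) (g b)"
    if "a \<in> carrier A" "b \<in> carrier B"
    unfolding tensor_map_def
    by (subst lift(3)) (use that in \<open>simp_all add: CD.mult_pure alg_homD(3)[OF f] alg_homD(3)[OF g]\<close>)
qed

text \<open>Multiplicativity comes from presenting the associator as the lift of two commuting
  homomorphisms: \<open>s\<close>, with
  \<open>s (a \<otimes> b) = a \<otimes> (b \<otimes> 1)\<close>, and
  \<open>c \<mapsto> 1 \<otimes> (1 \<otimes> c)\<close>.\<close>

lemma tensor_assoc_alg_hom:
  assumes "assoc_algebra K A" "assoc_algebra K B" "assoc_algebra K C"
  shows "tensor_assoc K A B C \<in> alg_hom K (tensor_algebra K (tensor_algebra K A B) C)
      (tensor_algebra K A (tensor_algebra K B C))"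
    and "\<lbrakk>x \<in> carrier (tensor_algebra K A B); c \<in> carrier C\<rbrakk> \<Longrightarrow>
      tensor_assoc K A B C (ktensor K (tensor_algebra K A B) C x c) =
      tensor_lift (ktensor_group K A (tensor_algebra K B C))
        (\<lambda>a b. ktensor K A (tensor_algebra K B C) a (ktensor K B C b c)) x"
    and "\<lbrakk>a \<in> carrier A; b \<in> carrier B; c \<in> carrier C\<rbrakk> \<Longrightarrow>
      tensor_assoc K A B C (ktensor K (tensor_algebra K A B) C (ktensor K A B a b) c) =
      ktensor K A (tensor_algebra K B C) a (ktensor K B C b c)"
proof -
  interpret A: assoc_algebra K A by fact
  interpret B: assoc_algebra K B by fact
  interpret C: assoc_algebra K C by fact
  interpret AB: algebra_tensor K A B by unfold_locales
  interpret BC: algebra_tensor K B C by unfold_locales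
  interpret X: assoc_algebra K "tensor_algebra K A B" by (rule AB.assoc_algebra_tensor)
  interpret Y: assoc_algebra K "tensor_algebra K B C" by (rule BC.assoc_algebra_tensor)
  interpret XC: algebra_tensor K "tensor_algebra K A B" C by unfold_locales
  interpret AY: algebra_tensor K A "tensor_algebra K B C" by unfold_locales
  interpret Z: assoc_algebra K "tensor_algebra K A (tensor_algebra K B C)"
    by (rule AY.assoc_algebra_tensor)
  let ?G = "ktensor_group K A (tensor_algebra K B C)"
  let ?pAY = "ktensor K A (tensor_algebra K B C)" and ?pBC = "ktensor K B C"
  define s where "s = tensor_lift ?G (\<lambda>a b. ?pAY a (?pBC b \<one>\<^bsub>C\<^esub>))"
  define F where "F x c = tensor_lift ?G (\<lambda>a b. ?pAY a (?pBC b c)) x" for x c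
  have comm: "?pAY a \<one>\<^bsub>tensor_algebra K B C\<^esub> \<otimes>\<^bsub>tensor_algebra K A (tensor_algebra K B C)\<^esub>
      ?pAY \<one>\<^bsub>A\<^esub> y = ?pAY a y"
    "?pAY \<one>\<^bsub>A\<^esub> y \<otimes>\<^bsub>tensor_algebra K A (tensor_algebra K B C)\<^esub>
      ?pAY a \<one>\<^bsub>tensor_algebra K B C\<^esub> = ?pAY a y"
    if "a \<in> carrier A" "y \<in> carrier (tensor_algebra K B C)" for a y
    using that by (simp_all add: AY.mult_pure)
  note s_lift = AB.lift_alg_hom[OF AY.assoc_algebra_tensor AY.add_group_of_tensor_group
      AY.left_inclusion alg_hom_comp[OF BC.left_inclusion AY.right_inclusion],
      where \<mu> = "\<lambda>a b. ?pAY a (?pBC b \<one>\<^bsub>C\<^esub>)", folded s_def]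
  have s: "s \<in> alg_hom K (tensor_algebra K A B) (tensor_algebra K A (tensor_algebra K B C))"
    by (rule s_lift(2)) (simp_all add: comm)
  have s_pure: "s (ktensor K A B a b) = ?pAY a (?pBC b \<one>\<^bsub>C\<^esub>)"
    if "a \<in> carrier A" "b \<in> carrier B" for a b
    by (subst s_lift(3)) (use that in \<open>simp_all add: comm\<close>)
  have F_bil: "bilinear_map K A B (tensor_algebra K A (tensor_algebra K B C)) (\<lambda>a b. ?pAY a (?pBC b c))"
    if "c \<in> carrier C" for c
    by (rule bilinear_map_comp2[OF AY.pure_bilinear semilinear_map_id
          bilinear_map_linear(2)[OF BC.pure_bilinear that]])
  note F_lin = semilinear_mapD[OF AB.lift_linear[OF AY.add_group_of_tensor_group AY.module_tensor F_bil]]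
    and F_pure = AB.lift_pure[OF AY.add_group_of_tensor_group AY.module_tensor F_bil]
  have F_eq: "F x c = s x \<otimes>\<^bsub>tensor_algebra K A (tensor_algebra K B C)\<^esub> ?pAY \<one>\<^bsub>A\<^esub> (?pBC \<one>\<^bsub>B\<^esub> c)"
    and st_comm: "s x \<otimes>\<^bsub>tensor_algebra K A (tensor_algebra K B C)\<^esub> ?pAY \<one>\<^bsub>A\<^esub> (?pBC \<one>\<^bsub>B\<^esub> c) =
      ?pAY \<one>\<^bsub>A\<^esub> (?pBC \<one>\<^bsub>B\<^esub> c) \<otimes>\<^bsub>tensor_algebra K A (tensor_algebra K B C)\<^esub> s x"
    if x: "x \<in> carrier (tensor_algebra K A B)" and c: "c \<in> carrier C" for x c
    using x by (induction rule: AB.tensor_induct)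
      (use c in \<open>simp_all add: F_def F_pure F_lin s_pure alg_homD(3-)[OF s] AY.mult_pure BC.mult_pure
        Z.l_distr Z.r_distr\<close>)
  note lift = XC.lift_alg_hom[OF AY.assoc_algebra_tensor AY.add_group_of_tensor_group s
      alg_hom_comp[OF BC.right_inclusion AY.right_inclusion] st_comm F_eq]
  have assoc_eq: "tensor_assoc K A B C = tensor_lift ?G F"
    by (simp add: tensor_assoc_def Let_def F_def[abs_def])
  show "tensor_assoc K A B C \<in> alg_hom K (tensor_algebra K (tensor_algebra K A B) C)
      (tensor_algebra K A (tensor_algebra K B C))"
    unfolding assoc_eq by (rule lift(2))
  show pure: "tensor_assoc K A B C (ktensor K (tensor_algebra K A B) C x c) =
      tensor_lift ?G (\<lambda>a b. ?pAY a (?pBC b c)) x"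
    if "x \<in> carrier (tensor_algebra K A B)" "c \<in> carrier C" for x c
    unfolding assoc_eq using that by (simp add: lift(3) F_eq[symmetric]) (simp add: F_def)
  show "\<lbrakk>a \<in> carrier A; b \<in> carrier B; c \<in> carrier C\<rbrakk> \<Longrightarrow>
      tensor_assoc K A B C (ktensor K (tensor_algebra K A B) C (ktensor K A B a b) c) = ?pAY a (?pBC b c)"
    by (simp add: pure F_pure)
qed

section \<open>Trilinear maps, inverses of homomorphisms, and contraction by the counit\<close>

lemma bilinear_map_flip:
  "bilinear_map K V W P f \<Longrightarrow> bilinear_map K W V P (\<lambda>w v. f v w)"
  by (rule bilinear_mapI) (simp_all add: bilinear_mapD)

context vector_tensor begin

text \<open>Currying for trilinear maps: lifting two of three variables leaves a bilinear map, which
  can be lifted again to the threefold tensor product.\<close>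

lemma lift_bilinear:
  assumes G: "add_group_of G P" and P: "module K P" and U: "module K U"
    and f: "\<And>u. u \<in> carrier U \<Longrightarrow> bilinear_map K V W P (f u)"
    and lin: "\<And>v w. \<lbrakk>v \<in> carrier V; w \<in> carrier W\<rbrakk> \<Longrightarrow> linear_map K U P (\<lambda>u. f u v w)"
  shows "bilinear_map K U T P (\<lambda>u x. tensor_lift G (f u) x)"
proof -
  interpret P: module K P by (rule P)
  interpret U: module K U by (rule U)
  note lift = semilinear_mapD[OF lift_linear[OF G P f]] and pure = lift_pure[OF G P f]
    and lin = semilinear_mapD[OF lin]
  show ?thesis
  proof (rule bilinear_mapI)
    show "tensor_lift G (f (u \<oplus>\<^bsub>U\<^esub> u')) x = tensor_lift G (f u) x \<oplus>\<^bsub>P\<^esub> tensor_lift G (f u') x"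
      if "u \<in> carrier U" "u' \<in> carrier U" "x \<in> carrier T" for u u' x
      using that(3) by (induction rule: tensor_induct)
        (use that(1,2) in \<open>simp_all add: pure lin lift P.M.a_ac\<close>)
    show "tensor_lift G (f (k \<odot>\<^bsub>U\<^esub> u)) x = k \<odot>\<^bsub>P\<^esub> tensor_lift G (f u) x"
      if "k \<in> carrier K" "u \<in> carrier U" "x \<in> carrier T" for k u x
      using that(3) by (induction rule: tensor_induct)
        (use that(1,2) in \<open>simp_all add: pure lin lift P.smult_r_distr\<close>)
  qed (simp_all add: lift)
qed

end

text \<open>Only set-theoretic inverse properties of \<open>g\<close> are asked, so multiplicativity
  of a merely linear construction can be deduced from that of its inverse.\<close>

lemma alg_hom_inverse:
  assumes f: "f \<in> alg_hom K A B" and A: "assoc_algebra K A"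
    and g: "\<And>y. y \<in> carrier B \<Longrightarrow> g y \<in> carrier A"
    and fg: "\<And>y. y \<in> carrier B \<Longrightarrow> f (g y) = y" and gf: "\<And>x. x \<in> carrier A \<Longrightarrow> g (f x) = x"
  shows "g \<in> alg_hom K B A"
proof -
  interpret A: assoc_algebra K A by (rule A)
  note fD = alg_homD(3-)[OF f]
  have eqI: "g y = x" if "x \<in> carrier A" "f x = y" for x y
    using gf that by blast
  show ?thesis
    by (rule alg_homI; (rule eqI)?) (simp_all add: g fD fg)
qed

lemma alg_hom_cong:
  assumes "f \<in> alg_hom K A B" "assoc_algebra K A" "\<And>x. x \<in> carrier A \<Longrightarrow> g x = f x"
  shows "g \<in> alg_hom K A B"
proof -
  interpret A: assoc_algebra K A by fact
  show ?thesis
    by (rule alg_homI) (simp_all add: assms(3) alg_homD(3-)[OF assms(1)])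
qed

lemma scalar_alg_hom:
  assumes A: "assoc_algebra K A" and \<epsilon>: "\<epsilon> \<in> alg_hom K H (base_ring_algebra K)"
  shows "(\<lambda>h. \<epsilon> h \<odot>\<^bsub>A\<^esub> \<one>\<^bsub>A\<^esub>) \<in> alg_hom K H A"
proof -
  interpret A: assoc_algebra K A by (rule A)
  note \<epsilon>D = alg_homD(3-)[OF \<epsilon>, simplified base_ring_algebra_def, simplified]
  show ?thesis
    by (rule alg_homI)
      (simp_all add: \<epsilon>D A.smult_l_distr A.smult_mult_left A.smult_assoc1)
qed

lemma contract_left_alg_hom:
  assumes H: "assoc_algebra K H" and A: "assoc_algebra K A"
    and \<epsilon>: "\<epsilon> \<in> alg_hom K H (base_ring_algebra K)"
  shows "contract_left A \<epsilon> \<in> alg_hom K (tensor_algebra K H A) A"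
    and "\<lbrakk>h \<in> carrier H; a \<in> carrier A\<rbrakk> \<Longrightarrow> contract_left A \<epsilon> (ktensor K H A h a) = \<epsilon> h \<odot>\<^bsub>A\<^esub> a"
    and "bilinear_map K H A A (\<lambda>h a. \<epsilon> h \<odot>\<^bsub>A\<^esub> a)"
proof -
  interpret H: assoc_algebra K H by (rule H)
  interpret A: assoc_algebra K A by (rule A)
  interpret HA: algebra_tensor K H A by unfold_locales
  have \<epsilon>c: "\<epsilon> h \<in> carrier K" if "h \<in> carrier H" for h
    using alg_homD(3)[OF \<epsilon> that] by (simp add: base_ring_algebra_def)
  note lift = HA.lift_alg_hom[OF A A.add_group_of_add_monoid scalar_alg_hom[OF A \<epsilon>] alg_hom_id,
      where \<mu> = "\<lambda>h a. \<epsilon> h \<odot>\<^bsub>A\<^esub> a"]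
  show "contract_left A \<epsilon> \<in> alg_hom K (tensor_algebra K H A) A"
    unfolding contract_left_def
    by (rule lift(2)) (simp_all add: \<epsilon>c A.smult_mult_left A.smult_mult_right)
  show "contract_left A \<epsilon> (ktensor K H A h a) = \<epsilon> h \<odot>\<^bsub>A\<^esub> a" if "h \<in> carrier H" "a \<in> carrier A"
    unfolding contract_left_def
    by (subst lift(3)) (use that in \<open>simp_all add: \<epsilon>c A.smult_mult_left A.smult_mult_right\<close>)
  show "bilinear_map K H A A (\<lambda>h a. \<epsilon> h \<odot>\<^bsub>A\<^esub> a)"
    by (rule lift(1)) (simp_all add: \<epsilon>c A.smult_mult_left A.smult_mult_right)
qed

lemma contract_right_alg_hom:
  assumes H: "assoc_algebra K H" and A: "assoc_algebra K A"
    and \<epsilon>: "\<epsilon> \<in> alg_hom K H (base_ring_algebra K)"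
  shows "contract_right A \<epsilon> \<in> alg_hom K (tensor_algebra K A H) A"
    and "bilinear_map K A H A (\<lambda>a h. \<epsilon> h \<odot>\<^bsub>A\<^esub> a)"
proof -
  interpret H: assoc_algebra K H by (rule H)
  interpret A: assoc_algebra K A by (rule A)
  interpret AH: algebra_tensor K A H by unfold_locales
  have \<epsilon>c: "\<epsilon> h \<in> carrier K" if "h \<in> carrier H" for h
    using alg_homD(3)[OF \<epsilon> that] by (simp add: base_ring_algebra_def)
  note lift = AH.lift_alg_hom[OF A A.add_group_of_add_monoid alg_hom_id scalar_alg_hom[OF A \<epsilon>],
      where \<mu> = "\<lambda>a h. \<epsilon> h \<odot>\<^bsub>A\<^esub> a"]
  show "contract_right A \<epsilon> \<in> alg_hom K (tensor_algebra K A H) A"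
    unfolding contract_right_def
    by (rule lift(2)) (simp_all add: \<epsilon>c A.smult_mult_left A.smult_mult_right)
  show "bilinear_map K A H A (\<lambda>a h. \<epsilon> h \<odot>\<^bsub>A\<^esub> a)"
    by (rule lift(1)) (simp_all add: \<epsilon>c A.smult_mult_left A.smult_mult_right)
qed


section \<open>Hopf algebras\<close>

context commutative_hopf_algebra begin

lemma assoc_algebra_H: "assoc_algebra K H"
  by (rule assoc_algebra)

lemma module_H: "module K H"
  by (rule module)

lemma add_group_of_H: "add_group_of (add_monoid H) H"
  by (rule abelian_group.add_group_of_add_monoid[OF module.axioms(2)[OF module_H]])

lemma algebra_tensor_H: "assoc_algebra K A \<Longrightarrow> algebra_tensor K H A"
  by (rule algebra_tensor.intro[OF assoc_algebra_H])

lemma left_inclusion_H_central: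
  assumes "assoc_algebra K A" "h \<in> carrier H" "x \<in> carrier (tensor_algebra K H A)"
  shows "ktensor K H A h \<one>\<^bsub>A\<^esub> \<otimes>\<^bsub>tensor_algebra K H A\<^esub> x =
    x \<otimes>\<^bsub>tensor_algebra K H A\<^esub> ktensor K H A h \<one>\<^bsub>A\<^esub>"
  by (rule algebra_tensor.left_inclusion_central[OF algebra_tensor_H]) (use assms m_comm in auto)

section \<open>Coassociativity in Sweedler form and the antipode\<close>

lemmas comultD = alg_homD[OF comult_hom]

lemma counit_closed: "h \<in> carrier H \<Longrightarrow> \<epsilon> h \<in> carrier K"
  using alg_homD(3)[OF counit_hom] by (simp add: base_ring_algebra_def)

lemma antipode_linear_map: "linear_map K H H S"
  using antipode_linear by (simp add: left_module_hom_iff)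

text \<open>A trilinear map \<open>\<phi>\<close> induces a linear \<open>\<Phi>\<close> on
  \<open>H \<otimes> (H \<otimes> H)\<close>; evaluating \<open>\<Phi>\<close> on both sides of the
  coassociativity axiom gives the two iterated sums.\<close>

lemma coassoc_trilinear:
  assumes P: "module K P" and G: "add_group_of G P"
    and \<phi>: "\<And>a. a \<in> carrier H \<Longrightarrow> bilinear_map K H H P (\<phi> a)"
    and \<phi>': "\<And>c. c \<in> carrier H \<Longrightarrow> bilinear_map K H H P (\<lambda>a b. \<phi> a b c)"
    and x: "x \<in> carrier H"
  shows "tensor_lift G (\<lambda>a b. tensor_lift G (\<phi> a) (\<Delta> b)) (\<Delta> x) =
    tensor_lift G (\<lambda>a b. tensor_lift G (\<lambda>a1 a2. \<phi> a1 a2 b) (\<Delta> a)) (\<Delta> x)"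
proof -
  let ?HH = "tensor_algebra K H H"
  let ?HHH = "tensor_algebra K H ?HH"
  interpret HH: algebra_tensor K H H by (rule algebra_tensor_H[OF assoc_algebra_H])
  interpret HHH: algebra_tensor K H ?HH by (rule algebra_tensor_H[OF HH.assoc_algebra_tensor])
  have HH_H: "algebra_tensor K ?HH H"
    by (rule algebra_tensor.intro[OF HH.assoc_algebra_tensor assoc_algebra_H])
  note lin = bilinear_map_linear
  have bil: "bilinear_map K H ?HH P (\<lambda>a y. tensor_lift G (\<phi> a) y)"
    by (rule HH.lift_bilinear[OF G P module_H \<phi> lin(2)[OF \<phi>']])
  have bil': "bilinear_map K ?HH H P (\<lambda>y b. tensor_lift G (\<lambda>a1 a2. \<phi> a1 a2 b) y)"
    by (rule bilinear_map_flip[OF HH.lift_bilinear[OF G P module_H \<phi>' lin(1)[OF \<phi>]]])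
  define \<Phi> where "\<Phi> = tensor_lift G (\<lambda>a y. tensor_lift G (\<phi> a) y)"
  have \<Phi>: "linear_map K ?HHH P \<Phi>"
    unfolding \<Phi>_def by (rule HHH.lift_linear[OF G P bil])
  have \<Phi>_pure: "\<Phi> (ktensor K H ?HH a y) = tensor_lift G (\<phi> a) y"
    if "a \<in> carrier H" "y \<in> carrier ?HH" for a y
    unfolding \<Phi>_def by (rule HHH.lift_pure[OF G P bil that])
  note id\<Delta> = tensor_map_alg_hom[OF HH.algebra_tensor_axioms HHH.algebra_tensor_axioms alg_hom_id[of K H]
      comult_hom, folded id_def]
  note \<Delta>id = tensor_map_alg_hom[OF HH.algebra_tensor_axioms HH_H comult_hom alg_hom_id[of K H],
      folded id_def]
  note assoc = tensor_assoc_alg_hom[OF assoc_algebra_H assoc_algebra_H assoc_algebra_H]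
  have "tensor_lift G (\<lambda>a b. tensor_lift G (\<phi> a) (\<Delta> b)) (\<Delta> x) =
      \<Phi> (tensor_map K H ?HH id \<Delta> (\<Delta> x))"
  proof (rule HH.linear_map_eqI[OF HH.lift_linear[OF G P] linear_map_comp[OF alg_homD(2)[OF id\<Delta>(1)] \<Phi>]])
    show bil\<Delta>: "bilinear_map K H H P (\<lambda>a b. tensor_lift G (\<phi> a) (\<Delta> b))"
      by (rule bilinear_map_comp2[OF bil semilinear_map_id comultD(2)])
  qed (simp_all add: HH.lift_pure[OF G P bilinear_map_comp2[OF bil semilinear_map_id comultD(2)]]
      id\<Delta>(2) \<Phi>_pure comultD(3) x)
  also have "\<dots> = \<Phi> (tensor_assoc K H H H (tensor_map K ?HH H \<Delta> id (\<Delta> x)))"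
    by (simp add: coassoc x)
  also have "\<dots> = tensor_lift G (\<lambda>a b. tensor_lift G (\<lambda>a1 a2. \<phi> a1 a2 b) (\<Delta> a)) (\<Delta> x)"
  proof (rule HH.linear_map_eqI[OF
        linear_map_comp[OF linear_map_comp[OF alg_homD(2)[OF \<Delta>id(1)] alg_homD(2)[OF assoc(1)]] \<Phi>]
        HH.lift_linear[OF G P]])
    show bil\<Delta>': "bilinear_map K H H P (\<lambda>a b. tensor_lift G (\<lambda>a1 a2. \<phi> a1 a2 b) (\<Delta> a))"
      by (rule bilinear_map_comp2[OF bil' comultD(2) semilinear_map_id])
    fix a b assume ab: "a \<in> carrier H" "b \<in> carrier H"
    have "\<Phi> (tensor_lift (ktensor_group K H ?HH) (\<lambda>a1 a2. ktensor K H ?HH a1 (ktensor K H H a2 b)) (\<Delta> a)) =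
        tensor_lift G (\<lambda>a1 a2. \<Phi> (ktensor K H ?HH a1 (ktensor K H H a2 b))) (\<Delta> a)"
      by (rule HH.lift_comp[OF HHH.add_group_of_tensor_group G HHH.module_tensor P _ \<Phi>])
        (auto intro!: bilinear_map_comp2[OF HHH.pure_bilinear semilinear_map_id]
          lin(2)[OF HH.pure_bilinear] comultD ab)
    also have "\<dots> = tensor_lift G (\<lambda>a1 a2. \<phi> a1 a2 b) (\<Delta> a)"
      by (rule HH.lift_eqI[OF G G P bilinear_map_comp[OF _ \<Phi>] \<phi>'])
        (auto intro!: bilinear_map_comp2[OF HHH.pure_bilinear semilinear_map_id]
          lin(2)[OF HH.pure_bilinear] comultD ab simp: \<Phi>_pure HH.lift_pure[OF G P \<phi>] ab)
    finally show "\<Phi> (tensor_assoc K H H H (tensor_map K ?HH H \<Delta> id (ktensor K H H a b))) =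
        tensor_lift G (\<lambda>a b. tensor_lift G (\<lambda>a1 a2. \<phi> a1 a2 b) (\<Delta> a)) (ktensor K H H a b)"
      using ab by (simp add: \<Delta>id(2) assoc(2) comultD(3) HH.lift_pure[OF G P bil\<Delta>'])
  qed (simp add: comultD(3) x)
  finally show ?thesis .
qed

text \<open>With \<open>\<phi> a b = S(a) b\<close> this is \<open>S(x\<^sub>1) x\<^sub>2 \<otimes> x\<^sub>3 = 1 \<otimes> x\<close>, and with \<open>\<phi> a b = a S(b)\<close> it is
  \<open>x\<^sub>1 S(x\<^sub>2) \<otimes> x\<^sub>3 = 1 \<otimes> x\<close>.\<close>

lemma convolution_cancel:
  assumes \<phi>: "bilinear_map K H H H \<phi>" and x: "x \<in> carrier H"
    and conv: "\<And>h. h \<in> carrier H \<Longrightarrow> tensor_lift (add_monoid H) \<phi> (\<Delta> h) = \<epsilon> h \<odot>\<^bsub>H\<^esub> \<one>\<^bsub>H\<^esub>"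
  shows "tensor_lift (ktensor_group K H H)
      (\<lambda>a b. tensor_lift (ktensor_group K H H) (\<lambda>b1 b2. ktensor K H H (\<phi> a b1) b2) (\<Delta> b)) (\<Delta> x) =
    ktensor K H H \<one>\<^bsub>H\<^esub> x"
proof -
  let ?HH = "tensor_algebra K H H" and ?G = "ktensor_group K H H" and ?p = "ktensor K H H"
  interpret HH: algebra_tensor K H H by (rule algebra_tensor_H[OF assoc_algebra_H])
  note \<phi>lin = bilinear_map_linear[OF \<phi>] and plin = bilinear_map_linear[OF HH.pure_bilinear]
  have G: "add_group_of ?G ?HH" and mHH: "module K ?HH" and aH: "add_group_of (add_monoid H) H"
    by (rule HH.add_group_of_tensor_group HH.module_tensor add_group_of_H)+
  have bil1: "bilinear_map K H H ?HH (\<lambda>b c. ?p (\<phi> a b) c)" if "a \<in> carrier H" for a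
    by (rule bilinear_map_comp2[OF HH.pure_bilinear \<phi>lin(1)[OF that] semilinear_map_id])
  have bil2: "bilinear_map K H H ?HH (\<lambda>a b. ?p (\<phi> a b) c)" if "c \<in> carrier H" for c
    by (rule bilinear_map_comp[OF \<phi> plin(2)[OF that]])
  note contract = contract_left_alg_hom[OF assoc_algebra_H assoc_algebra_H counit_hom]
  have inner: "tensor_lift ?G (\<lambda>a1 a2. ?p (\<phi> a1 a2) b) (\<Delta> a) = ?p \<one>\<^bsub>H\<^esub> (\<epsilon> a \<odot>\<^bsub>H\<^esub> b)"
    if ab: "a \<in> carrier H" "b \<in> carrier H" for a b
  proof -
    have "?p (tensor_lift (add_monoid H) \<phi> (\<Delta> a)) b = tensor_lift ?G (\<lambda>a1 a2. ?p (\<phi> a1 a2) b) (\<Delta> a)"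
      by (rule HH.lift_comp[OF aH G module_H mHH \<phi> plin(2)[OF ab(2)] comultD(3)[OF ab(1)]])
    then show ?thesis
      using ab by (simp add: conv counit_closed bilinear_mapD(5,6)[OF HH.pure_bilinear])
  qed
  have bil3: "bilinear_map K H H ?HH (\<lambda>a b. ?p \<one>\<^bsub>H\<^esub> (\<epsilon> a \<odot>\<^bsub>H\<^esub> b))"
    by (rule bilinear_map_comp[OF contract(3) plin(1)]) simp
  \<comment> \<open>Coassociativity moves the second coproduct to the left factor, where
    \<open>\<phi>\<close> meets a full coproduct and becomes the counit; the counit axiom then
    removes it.\<close>
  have "tensor_lift ?G (\<lambda>a b. tensor_lift ?G (\<lambda>b1 b2. ?p (\<phi> a b1) b2) (\<Delta> b)) (\<Delta> x) =
      tensor_lift ?G (\<lambda>a b. tensor_lift ?G (\<lambda>a1 a2. ?p (\<phi> a1 a2) b) (\<Delta> a)) (\<Delta> x)"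
    by (rule coassoc_trilinear[OF mHH G bil1 bil2 x])
  also have "\<dots> = tensor_lift ?G (\<lambda>a b. ?p \<one>\<^bsub>H\<^esub> (\<epsilon> a \<odot>\<^bsub>H\<^esub> b)) (\<Delta> x)"
    by (rule HH.lift_eqI[OF G G mHH _ bil3 _ comultD(3)[OF x]])
      (auto intro: bilinear_mapI simp: inner bilinear_mapD[OF bil3])
  also have "\<dots> = ?p \<one>\<^bsub>H\<^esub> (tensor_lift (add_monoid H) (\<lambda>a b. \<epsilon> a \<odot>\<^bsub>H\<^esub> b) (\<Delta> x))"
    by (rule HH.lift_comp[OF aH G module_H mHH contract(3) plin(1) comultD(3)[OF x], symmetric]) simp
  also have "\<dots> = ?p \<one>\<^bsub>H\<^esub> x"
    using counit_left[OF x] by (simp add: contract_left_def)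
  finally show ?thesis .
qed

text \<open>The endomorphism \<open>h \<otimes> a \<mapsto> (h \<otimes> 1) \<Delta>(a)\<close> of the algebra \<open>H \<otimes> H\<close> has the linear inverse
  \<open>h \<otimes> a \<mapsto> h S(a\<^sub>1) \<otimes> a\<^sub>2\<close>, which is thus multiplicative, and \<open>S\<close> is read off from it.\<close>

theorem antipode_alg_hom: "S \<in> alg_hom K H H"
proof -
  let ?HH = "tensor_algebra K H H" and ?G = "ktensor_group K H H" and ?p = "ktensor K H H"
  interpret HH: algebra_tensor K H H by (rule algebra_tensor_H[OF assoc_algebra_H])
  interpret A: assoc_algebra K ?HH by (rule HH.assoc_algebra_tensor)
  have G: "add_group_of ?G ?HH" and mHH: "module K ?HH" and aH: "add_group_of (add_monoid H) H"
    by (rule HH.add_group_of_tensor_group HH.module_tensor add_group_of_H)+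
  have HHa: "assoc_algebra K ?HH" by (rule HH.assoc_algebra_tensor)
  note SD = semilinear_mapD[OF antipode_linear_map]
  \<comment> \<open>Commutativity of \<open>H\<close> makes \<open>h \<otimes> 1\<close> commute
    with \<open>\<Delta> a\<close>, so that \<open>\<beta>\<close> is multiplicative by the
    universal property.\<close>
  define \<beta> where "\<beta> = tensor_lift ?G (\<lambda>h a. ?p h \<one>\<^bsub>H\<^esub> \<otimes>\<^bsub>?HH\<^esub> \<Delta> a)"
  have comm: "?p h \<one>\<^bsub>H\<^esub> \<otimes>\<^bsub>?HH\<^esub> \<Delta> a = \<Delta> a \<otimes>\<^bsub>?HH\<^esub> ?p h \<one>\<^bsub>H\<^esub>"
    if "h \<in> carrier H" "a \<in> carrier H" for h a
    by (rule left_inclusion_H_central[OF assoc_algebra_H that(1) comultD(3)[OF that(2)]])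
  note \<beta>_lift = HH.lift_alg_hom[OF HHa G HH.left_inclusion comult_hom comm refl, folded \<beta>_def]
  have \<beta>_hom: "\<beta> \<in> alg_hom K ?HH ?HH"
    by (rule \<beta>_lift(2))
  note \<beta>D = alg_homD(3-)[OF \<beta>_hom]

  have S1_bil: "bilinear_map K H H ?HH (\<lambda>a b. ?p (S a) b)"
    by (rule bilinear_map_comp2[OF HH.pure_bilinear antipode_linear_map semilinear_map_id])
  \<comment> \<open>\<open>S \<otimes> id\<close>, so that \<open>\<sigma> (\<Delta> a)\<close> is
    \<open>S(a\<^sub>1) \<otimes> a\<^sub>2\<close>.\<close>
  define \<sigma> where "\<sigma> = tensor_lift ?G (\<lambda>a b. ?p (S a) b)"
  have \<sigma>: "linear_map K ?HH ?HH \<sigma>"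
    unfolding \<sigma>_def by (rule HH.lift_linear[OF G mHH S1_bil])
  note \<sigma>D = semilinear_mapD[OF \<sigma>]
  have \<gamma>_bil: "bilinear_map K H H ?HH (\<lambda>h a. ?p h \<one>\<^bsub>H\<^esub> \<otimes>\<^bsub>?HH\<^esub> \<sigma> (\<Delta> a))"
    by (rule bilinear_map_comp2[OF mult_bilinear[OF HHa] alg_homD(2)[OF HH.left_inclusion]
          linear_map_comp[OF comultD(2) \<sigma>]])
  define \<gamma> where "\<gamma> = tensor_lift ?G (\<lambda>h a. ?p h \<one>\<^bsub>H\<^esub> \<otimes>\<^bsub>?HH\<^esub> \<sigma> (\<Delta> a))"
  have \<gamma>: "linear_map K ?HH ?HH \<gamma>"
    unfolding \<gamma>_def by (rule HH.lift_linear[OF G mHH \<gamma>_bil])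
  note \<gamma>D = semilinear_mapD[OF \<gamma>]
  have \<gamma>_pure: "\<gamma> (?p h a) = ?p h \<one>\<^bsub>H\<^esub> \<otimes>\<^bsub>?HH\<^esub> \<sigma> (\<Delta> a)" if "h \<in> carrier H" "a \<in> carrier H" for h a
    unfolding \<gamma>_def by (rule HH.lift_pure[OF G mHH \<gamma>_bil that])
  \<comment> \<open>Linearity over the left factor reduces \<open>\<gamma> \<beta> = id\<close> to
    the value of \<open>\<gamma>\<close> on \<open>\<Delta> a\<close>.\<close>
  have \<gamma>_left: "\<gamma> (?p h \<one>\<^bsub>H\<^esub> \<otimes>\<^bsub>?HH\<^esub> x) = ?p h \<one>\<^bsub>H\<^esub> \<otimes>\<^bsub>?HH\<^esub> \<gamma> x"
    if h: "h \<in> carrier H" and x: "x \<in> carrier ?HH" for h x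
    using x
  proof (induction rule: HH.tensor_induct)
    case (pure h' a)
    then show ?case
      using h A.m_assoc[of "?p h \<one>\<^bsub>H\<^esub>" "?p h' \<one>\<^bsub>H\<^esub>" "\<sigma> (\<Delta> a)"]
      by (simp add: HH.mult_pure \<gamma>_pure \<sigma>D comultD)
  qed (use h in \<open>simp add: \<gamma>D A.r_distr\<close>)

  have left_mult: "?p h \<one>\<^bsub>H\<^esub> \<otimes>\<^bsub>?HH\<^esub> tensor_lift ?G q y = tensor_lift ?G (\<lambda>v w. ?p h \<one>\<^bsub>H\<^esub> \<otimes>\<^bsub>?HH\<^esub> q v w) y"
    if "h \<in> carrier H" "bilinear_map K H H ?HH q" "y \<in> carrier ?HH" for h q y
    by (rule HH.lift_comp[OF G G mHH mHH that(2) HH.mult_linear_right that(3)]) (simp add: that(1))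

  define c where "c \<phi> a b = tensor_lift ?G (\<lambda>b1 b2. ?p (\<phi> a b1) b2) (\<Delta> b)"
    for \<phi> :: "'h \<Rightarrow> 'h \<Rightarrow> 'h" and a b
  \<comment> \<open>The sum is \<open>a\<^sub>1 S(a\<^sub>2) \<otimes> a\<^sub>3\<close>, hence the
    right antipode law.\<close>
  have \<gamma>\<Delta>: "\<gamma> (\<Delta> a) = ?p \<one>\<^bsub>H\<^esub> a" if a: "a \<in> carrier H" for a
  proof -
    have bil: "bilinear_map K H H H (\<lambda>a b. a \<otimes>\<^bsub>H\<^esub> S b)"
      by (rule bilinear_map_comp2[OF mult_bilinear[OF assoc_algebra_H] semilinear_map_id antipode_linear_map])
    have eq: "?p a1 \<one>\<^bsub>H\<^esub> \<otimes>\<^bsub>?HH\<^esub> \<sigma> (\<Delta> a2) = c (\<lambda>a b. a \<otimes>\<^bsub>H\<^esub> S b) a1 a2"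
      if "a1 \<in> carrier H" "a2 \<in> carrier H" for a1 a2
      unfolding c_def \<sigma>_def left_mult[OF that(1) S1_bil comultD(3)[OF that(2)]]
      by (rule HH.lift_eqI[OF G G mHH bilinear_map_comp[OF S1_bil HH.mult_linear_right]
            bilinear_map_comp2[OF HH.pure_bilinear bilinear_map_linear(1)[OF bil that(1)] semilinear_map_id]])
        (use that in \<open>simp_all add: HH.mult_pure SD comultD\<close>)
    have "\<gamma> (\<Delta> a) = tensor_lift ?G (c (\<lambda>a b. a \<otimes>\<^bsub>H\<^esub> S b)) (\<Delta> a)"
      unfolding \<gamma>_def
      by (rule HH.lift_eqI[OF G G mHH \<gamma>_bil _ eq comultD(3)[OF a]])
        (auto intro: bilinear_mapI simp: eq[symmetric] bilinear_mapD[OF \<gamma>_bil])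
    also have "\<dots> = ?p \<one>\<^bsub>H\<^esub> a"
      unfolding c_def[abs_def] by (rule convolution_cancel[OF bil a antipode_right])
    finally show ?thesis .
  qed
  \<comment> \<open>The sum is \<open>S(a\<^sub>1) a\<^sub>2 \<otimes> a\<^sub>3\<close>, hence the
    left antipode law.\<close>
  have \<beta>\<sigma>\<Delta>: "\<beta> (\<sigma> (\<Delta> a)) = ?p \<one>\<^bsub>H\<^esub> a" if a: "a \<in> carrier H" for a
  proof -
    have bil: "bilinear_map K H H H (\<lambda>a b. S a \<otimes>\<^bsub>H\<^esub> b)"
      by (rule bilinear_map_comp2[OF mult_bilinear[OF assoc_algebra_H] antipode_linear_map semilinear_map_id])
    have \<beta>lin: "linear_map K ?HH ?HH \<beta>" by (rule alg_homD(2)[OF \<beta>_hom])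
    have eq: "\<beta> (?p (S a1) a2) = c (\<lambda>a b. S a \<otimes>\<^bsub>H\<^esub> b) a1 a2"
      if "a1 \<in> carrier H" "a2 \<in> carrier H" for a1 a2
    proof -
      \<comment> \<open>Allows \<open>\<Delta> a2\<close> to be written out as its own Sweedler sum,
        into which the left factor can then be multiplied.\<close>
      have lift_p: "tensor_lift ?G ?p y = y" if "y \<in> carrier ?HH" for y
        by (rule HH.linear_map_eqI[OF HH.lift_linear[OF G mHH HH.pure_bilinear] semilinear_map_id _ that])
          (simp add: HH.lift_pure[OF G mHH HH.pure_bilinear])
      have "\<beta> (?p (S a1) a2) = ?p (S a1) \<one>\<^bsub>H\<^esub> \<otimes>\<^bsub>?HH\<^esub> tensor_lift ?G ?p (\<Delta> a2)"
        using that by (simp add: \<beta>_lift(3) SD lift_p comultD(3))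
      also have "\<dots> = c (\<lambda>a b. S a \<otimes>\<^bsub>H\<^esub> b) a1 a2"
        unfolding c_def left_mult[OF SD(2)[OF that(1)] HH.pure_bilinear comultD(3)[OF that(2)]]
        by (rule HH.lift_eqI[OF G G mHH bilinear_map_comp[OF HH.pure_bilinear HH.mult_linear_right]
              bilinear_map_comp2[OF HH.pure_bilinear bilinear_map_linear(1)[OF bil that(1)] semilinear_map_id]])
          (use that in \<open>simp_all add: HH.mult_pure SD comultD\<close>)
      finally show ?thesis .
    qed
    have \<beta>S: "bilinear_map K H H ?HH (\<lambda>a1 a2. \<beta> (?p (S a1) a2))"
      by (rule bilinear_map_comp[OF S1_bil \<beta>lin])
    have "\<beta> (\<sigma> (\<Delta> a)) = tensor_lift ?G (\<lambda>a1 a2. \<beta> (?p (S a1) a2)) (\<Delta> a)"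
      unfolding \<sigma>_def by (rule HH.lift_comp[OF G G mHH mHH S1_bil \<beta>lin comultD(3)[OF a]])
    also have "\<dots> = tensor_lift ?G (c (\<lambda>a b. S a \<otimes>\<^bsub>H\<^esub> b)) (\<Delta> a)"
      by (rule HH.lift_eqI[OF G G mHH \<beta>S _ eq comultD(3)[OF a]])
        (auto intro: bilinear_mapI simp: eq[symmetric] bilinear_mapD[OF \<beta>S])
    also have "\<dots> = ?p \<one>\<^bsub>H\<^esub> a"
      unfolding c_def[abs_def] by (rule convolution_cancel[OF bil a antipode_left])
    finally show ?thesis .
  qed
  have \<beta>_left: "\<beta> (?p h \<one>\<^bsub>H\<^esub>) = ?p h \<one>\<^bsub>H\<^esub>" if "h \<in> carrier H" for h
    using that by (simp add: \<beta>_lift(3) comultD)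
  have \<beta>\<gamma>_pure: "\<beta> (\<gamma> (?p h a)) = ?p h a" if "h \<in> carrier H" "a \<in> carrier H" for h a
  proof -
    have "\<beta> (\<gamma> (?p h a)) = \<beta> (?p h \<one>\<^bsub>H\<^esub>) \<otimes>\<^bsub>?HH\<^esub> \<beta> (\<sigma> (\<Delta> a))"
      unfolding \<gamma>_pure[OF that] by (rule \<beta>D(2)) (simp_all add: that \<sigma>D comultD(3))
    also have "\<dots> = ?p h a"
      using that by (simp add: \<beta>_left \<beta>\<sigma>\<Delta> HH.mult_pure)
    finally show ?thesis .
  qed
  have "\<gamma> \<in> alg_hom K ?HH ?HH"
  proof (rule alg_hom_inverse[OF \<beta>_hom HHa])
    show "\<beta> (\<gamma> y) = y" if "y \<in> carrier ?HH" for y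
      by (rule HH.linear_map_eqI[OF linear_map_comp[OF \<gamma> alg_homD(2)[OF \<beta>_hom]] semilinear_map_id _ that])
        (rule \<beta>\<gamma>_pure)
    show "\<gamma> (\<beta> x) = x" if "x \<in> carrier ?HH" for x
      by (rule HH.linear_map_eqI[OF linear_map_comp[OF alg_homD(2)[OF \<beta>_hom] \<gamma>] semilinear_map_id _ that])
        (simp add: \<beta>_lift(3) \<gamma>_left comultD(3) \<gamma>\<Delta> HH.mult_pure)
  qed (simp add: \<gamma>D)
  note contract = contract_right_alg_hom[OF assoc_algebra_H assoc_algebra_H counit_hom]
  \<comment> \<open>From \<open>\<gamma> (1 \<otimes> a) = S(a\<^sub>1) \<otimes> a\<^sub>2\<close>,
    contracting the second factor leaves \<open>S\<close> applied to the right counit axiom. Thus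
    \<open>S\<close> is a composite of algebra homomorphisms.\<close>
  have "S a = contract_right H \<epsilon> (\<gamma> (?p \<one>\<^bsub>H\<^esub> a))" if a: "a \<in> carrier H" for a
  proof -
    have "\<gamma> (?p \<one>\<^bsub>H\<^esub> a) = \<sigma> (\<Delta> a)"
      using a by (simp add: \<gamma>_pure \<sigma>D comultD(3) HH.one_eq[symmetric])
    then have "contract_right H \<epsilon> (\<gamma> (?p \<one>\<^bsub>H\<^esub> a)) =
        tensor_lift (add_monoid H) (\<lambda>v w. contract_right H \<epsilon> (?p (S v) w)) (\<Delta> a)"
      unfolding \<sigma>_def
      using HH.lift_comp[OF G aH mHH module_H S1_bil alg_homD(2)[OF contract(1)] comultD(3)[OF a]]
      by simp
    also have "\<dots> = tensor_lift (add_monoid H) (\<lambda>v w. S (\<epsilon> w \<odot>\<^bsub>H\<^esub> v)) (\<Delta> a)"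
      by (rule HH.lift_eqI[OF aH aH module_H bilinear_map_comp[OF S1_bil alg_homD(2)[OF contract(1)]]
            bilinear_map_comp[OF contract(2) antipode_linear_map] _ comultD(3)[OF a]])
        (simp add: contract_right_def HH.lift_pure[OF aH module_H contract(2)] SD counit_closed)
    also have "\<dots> = S (contract_right H \<epsilon> (\<Delta> a))"
      unfolding contract_right_def
      by (rule HH.lift_comp[OF aH aH module_H module_H contract(2) antipode_linear_map
            comultD(3)[OF a], symmetric])
    also have "\<dots> = S a" by (simp add: counit_right a)
    finally show ?thesis by simp
  qed
  then show ?thesis
    by (intro alg_hom_cong[OF alg_hom_comp[OF alg_hom_comp[OF HH.right_inclusion
              \<open>\<gamma> \<in> alg_hom K ?HH ?HH\<close>] contract(1)] assoc_algebra_H])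
qed

end


section \<open>The module \<open>H \<otimes> M\<close>\<close>

locale tensor_with_module = H: algebra K H + A: assoc_algebra K A + M: left_module A M
  for K :: "'k ring" and H :: "('k, 'h) module" and A :: "('k, 'a) module" and M :: "('a, 'm) module"
begin

abbreviation (input) "V \<equiv> scalars_module A M"
abbreviation (input) "HA \<equiv> tensor_algebra K H A"
abbreviation (input) "HV \<equiv> tensor_algebra K H V"
abbreviation (input) "HM \<equiv> tensor_module K H A M"
abbreviation (input) "GV \<equiv> ktensor_group K H V"
abbreviation (input) "pV \<equiv> ktensor K H V"

lemma V_simps [simp]:
  "carrier V = carrier M" "ring.add V = ring.add M" "ring.zero V = ring.zero M"
  "k \<odot>\<^bsub>V\<^esub> m = (k \<odot>\<^bsub>A\<^esub> \<one>\<^bsub>A\<^esub>) \<odot>\<^bsub>M\<^esub> m"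
  by (simp_all add: scalars_module_def restrict_scalars_def)

lemma module_V: "module K V"
proof (rule moduleI)
  show "abelian_group V"
  proof (intro abelian_group.intro abelian_group_axioms.intro)
    show "abelian_monoid V"
      by (rule abelian_monoidI) (simp_all add: M.M.a_ac)
    show "comm_group (add_monoid V)"
      by (rule comm_groupI) (auto simp: M.M.a_ac intro: M.M.l_neg M.M.a_inv_closed)
  qed
qed (simp_all add: H.R_cring M.smult_closed M.smult_r_distr M.smult_one A.smult_l_distr
    M.smult_l_distr M.smult_assoc[symmetric] A.smult_mult_left A.smult_assoc1)

sublocale HA: algebra_tensor K H A
  by (intro algebra_tensor.intro H.assoc_algebra A.assoc_algebra_axioms)

sublocale HV: vector_tensor K H V
  by (intro vector_tensor.intro H.module module_V)

text \<open>\<open>HV\<close> and \<open>HM\<close> share their additive group but carry different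
  scalars, \<open>K\<close> and \<open>H \<otimes> A\<close>. Lifts and inductions are done in
  \<open>HV\<close> and transported along these equations.\<close>

lemma HV_eq: "carrier HV = carrier HM" "ring.add HV = ring.add HM" "ring.zero HV = ring.zero HM"
  by (simp_all add: tensor_algebra_def tensor_module_def Let_def)

lemma action_bilinear: "bilinear_map K A V V (\<lambda>a m. a \<odot>\<^bsub>M\<^esub> m)"
proof (rule bilinear_mapI)
  fix k a m assume "k \<in> carrier K" "a \<in> carrier A" "m \<in> carrier V"
  \<comment> \<open>\<open>K\<close> acts on \<open>M\<close> through \<open>k \<cdot> 1\<close>,
    which is central in \<open>A\<close>; both scalar laws follow.\<close>
  moreover from this have "(k \<odot>\<^bsub>A\<^esub> a) = (k \<odot>\<^bsub>A\<^esub> \<one>\<^bsub>A\<^esub>) \<otimes>\<^bsub>A\<^esub> a" "a \<otimes>\<^bsub>A\<^esub> (k \<odot>\<^bsub>A\<^esub> \<one>\<^bsub>A\<^esub>) = k \<odot>\<^bsub>A\<^esub> a"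
    by (simp_all add: A.smult_mult_left A.smult_mult_right)
  ultimately show "(k \<odot>\<^bsub>A\<^esub> a) \<odot>\<^bsub>M\<^esub> m = k \<odot>\<^bsub>V\<^esub> (a \<odot>\<^bsub>M\<^esub> m)"
    and "a \<odot>\<^bsub>M\<^esub> (k \<odot>\<^bsub>V\<^esub> m) = k \<odot>\<^bsub>V\<^esub> (a \<odot>\<^bsub>M\<^esub> m)"
    by (simp_all add: M.smult_assoc[symmetric])
qed (simp_all add: M.smult_closed M.smult_l_distr M.smult_r_distr)

lemma HM_smult_eq: "y \<odot>\<^bsub>HM\<^esub> x =
    tensor_lift GV (\<lambda>h a. tensor_lift GV (\<lambda>h' m. pV (h \<otimes>\<^bsub>H\<^esub> h') (a \<odot>\<^bsub>M\<^esub> m)) x) y"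
  by (simp add: tensor_module_def Let_def)

lemmas lift_HV = HV.add_group_of_tensor_group HV.module_tensor
lemmas H_mult_linear = bilinear_map_linear[OF mult_bilinear[OF H.assoc_algebra]]

lemma HM_inner_bilinear:
  "\<lbrakk>h \<in> carrier H; a \<in> carrier A\<rbrakk> \<Longrightarrow> bilinear_map K H V HV (\<lambda>h' m. pV (h \<otimes>\<^bsub>H\<^esub> h') (a \<odot>\<^bsub>M\<^esub> m))"
  "\<lbrakk>h' \<in> carrier H; m \<in> carrier V\<rbrakk> \<Longrightarrow> bilinear_map K H A HV (\<lambda>h a. pV (h \<otimes>\<^bsub>H\<^esub> h') (a \<odot>\<^bsub>M\<^esub> m))"
  by (rule bilinear_map_comp2[OF HV.pure_bilinear H_mult_linear(1) bilinear_map_linear(1)[OF action_bilinear]];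
      assumption)
    (rule bilinear_map_comp2[OF HV.pure_bilinear H_mult_linear(2) bilinear_map_linear(2)[OF action_bilinear]];
      assumption)

lemma HM_outer_bilinear: "x \<in> carrier HV \<Longrightarrow> bilinear_map K H A HV
    (\<lambda>h a. tensor_lift GV (\<lambda>h' m. pV (h \<otimes>\<^bsub>H\<^esub> h') (a \<odot>\<^bsub>M\<^esub> m)) x)"
  by (rule HV.lift_param[OF lift_HV HM_inner_bilinear HA.vector_tensor_axioms])

lemma HM_smult_linear: "x \<in> carrier HV \<Longrightarrow> linear_map K HA HV (\<lambda>y. y \<odot>\<^bsub>HM\<^esub> x)"
  unfolding HM_smult_eq by (rule HA.lift_linear[OF lift_HV HM_outer_bilinear])

lemma HM_smult_pure_left: "\<lbrakk>h \<in> carrier H; a \<in> carrier A; x \<in> carrier HV\<rbrakk> \<Longrightarrow>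
    ktensor K H A h a \<odot>\<^bsub>HM\<^esub> x = tensor_lift GV (\<lambda>h' m. pV (h \<otimes>\<^bsub>H\<^esub> h') (a \<odot>\<^bsub>M\<^esub> m)) x"
  unfolding HM_smult_eq by (rule HA.lift_pure[OF lift_HV HM_outer_bilinear])

lemma HM_smult_additive:
  assumes "y \<in> carrier HA" "x \<in> carrier HV" "x' \<in> carrier HV"
  shows "y \<odot>\<^bsub>HM\<^esub> (x \<oplus>\<^bsub>HV\<^esub> x') = y \<odot>\<^bsub>HM\<^esub> x \<oplus>\<^bsub>HV\<^esub> y \<odot>\<^bsub>HM\<^esub> x'"
proof -
  interpret HVm: module K HV by (rule HV.module_tensor)
  note inner = semilinear_mapD[OF HV.lift_linear[OF lift_HV HM_inner_bilinear(1)]]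
    and smult = semilinear_mapD[OF HM_smult_linear]
  show ?thesis
    using assms(1) by (induction rule: HA.tensor_induct)
      (use assms(2,3) in \<open>simp_all add: HM_smult_pure_left inner smult HVm.M.a_ac\<close>)
qed

section \<open>Comparison of \<open>H \<otimes> M\<close> with the extension of scalars along
  \<open>\<eta> \<otimes> id\<close>\<close>

abbreviation (input) "u \<equiv> unit_tensor_id K H A"

lemma unit_tensor_id_alg_hom: "u \<in> alg_hom K A HA"
  using HA.right_inclusion by (simp add: unit_tensor_id_def[abs_def])

sublocale uM: scalar_extension A HA u M
proof (rule scalar_extension.intro)
  show "ring HA" using HA.assoc_algebra_tensor by (rule assoc_algebra.axioms(2))
qed (auto intro: A.ring_axioms M.left_module_axioms alg_homD(1)[OF unit_tensor_id_alg_hom])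

text \<open>The action of \<open>x\<close> on \<open>1 \<otimes> m\<close>; naming this inner lift
  of \<open>unit_ext_ident\<close> lets the outer one be handled by the universal property over
  \<open>A\<close>.\<close>

definition base_action :: "('h, 'a) tensor \<Rightarrow> 'm \<Rightarrow> ('h, 'm) tensor" where
  "base_action x m = tensor_lift GV (\<lambda>h a. pV h (a \<odot>\<^bsub>M\<^esub> m)) x"

lemma unit_ext_ident_eq: "unit_ext_ident K H A M = tensor_lift GV base_action"
  by (simp add: unit_ext_ident_def Let_def base_action_def[abs_def])

lemma base_action_inner_bilinear: "m \<in> carrier M \<Longrightarrow> bilinear_map K H A HV (\<lambda>h a. pV h (a \<odot>\<^bsub>M\<^esub> m))"
  by (rule bilinear_map_comp2[OF HV.pure_bilinear semilinear_map_id
        bilinear_map_linear(2)[OF action_bilinear]]) simp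

lemma base_action_linear: "m \<in> carrier M \<Longrightarrow> linear_map K HA HV (\<lambda>x. base_action x m)"
  unfolding base_action_def by (rule HA.lift_linear[OF lift_HV base_action_inner_bilinear])

lemma base_action_pure: "\<lbrakk>h \<in> carrier H; a \<in> carrier A; m \<in> carrier M\<rbrakk> \<Longrightarrow>
    base_action (ktensor K H A h a) m = pV h (a \<odot>\<^bsub>M\<^esub> m)"
  unfolding base_action_def by (rule HA.lift_pure[OF lift_HV base_action_inner_bilinear])

lemma base_action_smult:
  assumes y: "y \<in> carrier HA" and x: "x \<in> carrier HA" and m: "m \<in> carrier M"
  shows "base_action (y \<otimes>\<^bsub>HA\<^esub> x) m = y \<odot>\<^bsub>HM\<^esub> base_action x m"
  using y
proof (induction rule: HA.tensor_induct)
  case ha: (pure h a)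
  note inner = HV.lift_pure[OF lift_HV HM_inner_bilinear(1)]
  show ?case using x
  proof (induction rule: HA.tensor_induct)
    case (pure h' a')
    then show ?case
      using ha m by (simp add: HA.mult_pure base_action_pure HM_smult_pure_left M.smult_closed
          inner M.smult_assoc)
  next
    case (add x x')
    then show ?case
      using ha m by (simp add: semilinear_mapD[OF HA.mult_linear_right]
          semilinear_mapD[OF base_action_linear] HM_smult_additive)
  qed
next
  case (add y y')
  then show ?case
    using x m by (simp add: semilinear_mapD[OF HA.mult_linear_left] semilinear_mapD[OF HM_smult_linear]
        semilinear_mapD[OF base_action_linear])
qed

text \<open>Balancedness over \<open>A\<close> is the associativity of the action on
  \<open>M\<close>: multiplying \<open>h \<otimes> a'\<close> by \<open>1 \<otimes> a\<close>
  changes only the second factor.\<close>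

lemma base_action_balanced: "balanced_map A HA (\<lambda>b a. b \<otimes>\<^bsub>HA\<^esub> u a) M HV base_action"
proof (rule balanced_mapI)
  interpret HVm: module K HV by (rule HV.module_tensor)
  note lin = semilinear_mapD[OF base_action_linear]
  fix x assume x: "x \<in> carrier HA"
  show "base_action x (m \<oplus>\<^bsub>M\<^esub> m') = base_action x m \<oplus>\<^bsub>HV\<^esub> base_action x m'"
    if "m \<in> carrier M" "m' \<in> carrier M" for m m'
    using x by (induction rule: HA.tensor_induct)
      (use that HV.pure_add_right in \<open>simp_all add: base_action_pure lin M.smult_r_distr
        M.smult_closed HVm.M.a_ac\<close>)
  show "base_action (x \<otimes>\<^bsub>HA\<^esub> u a) m = base_action x (a \<odot>\<^bsub>M\<^esub> m)"
    if "a \<in> carrier A" "m \<in> carrier M" for a m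
    using x by (induction rule: HA.tensor_induct)
      (use that in \<open>simp_all add: base_action_pure lin unit_tensor_id_def HA.mult_pure M.smult_assoc
        M.smult_closed semilinear_mapD[OF HA.mult_linear_left]\<close>)
qed (simp_all add: semilinear_mapD[OF base_action_linear])

lemma unit_ext_ident_semilinear:
  "semilinear_map HA (\<lambda>b. b) (ext_scalars A HA u M) HM (unit_ext_ident K H A M)"
proof -
  note add = uM.tensor_lift_additive[OF HV.add_group_of_tensor_group base_action_balanced,
      folded unit_ext_ident_eq]
  note pure = uM.tensor_lift_pure[OF HV.add_group_of_tensor_group base_action_balanced,
      folded unit_ext_ident_eq]
  show ?thesis
  proof (rule semilinear_mapI)
    show "additive_map (ext_scalars A HA u M) HM (unit_ext_ident K H A M)"
      using add by (simp add: additive_map_def HV_eq)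
    fix y z assume y: "y \<in> carrier HA" and "z \<in> carrier (ext_scalars A HA u M)"
    from this(2) show "unit_ext_ident K H A M (y \<odot>\<^bsub>ext_scalars A HA u M\<^esub> z) =
        y \<odot>\<^bsub>HM\<^esub> unit_ext_ident K H A M z"
      by (induction rule: uM.tensor_induct)
        (use y in \<open>simp_all add: uM.smult_pure pure base_action_smult semilinear_mapD[OF HA.mult_linear_right]
          additive_map_add[OF uM.smult_additive] additive_map_closed[OF uM.smult_additive]
          additive_map_add[OF add] additive_map_closed[OF add] HM_smult_additive\<close>)
  qed
qed

lemma unit_ext_ident_surj:
  assumes "x \<in> carrier HM"
  shows "\<exists>z \<in> carrier (ext_scalars A HA u M). unit_ext_ident K H A M z = x"
proof -
  interpret uMg: abelian_group "ext_scalars A HA u M" by (rule uM.abelian_group_tensor)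
  note ident_pure = uM.tensor_lift_pure[OF HV.add_group_of_tensor_group base_action_balanced,
      folded unit_ext_ident_eq]
  have "x \<in> carrier HV" using assms by (simp add: HV_eq)
  then show ?thesis
  proof (induction rule: HV.tensor_induct)
    case (pure h m)
    then show ?case
      by (intro bexI[of _ "pure_tensor A HA (\<lambda>b a. b \<otimes>\<^bsub>HA\<^esub> u a) M (ktensor K H A h \<one>\<^bsub>A\<^esub>) m"])
        (simp_all add: ident_pure base_action_pure M.smult_one)
  next
    case (add x y)
    then obtain x' y' where "x' \<in> carrier (ext_scalars A HA u M)" "y' \<in> carrier (ext_scalars A HA u M)"
      "unit_ext_ident K H A M x' = x" "unit_ext_ident K H A M y' = y"
      by blast
    then show ?case
      using semilinear_mapD(3)[OF unit_ext_ident_semilinear, of x' y'] uMg.a_closed[of x' y']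
      by (metis HV_eq(2))
  qed
qed

lemma on_unit_ext_semilinear:
  assumes "semilinear_map HA (\<lambda>b. b) HM P \<Theta>"
  shows "semilinear_map HA (\<lambda>b. b) (ext_scalars A HA u M) P (on_unit_ext K H A M \<Theta>)"
  unfolding on_unit_ext_def comp_def
  by (rule semilinear_map_comp[OF unit_ext_ident_semilinear assms]) auto

text \<open>If a composite is bijective and its first map is onto, the second map is bijective:
  every element of \<open>H \<otimes> M\<close> has a preimage, on which injectivity of the
  composite can be used.\<close>

lemma on_unit_ext_bij_betw:
  assumes \<Theta>: "semilinear_map HA (\<lambda>b. b) HM P \<Theta>"
    and bij: "bij_betw (on_unit_ext K H A M \<Theta>) (carrier (ext_scalars A HA u M)) (carrier P)"
  shows "bij_betw \<Theta> (carrier HM) (carrier P)"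
proof -
  let ?I = "unit_ext_ident K H A M" and ?uM = "ext_scalars A HA u M"
  have "?I ` carrier ?uM = carrier HM"
    using unit_ext_ident_surj semilinear_mapD(2)[OF unit_ext_ident_semilinear] by blast
  then show ?thesis
    using bij unfolding on_unit_ext_def bij_betw_def
    by (metis image_comp inj_on_imageI)
qed

end


section \<open>The cocycle of a coaction\<close>

context commutative_hopf_algebra begin

text \<open>The value on \<open>h \<otimes> a\<close> is left as a Sweedler sum over
  \<open>\<Delta> h\<close>, ready for a further linear map to be moved inside it.\<close>

lemma comult_tensor_id_alg_hom:
  assumes A: "assoc_algebra K A"
  defines "HA \<equiv> tensor_algebra K H A"
  shows "comult_tensor_id K H A \<Delta> \<in> alg_hom K HA (tensor_algebra K H HA)"
    and "\<lbrakk>h \<in> carrier H; a \<in> carrier A\<rbrakk> \<Longrightarrow> comult_tensor_id K H A \<Delta> (ktensor K H A h a) =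
      tensor_lift (ktensor_group K H HA) (\<lambda>h1 h2. ktensor K H HA h1 (ktensor K H A h2 a)) (\<Delta> h)"
proof -
  interpret HA: algebra_tensor K H A by (rule algebra_tensor_H[OF A])
  interpret HH: algebra_tensor K H H by (rule algebra_tensor_H[OF assoc_algebra_H])
  have HH_A: "algebra_tensor K (tensor_algebra K H H) A"
    by (rule algebra_tensor.intro[OF HH.assoc_algebra_tensor A])
  note map = tensor_map_alg_hom[OF HA.algebra_tensor_axioms HH_A comult_hom alg_hom_id, folded id_def]
  note assoc = tensor_assoc_alg_hom[OF assoc_algebra_H assoc_algebra_H A]
  show "comult_tensor_id K H A \<Delta> \<in> alg_hom K HA (tensor_algebra K H HA)"
    unfolding comult_tensor_id_def HA_def by (rule alg_hom_comp[OF map(1) assoc(1)])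
  show "\<lbrakk>h \<in> carrier H; a \<in> carrier A\<rbrakk> \<Longrightarrow> comult_tensor_id K H A \<Delta> (ktensor K H A h a) =
      tensor_lift (ktensor_group K H HA) (\<lambda>h1 h2. ktensor K H HA h1 (ktensor K H A h2 a)) (\<Delta> h)"
    unfolding comult_tensor_id_def HA_def by (simp add: map(2) assoc(2) comultD(3))
qed

text \<open>Here \<open>f (h \<otimes> x) = (S(h) \<otimes> 1) x\<close> and \<open>f' (h \<otimes> x) = (h \<otimes> 1) f(d(x))\<close>, that is,
  \<open>f' (h \<otimes> h' \<otimes> a) = h S(h') a\<^sub>-\<^sub>1 \<otimes> a\<^sub>0\<close>. That \<open>f'\<close> is a retraction of \<open>d\<close> needs no new Hopf algebra
  identity, since \<open>f d \<delta> = f D \<delta> = u e \<delta> = u\<close>.\<close>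

theorem coaction_cocycle_iso:
  fixes A :: "('k, 'a) module" and M :: "('a, 'm) module"
  assumes A: "assoc_algebra K A" and coact: "algebra_left_coaction K H \<Delta> \<epsilon> A \<delta>"
    and M: "left_module A M"
    and \<Theta>: "\<Theta> \<in> left_module_hom (tensor_algebra K H A) (tensor_module K H A M)
      (ext_scalars A (tensor_algebra K H A) \<delta> M)"
    and mult: "multiplicativity_condition K H \<Delta> A \<delta> M \<Theta>"
    and unital: "unitality_condition K H \<epsilon> A \<delta> M \<Theta>"
  shows "bij_betw \<Theta> (carrier (tensor_module K H A M))
    (carrier (ext_scalars A (tensor_algebra K H A) \<delta> M))"
proof -
  define HA where "HA = tensor_algebra K H A"
  define HHA where "HHA = tensor_algebra K H HA"
  define u where "u = unit_tensor_id K H A"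
  define u' where "u' = unit_tensor_id K H HA"
  define d where "d = id_tensor_coaction K H A \<delta>"
  define D where "D = comult_tensor_id K H A \<Delta>"
  define e where "e = contract_left A \<epsilon>"
  let ?p = "ktensor K H A" and ?q = "ktensor K H HA" and ?G = "ktensor_group K H A"
  interpret A: assoc_algebra K A by (rule A)
  interpret tensor_with_module K H A M
    by (intro tensor_with_module.intro A M) unfold_locales
  have HA': "algebra_tensor K H A" and HH': "algebra_tensor K H H"
    by (rule algebra_tensor_H A assoc_algebra_H)+
  interpret HH: algebra_tensor K H H by (rule HH')
  have HAa: "assoc_algebra K HA"
    unfolding HA_def by (rule HA.assoc_algebra_tensor)
  interpret HAa: assoc_algebra K HA by (rule HAa)
  interpret HHA: algebra_tensor K H HA by (rule algebra_tensor_H[OF HAa])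
  have HHAa: "assoc_algebra K HHA"
    unfolding HHA_def by (rule HHA.assoc_algebra_tensor)
  have G: "add_group_of ?G HA" and mHA: "module K HA"
    unfolding HA_def by (rule HA.add_group_of_tensor_group HA.module_tensor)+
  have G2: "add_group_of (ktensor_group K H HA) HHA" and mHHA: "module K HHA"
    unfolding HHA_def by (rule HHA.add_group_of_tensor_group HHA.module_tensor)+
  have rings: "ring A" "ring HA" "ring HHA"
    using A HAa HHAa by (auto dest: assoc_algebra.axioms(2))

  have \<delta>: "\<delta> \<in> alg_hom K A HA"
    using coact by (simp add: algebra_left_coaction_def HA_def)
  have d\<delta>: "d (\<delta> a) = D (\<delta> a)" and e\<delta>: "e (\<delta> a) = a" if "a \<in> carrier A" for a
    using coact that by (auto simp: algebra_left_coaction_def d_def D_def e_def)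
  have u: "u \<in> alg_hom K A HA"
    unfolding u_def HA_def by (rule unit_tensor_id_alg_hom)
  have u': "u' \<in> alg_hom K HA HHA"
    using HHA.right_inclusion by (simp add: u'_def unit_tensor_id_def[abs_def] HHA_def)
  note map = tensor_map_alg_hom[OF HA' HHA.algebra_tensor_axioms alg_hom_id \<delta>, folded id_def]
  have d_eq: "d = tensor_map K H HA id \<delta>"
    by (simp add: d_def id_tensor_coaction_def HA_def)
  have d: "d \<in> alg_hom K HA HHA"
    using map(1) by (simp add: d_eq HA_def HHA_def)
  have d_pure: "d (?p h a) = ?q h (\<delta> a)" if "h \<in> carrier H" "a \<in> carrier A" for h a
    using map(2)[OF that] by (simp add: d_eq)
  have D: "D \<in> alg_hom K HA HHA"
    unfolding D_def HA_def HHA_def by (rule comult_tensor_id_alg_hom(1)[OF A])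
  have D_pure: "D (?p h a) = tensor_lift (ktensor_group K H HA) (\<lambda>h1 h2. ?q h1 (?p h2 a)) (\<Delta> h)"
    if "h \<in> carrier H" "a \<in> carrier A" for h a
    using comult_tensor_id_alg_hom(2)[OF A that] by (simp add: D_def HA_def)
  note contract = contract_left_alg_hom[OF assoc_algebra_H A counit_hom]
  have e: "e \<in> alg_hom K HA A"
    using contract(1) by (simp add: e_def HA_def)
  have e_pure: "e (?p h a) = \<epsilon> h \<odot>\<^bsub>A\<^esub> a" if "h \<in> carrier H" "a \<in> carrier A" for h a
    using contract(2)[OF that] by (simp add: e_def)
  note \<delta>D = alg_homD(3-)[OF \<delta>]
  have p_closed: "?p h a \<in> carrier HA" if "h \<in> carrier H" "a \<in> carrier A" for h a
    using that by (simp add: HA_def)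
  have p_mult: "?p h a \<otimes>\<^bsub>HA\<^esub> ?p h' a' = ?p (h \<otimes>\<^bsub>H\<^esub> h') (a \<otimes>\<^bsub>A\<^esub> a')"
    if "h \<in> carrier H" "a \<in> carrier A" "h' \<in> carrier H" "a' \<in> carrier A" for h a h' a'
    using that by (simp add: HA_def HA.mult_pure)
  have p_one: "?p \<one>\<^bsub>H\<^esub> \<one>\<^bsub>A\<^esub> = \<one>\<^bsub>HA\<^esub>"
    by (simp add: HA_def HA.one_eq)
  note SD = alg_homD(3-)[OF antipode_alg_hom]
  have \<iota>: "(\<lambda>h. ?p h \<one>\<^bsub>A\<^esub>) \<in> alg_hom K H HA"
    unfolding HA_def by (rule HA.left_inclusion)
  note \<iota>D = alg_homD(3-)[OF \<iota>]
  have \<iota>_central: "?p h \<one>\<^bsub>A\<^esub> \<otimes>\<^bsub>HA\<^esub> x = x \<otimes>\<^bsub>HA\<^esub> ?p h \<one>\<^bsub>A\<^esub>" if "h \<in> carrier H" "x \<in> carrier HA" for h x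
    using left_inclusion_H_central[OF A] that by (simp add: HA_def)

  \<comment> \<open>The homomorphism property combines multiplicativity of \<open>S\<close> with
    centrality of \<open>h \<otimes> 1\<close>, so the possibly noncommutative factor
    \<open>A\<close> causes no obstruction.\<close>
  define f where "f = tensor_lift ?G (\<lambda>h x. ?p (S h) \<one>\<^bsub>A\<^esub> \<otimes>\<^bsub>HA\<^esub> x)"
  have f: "f \<in> alg_hom K HHA HA"
    unfolding f_def HHA_def
    by (rule HHA.lift_alg_hom(2)[OF HAa G alg_hom_comp[OF antipode_alg_hom \<iota>] alg_hom_id])
      (simp_all add: \<iota>_central SD)
  have f_pure: "f (?q h x) = ?p (S h) \<one>\<^bsub>A\<^esub> \<otimes>\<^bsub>HA\<^esub> x" if "h \<in> carrier H" "x \<in> carrier HA" for h x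
    unfolding f_def
    by (rule HHA.lift_alg_hom(3)[OF HAa G alg_hom_comp[OF antipode_alg_hom \<iota>] alg_hom_id])
      (simp_all add: \<iota>_central SD that)
  have fd: "(\<lambda>x. f (d x)) \<in> alg_hom K HA HA"
    by (rule alg_hom_comp[OF d f])
  \<comment> \<open>Building on \<open>f d\<close>, already an algebra homomorphism, leaves only the
    same centrality to be checked.\<close>
  define f' where "f' = tensor_lift ?G (\<lambda>h x. ?p h \<one>\<^bsub>A\<^esub> \<otimes>\<^bsub>HA\<^esub> f (d x))"
  have f': "f' \<in> alg_hom K HHA HA"
    unfolding f'_def HHA_def
    by (rule HHA.lift_alg_hom(2)[OF HAa G \<iota> fd]) (simp_all add: \<iota>_central alg_homD(3)[OF fd])
  have f'_pure: "f' (?q h x) = ?p h \<one>\<^bsub>A\<^esub> \<otimes>\<^bsub>HA\<^esub> f (d x)" if "h \<in> carrier H" "x \<in> carrier HA" for h x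
    unfolding f'_def
    by (rule HHA.lift_alg_hom(3)[OF HAa G \<iota> fd]) (simp_all add: \<iota>_central alg_homD(3)[OF fd] that)

  have conv: "tensor_lift ?G (\<lambda>h1 h2. ?p (\<phi> h1 h2) \<one>\<^bsub>A\<^esub> \<otimes>\<^bsub>HA\<^esub> y) (\<Delta> h) = \<epsilon> h \<odot>\<^bsub>HA\<^esub> y"
    if \<phi>: "bilinear_map K H H H \<phi>" and h: "h \<in> carrier H" and y: "y \<in> carrier HA"
      and conv: "tensor_lift (add_monoid H) \<phi> (\<Delta> h) = \<epsilon> h \<odot>\<^bsub>H\<^esub> \<one>\<^bsub>H\<^esub>" for \<phi> h y
  proof -
    have lin: "linear_map K H HA (\<lambda>h. ?p h \<one>\<^bsub>A\<^esub> \<otimes>\<^bsub>HA\<^esub> y)"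
      by (rule linear_map_comp[OF alg_homD(2)[OF \<iota>] bilinear_map_linear(2)[OF mult_bilinear[OF HAa] y]])
    have "tensor_lift ?G (\<lambda>h1 h2. ?p (\<phi> h1 h2) \<one>\<^bsub>A\<^esub> \<otimes>\<^bsub>HA\<^esub> y) (\<Delta> h) =
        ?p (\<epsilon> h \<odot>\<^bsub>H\<^esub> \<one>\<^bsub>H\<^esub>) \<one>\<^bsub>A\<^esub> \<otimes>\<^bsub>HA\<^esub> y"
      unfolding conv[symmetric]
      by (rule HH.lift_comp[OF add_group_of_H G module_H mHA \<phi> lin comultD(3)[OF h], symmetric])
    also have "\<dots> = \<epsilon> h \<odot>\<^bsub>HA\<^esub> y"
      using h y by (simp add: \<iota>D counit_closed p_one HAa.smult_mult_left)
    finally show ?thesis .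
  qed
  \<comment> \<open>One scheme for \<open>f D\<close> and \<open>f' D\<close>: on the summands of
    \<open>D (h \<otimes> a)\<close> the map \<open>g\<close> depends on the legs of
    \<open>\<Delta> h\<close> only through \<open>\<phi>\<close>, whose convolution sum is
    \<open>\<epsilon> h\<close>; a fixed factor \<open>y\<close> remains.\<close>
  have eval: "g (D (?p h a)) = \<epsilon> h \<odot>\<^bsub>HA\<^esub> y"
    if g: "g \<in> alg_hom K HHA HA" and \<phi>: "bilinear_map K H H H \<phi>"
      and conv_\<phi>: "tensor_lift (add_monoid H) \<phi> (\<Delta> h) = \<epsilon> h \<odot>\<^bsub>H\<^esub> \<one>\<^bsub>H\<^esub>"
      and h: "h \<in> carrier H" and a: "a \<in> carrier A" and y: "y \<in> carrier HA"
      and g_pure: "\<And>h1 h2. \<lbrakk>h1 \<in> carrier H; h2 \<in> carrier H\<rbrakk> \<Longrightarrow>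
        g (?q h1 (?p h2 a)) = ?p (\<phi> h1 h2) \<one>\<^bsub>A\<^esub> \<otimes>\<^bsub>HA\<^esub> y"
    for g \<phi> h a y
  proof -
    have bil: "bilinear_map K H H HHA (\<lambda>h1 h2. ?q h1 (?p h2 a))"
      unfolding HHA_def HA_def
      by (rule bilinear_map_comp2[OF HHA.pure_bilinear[unfolded HA_def] semilinear_map_id
            bilinear_map_linear(2)[OF HA.pure_bilinear a]])
    have "g (D (?p h a)) = tensor_lift ?G (\<lambda>h1 h2. g (?q h1 (?p h2 a))) (\<Delta> h)"
      unfolding D_pure[OF h a]
      by (rule HH.lift_comp[OF G2 G mHHA mHA bil alg_homD(2)[OF g] comultD(3)[OF h]])
    also have "\<dots> = tensor_lift ?G (\<lambda>h1 h2. ?p (\<phi> h1 h2) \<one>\<^bsub>A\<^esub> \<otimes>\<^bsub>HA\<^esub> y) (\<Delta> h)"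
      by (rule HH.lift_eqI[OF G G mHA bilinear_map_comp[OF bil alg_homD(2)[OF g]]
            bilinear_map_comp[OF \<phi> linear_map_comp[OF alg_homD(2)[OF \<iota>]
                bilinear_map_linear(2)[OF mult_bilinear[OF HAa] y]]] g_pure comultD(3)[OF h]])
    also have "\<dots> = \<epsilon> h \<odot>\<^bsub>HA\<^esub> y"
      by (rule conv[OF \<phi> h y conv_\<phi>])
    finally show ?thesis .
  qed
  note H_mult = mult_bilinear[OF assoc_algebra_H]
  have eqI: "g x = g' x"
    if "linear_map K HA P g" "linear_map K HA P g'"
      "\<And>h a. \<lbrakk>h \<in> carrier H; a \<in> carrier A\<rbrakk> \<Longrightarrow> g (?p h a) = g' (?p h a)" "x \<in> carrier HA"
    for g g' :: "('h, 'a) tensor \<Rightarrow> 'p" and P :: "('k, 'p) module" and x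
    using HA.linear_map_eqI[of P g g' x] that by (simp add: HA_def)
  note comp = alg_homD(2)[OF alg_hom_comp]

  have fD_eq: "f (D x) = u (e x)" if "x \<in> carrier HA" for x
  proof (rule eqI[OF comp[OF D f] comp[OF e u] _ that])
    fix h a assume h: "h \<in> carrier H" and a: "a \<in> carrier A"
    \<comment> \<open>Here \<open>\<phi>\<close> is \<open>S(h\<^sub>1) h\<^sub>2\<close> and the
      remaining factor is \<open>1 \<otimes> a\<close>.\<close>
    have "f (D (?p h a)) = \<epsilon> h \<odot>\<^bsub>HA\<^esub> ?p \<one>\<^bsub>H\<^esub> a"
      by (rule eval[OF f bilinear_map_comp2[OF H_mult antipode_linear_map semilinear_map_id]
            antipode_left[OF h] h a])
        (use a in \<open>simp_all add: p_closed f_pure p_mult SD\<close>)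
    then show "f (D (?p h a)) = u (e (?p h a))"
      using h a alg_homD(7)[OF u] by (simp add: e_pure counit_closed) (simp add: u_def unit_tensor_id_def)
  qed
  have fd\<delta>: "f (d (\<delta> a)) = u a" if "a \<in> carrier A" for a
    using that by (simp add: d\<delta> fD_eq \<delta>D e\<delta>)
  have fd_pure: "f (d (?p h a)) = ?p (S h) \<one>\<^bsub>A\<^esub> \<otimes>\<^bsub>HA\<^esub> \<delta> a" if "h \<in> carrier H" "a \<in> carrier A" for h a
    using that by (simp add: d_pure f_pure \<delta>D)
  have f'D_eq: "f' (D x) = \<delta> (e x)" if "x \<in> carrier HA" for x
  proof (rule eqI[OF comp[OF D f'] comp[OF e \<delta>] _ that])
    fix h a assume h: "h \<in> carrier H" and a: "a \<in> carrier A"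
    \<comment> \<open>Here \<open>\<phi>\<close> is \<open>h\<^sub>1 S(h\<^sub>2)\<close> and the
      remaining factor is \<open>\<delta> a\<close>.\<close>
    have "f' (D (?p h a)) = \<epsilon> h \<odot>\<^bsub>HA\<^esub> \<delta> a"
    proof (rule eval[OF f' bilinear_map_comp2[OF H_mult semilinear_map_id antipode_linear_map]
            antipode_right[OF h] h a])
      fix h1 h2 assume h12: "h1 \<in> carrier H" "h2 \<in> carrier H"
      show "f' (?q h1 (?p h2 a)) = ?p (h1 \<otimes>\<^bsub>H\<^esub> S h2) \<one>\<^bsub>A\<^esub> \<otimes>\<^bsub>HA\<^esub> \<delta> a"
        using h12 a HAa.m_assoc[of "?p h1 \<one>\<^bsub>A\<^esub>" "?p (S h2) \<one>\<^bsub>A\<^esub>" "\<delta> a"]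
        by (simp add: p_closed f'_pure fd_pure p_mult SD \<delta>D)
    qed (simp add: \<delta>D a)
    then show "f' (D (?p h a)) = \<delta> (e (?p h a))"
      using h a by (simp add: e_pure counit_closed \<delta>D)
  qed
  have f'd_eq: "f' (d x) = x" if "x \<in> carrier HA" for x
  proof (rule eqI[OF comp[OF d f'] semilinear_map_id _ that])
    fix h a assume h: "h \<in> carrier H" and a: "a \<in> carrier A"
    then show "f' (d (?p h a)) = ?p h a"
      by (simp add: d_pure f'_pure \<delta>D fd\<delta>) (simp add: u_def unit_tensor_id_def p_mult)
  qed
  have fu': "f (u' x) = x" if "x \<in> carrier HA" for x
    using that by (simp add: u'_def unit_tensor_id_def f_pure SD p_one)
  have du: "d (u a) = u' (\<delta> a)" if "a \<in> carrier A" for a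
    using that by (simp add: u_def u'_def unit_tensor_id_def d_pure)
  have Du: "D (u a) = u' (u a)" if a: "a \<in> carrier A" for a
  proof -
    have "bilinear_map K H H HHA (\<lambda>h1 h2. ?q h1 (?p h2 a))"
      unfolding HHA_def HA_def
      by (rule bilinear_map_comp2[OF HHA.pure_bilinear[unfolded HA_def] semilinear_map_id
            bilinear_map_linear(2)[OF HA.pure_bilinear a]])
    then show ?thesis
      using a by (simp add: u_def u'_def unit_tensor_id_def D_pure comultD(6) HH.one_eq
          HH.lift_pure[OF G2 mHHA])
  qed
  have eu: "e (u a) = a" if "a \<in> carrier A" for a
    using that alg_homD(6)[OF counit_hom] by (simp add: u_def unit_tensor_id_def e_pure base_ring_algebra_def)

  have \<Theta>: "semilinear_map HA (\<lambda>b. b) (tensor_module K H A M) (ext_scalars A HA \<delta> M) \<Theta>"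
    using \<Theta> by (simp add: left_module_hom_iff HA_def)
  \<comment> \<open>The abstract cocycle theorem speaks of
    \<open>(\<eta> \<otimes> id)\<^sup>* M\<close>, so it is applied to \<open>\<Theta>\<close>
    composed with the identification; bijectivity is carried back to \<open>H \<otimes> M\<close>
    afterwards.\<close>
  have "bij_betw (on_unit_ext K H A M \<Theta>) (carrier (ext_scalars A HA u M)) (carrier (ext_scalars A HA \<delta> M))"
  proof (rule cocycle_bijective[OF rings M alg_homD(1)[OF u] alg_homD(1)[OF \<delta>] alg_homD(1)[OF e]
        alg_homD(1)[OF u'] alg_homD(1)[OF d] alg_homD(1)[OF D] alg_homD(1)[OF f] alg_homD(1)[OF f']
        d\<delta> du Du eu e\<delta> fu' fD_eq f'd_eq f'D_eq])
    show "semilinear_map HA (\<lambda>b. b) (ext_scalars A HA u M) (ext_scalars A HA \<delta> M) (on_unit_ext K H A M \<Theta>)"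
      using on_unit_ext_semilinear[of _ \<Theta>] \<Theta> by (simp add: HA_def u_def)
  qed (use mult unital in \<open>simp_all add: multiplicativity_condition_def unitality_condition_def Let_def
      HA_def HHA_def u_def u'_def d_def D_def e_def\<close>)
  then show ?thesis
    using on_unit_ext_bij_betw \<Theta> by (simp add: HA_def u_def)
qed

end

theorem proposition2p7:
  fixes K :: "'k ring" and H :: "('k, 'h) module" and A :: "('k, 'a) module"
    and M :: "('a, 'm) module"
    and \<Delta> :: "'h \<Rightarrow> ('h, 'h) tensor" and \<epsilon> :: "'h \<Rightarrow> 'k" and S :: "'h \<Rightarrow> 'h"
    and \<delta> :: "'a \<Rightarrow> ('h, 'a) tensor"
    and \<Theta> :: "('h, 'm) tensor \<Rightarrow> (('h, 'a) tensor, 'm) tensor"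
  assumes "field K"
    and "commutative_hopf_algebra K H \<Delta> \<epsilon> S"
    and "assoc_algebra K A"
    and "algebra_left_coaction K H \<Delta> \<epsilon> A \<delta>"
    and "left_module A M"
    and "\<Theta> \<in> left_module_hom (tensor_algebra K H A) (tensor_module K H A M)
               (ext_scalars A (tensor_algebra K H A) \<delta> M)"
    and "multiplicativity_condition K H \<Delta> A \<delta> M \<Theta>"
    and "unitality_condition K H \<epsilon> A \<delta> M \<Theta>"
  shows "\<Theta> \<in> left_module_iso (tensor_algebra K H A) (tensor_module K H A M)
               (ext_scalars A (tensor_algebra K H A) \<delta> M)"
  using commutative_hopf_algebra.coaction_cocycle_iso[OF assms(2-8)] assms(6)
  by (simp add: left_module_iso_def)

end
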